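(* Let $T_0:I\to I$, $I=[0,1]$, be a piecewise $C^2$ uniformly expanding map with boundary point $b\in(0,1)$, invariant intervals $I_l=[0,b]$, $I_r=[b,1]$, satisfying (I1)--(I4), and let $(T_\epsilon)_{\epsilon>0}$ be a family of $C^2$-small perturbations of $T_0$ satisfying (P1)--(P2), all as spelled out in the context. Let $\phi_l,\phi_r$ be the densities of the unique absolutely continuous invariant probability measures of $T_0|_{I_l}$, $T_0|_{I_r}$, let $\mathcal L_\epsilon$ be the Perron--Frobenius operator of $T_\epsilon$ acting on $BV$, and for small $\epsilon>0$ let $\rho_\epsilon<1$ be the simple eigenvalue of $\mathcal L_\epsilon$ near $1$ described in the context. Then for each $\epsilon>0$ small enough there is a unique real-valued function $\psi_\epsilon\in BV$ satisfying $$\mathcal L_\epsilon\psi_\epsilon=\rho_\epsilon\psi_\epsilon,\qquad |\psi_\epsilon|_{L^1}=1,\qquad \int_{I_l}\psi_\epsilon\,dx>0,$$ and, as $\epsilon\to0$, $$\psi_\epsilon\longrightarrow \tfrac12\phi_l-\tfrac12\phi_r\quad\text{in }L^1.$$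
   Context: Basic notions. $I=[0,1]$; $L^1=L^1(I,\mathrm{Leb})$ with norm $|f|_{L^1}=\int_I|f|\,dx$. $\mathrm{var}(f)$ is the total variation of $f:I\to\mathbb C$ over $I$; $BV=\{f:I\to\mathbb C:\mathrm{var}(f)<\infty\}$ with the variation norm (functions differing on at most a countable set being identified). A map $T:I\to I$ is piecewise $C^2$ with critical set $\mathcal C=\{0=c_0<c_1<\dots<c_d=1\}$ if for each $i$, $T|_{(c_i,c_{i+1})}$ extends to a $C^2$ function on a neighborhood of $[c_i,c_{i+1}]$. It is uniformly expanding if its minimum expansion $\inf_{x\in I\setminus\mathcal C}|T'(x)|$ is greater than $1$. At a critical point where $T$ is discontinuous, $T$ is considered bi-valued: $T(c_i)$ consists of both one-sided limits $T(c_{i-})$ and $T(c_{i+})$; images $T^k\mathcal C$ and preimages are understood accordingly. Restrictions of $T$ to a closed interval $[a,b']$ use the values $T(a_+)$ and $T(b'_-)$ at the endpoints. ACIM means absolutely continuous (with respect to Lebesgue measure) invariant probability measure. Every function of bounded variation is represented by its version with $f(x)=\frac12\big(f(x^-)+f(x^+)\big)$ at each interior point $x$ (and the one-sided limit at $0$ and $1$). The Perron--Frobenius operator of $T$ is $\mathcal L f(x)=\sum_{i=1}^d f(\xi_i(x))|\xi_i'(x)|1_{J_i}(x)$ for $x\notin T\mathcal C$, where $J_i=T|_{[c_{i-1},c_i]}([c_{i-1},c_i])$ and $\xi_i=(T|_{[c_{i-1},c_i]})^{-1}:J_i\to[c_{i-1},c_i]$. Unperturbed map. $T_0:I\to I$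 is piecewise $C^2$ and uniformly expanding with critical set $\mathcal C_0=\{0=c_{0,0}<\dots<c_{d,0}=1\}$. There is $b\in(0,1)$ such that $I_l=[0,b]$ and $I_r=[b,1]$ satisfy $T_0|_{I_*}(I_* )\subset I_*$ for $*\in\{l,r\}$. The set of infinitesimal holes is $H_0=T_0^{-1}\{b\}\setminus\{b\}$. Assumptions: (I1) For $*\in\{l,r\}$, $T_0|_{I_*}$ has exactly one ACIM $\mu_*$, with density $\phi_*=d\mu_*/dx$ (of bounded variation; regarded as a function on $I$ vanishing outside $I_*$). (I2) For every $k>0$, $(T_0^k\mathcal C_0)\cap H_0=\emptyset$. (I3) $\phi_l>0$ at each point of $H_0\cap I_l$, and $\phi_r>0$ at each point of $H_0\cap I_r$. (I4) Either (a) $\inf_{x\in I\setminus\mathcal C_0}|T_0'(x)|>2$, or (b) $T_0$ has no periodic critical points, except possibly that $0$ or $1$ may be fixed points. Here $c\in\mathcal C_0$ is periodic if $c\in T_0^n(c)$ for some $n>0$ (with $T_0$ possibly bi-valued). Perturbations. $T_\epsilon:I\to I$, $\epsilon>0$, are $C^2$-small perturbations of $T_0$: a critical set for $T_\epsilon$ may be chosen as $\mathcal C_\epsilon=\{0=c_{0,\epsilon}<\dots<c_{d,\epsilon}=1\}$ (same $d$), where each $\epsilon\mapsto c_{i,\epsilon}$ is $C^2$ for $\epsilon\ge0$; and there is $\delta>0$ such that for all sufficiently small $\epsilon$ and each $i$ there is a $C^2$ extension $\hat T_{i,\epsilon}:[c_{i,0}-\delta,c_{i+1,0}+\delta]\to\mathbb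 R$ of $T_\epsilon|_{[c_{i,\epsilon},c_{i+1,\epsilon}]}$, with $\hat T_{i,\epsilon}\to\hat T_{i,0}$ in the $C^2$ topology as $\epsilon\to0$. Assumptions: (P1) For $\epsilon>0$, $T_\epsilon$ has exactly one ACIM $\mu_\epsilon$, with density $\phi_\epsilon=d\mu_\epsilon/dx$. (P2) If $b\notin\mathcal C_0$ (in which case necessarily $T_0(b)=b$), then $T_\epsilon(b)=b$ for all $\epsilon>0$. If $b\in\mathcal C_0$, then $T_0(b_-)<b<T_0(b_+)$ and $b\in\mathcal C_\epsilon$ for all $\epsilon$. The eigenvalue $\rho_\epsilon$. Under these assumptions it is known (Keller, Keller--Liverani) that $1$ is an isolated eigenvalue of multiplicity two of $\mathcal L_0$ on $BV$, and that for fixed small $\delta>0$ and every small enough $\epsilon>0$ the spectrum of $\mathcal L_\epsilon$ on $BV$ intersected with the disk $B_\delta(1)$ consists of exactly two eigenvalues, $1$ and a real number $\rho_\epsilon<1$, each of multiplicity $1$; moreover $\rho_\epsilon\to1$ as $\epsilon\to0$. *)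

theory Defs
  imports "HOL-Probability.Probability_Measure"
begin

section \<open>Functions of bounded variation on [0,1]\<close>

definition total_variation :: "(real \<Rightarrow> 'a::real_normed_vector) \<Rightarrow> ennreal" where
  "total_variation f =
     Sup {ennreal (\<Sum>i<n. norm (f (t (Suc i)) - f (t i))) | n t.
            mono_on {..n::nat} t \<and> t ` {..n} \<subseteq> {0..1}}"

definition bv_version :: "(real \<Rightarrow> 'a::real_normed_vector) \<Rightarrow> real \<Rightarrow> 'a" where
  "bv_version f x =
     (if x < 0 \<or> 1 < x then 0
      else if x = 0 then Lim (at_right 0) f
      else if x = 1 then Lim (at_left 1) f
      else (1/2) *\<^sub>R (Lim (at_left x) f + Lim (at_right x) f))"

text \<open>Functions on [0,1] of finite variation modulo equality off a countable set: every class has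
  exactly one representative whose value at each interior point is the mean of its one-sided limits
  and whose values at 0 and 1 are the one-sided limits.  These representatives, extended by 0 to
  the real line, are taken as the elements of the space, so that equality in the space is equality
  of functions.\<close>

definition BV :: "(real \<Rightarrow> 'a::real_normed_vector) set" where
  "BV = {f. total_variation f < \<infinity> \<and> bv_version f = f}"

definition L1_norm :: "(real \<Rightarrow> 'a::real_normed_vector) \<Rightarrow> real" where
  "L1_norm f = (LINT x:{0..1}|lborel. norm (f x))"

definition BV_norm :: "(real \<Rightarrow> 'a::real_normed_vector) \<Rightarrow> real" where
  "BV_norm f = enn2real (total_variation f) + L1_norm f"


section \<open>Spectral theory of operators on the complex space of functions of bounded variation\<close>

definition BV_spectrum :: "((real \<Rightarrow> complex) \<Rightarrow> real \<Rightarrow> complex) \<Rightarrow> complex set" where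
  "BV_spectrum A =
     {z. \<not> (bij_betw (\<lambda>f x. z * f x - A f x) BV BV \<and>
            (\<exists>K. \<forall>f\<in>BV. BV_norm f \<le> K * BV_norm (\<lambda>x. z * f x - A f x)))}"

definition generalized_eigenspace ::
  "((real \<Rightarrow> complex) \<Rightarrow> real \<Rightarrow> complex) \<Rightarrow> complex \<Rightarrow> (real \<Rightarrow> complex) set" where
  "generalized_eigenspace A z =
     {f \<in> BV. \<exists>n::nat. ((\<lambda>g x. z * g x - A g x) ^^ n) f = (\<lambda>x. 0)}"

text \<open>An eigenvalue of (algebraic) multiplicity one.\<close>

definition simple_eigenvalue ::
  "((real \<Rightarrow> complex) \<Rightarrow> real \<Rightarrow> complex) \<Rightarrow> complex \<Rightarrow> bool" where
  "simple_eigenvalue A z \<longleftrightarrow>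
     (\<exists>f\<in>BV. f \<noteq> (\<lambda>x. 0) \<and> A f = (\<lambda>x. z * f x) \<and>
            generalized_eigenspace A z = range (\<lambda>(a::complex) x. a * f x))"


section \<open>Piecewise smooth interval maps\<close>

definition C2_with_derivs ::
  "real set \<Rightarrow> (real \<Rightarrow> real) \<Rightarrow> (real \<Rightarrow> real) \<Rightarrow> (real \<Rightarrow> real) \<Rightarrow> bool" where
  "C2_with_derivs S f f' f'' \<longleftrightarrow>
     (\<forall>x\<in>S. (f has_real_derivative f' x) (at x within S)) \<and>
     (\<forall>x\<in>S. (f' has_real_derivative f'' x) (at x within S)) \<and>
     continuous_on S f''"

definition C2_on :: "real set \<Rightarrow> (real \<Rightarrow> real) \<Rightarrow> bool" where
  "C2_on S f \<longleftrightarrow> (\<exists>f' f''. C2_with_derivs S f f' f'')"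

text \<open>The critical set is \<open>c ` {..d}\<close>.  No condition ties the value of \<open>T\<close> at a critical point to
  its one-sided limits there.\<close>

definition piecewise_C2 :: "(real \<Rightarrow> real) \<Rightarrow> (nat \<Rightarrow> real) \<Rightarrow> nat \<Rightarrow> bool" where
  "piecewise_C2 T c d \<longleftrightarrow>
     T \<in> {0..1} \<rightarrow> {0..1} \<and> c 0 = 0 \<and> c d = 1 \<and> (\<forall>i<d. c i < c (Suc i)) \<and>
     (\<forall>i<d. \<exists>U g. open U \<and> {c i..c (Suc i)} \<subseteq> U \<and> C2_on U g \<and>
                  (\<forall>x\<in>{c i<..<c (Suc i)}. g x = T x))"

definition min_expansion :: "(real \<Rightarrow> real) \<Rightarrow> real set \<Rightarrow> real" where
  "min_expansion T C = (INF x\<in>{0..1} - C. \<bar>deriv T x\<bar>)"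

text \<open>The restriction of \<open>T\<close> to \<open>{p..q}\<close> as a possibly bi-valued map: only limits
  from within \<open>{p..q}\<close> count.  For \<open>p = 0\<close>, \<open>q = 1\<close> this is \<open>T\<close> itself; at points of continuity
  in the interior the only value is \<open>T x\<close>.\<close>

definition one_sided_values :: "real \<Rightarrow> real \<Rightarrow> (real \<Rightarrow> real) \<Rightarrow> real \<Rightarrow> real set" where
  "one_sided_values p q T x =
     (if p < x \<and> x \<le> q then {Lim (at_left x) T} else {}) \<union>
     (if p \<le> x \<and> x < q then {Lim (at_right x) T} else {})"

definition bivalued_image :: "(real \<Rightarrow> real) \<Rightarrow> real set \<Rightarrow> real set" where
  "bivalued_image T A = (\<Union>x\<in>A. one_sided_values 0 1 T x)"

text \<open>The restriction of \<open>T\<close> to \<open>{p..q}\<close> as a function, with one-sided limits at both endpoints.\<close>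

definition restr :: "(real \<Rightarrow> real) \<Rightarrow> real \<Rightarrow> real \<Rightarrow> real \<Rightarrow> real" where
  "restr T p q x =
     (if x = p then Lim (at_right p) T else if x = q then Lim (at_left q) T else T x)"

definition infinitesimal_holes :: "(real \<Rightarrow> real) \<Rightarrow> real \<Rightarrow> real set" where
  "infinitesimal_holes T b = {x \<in> {0..1}. b \<in> one_sided_values 0 1 T x} - {b}"

text \<open>Absolutely continuous invariant probability measures of the restriction of \<open>T\<close> to \<open>{p..q}\<close>,
  as Borel measures on the real line.  They do not depend on the values of \<open>T\<close> at critical points,
  since finite sets are null.\<close>

definition acim :: "(real \<Rightarrow> real) \<Rightarrow> real \<Rightarrow> real \<Rightarrow> real measure \<Rightarrow> bool" where
  "acim T p q \<mu> \<longleftrightarrow>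
     sets \<mu> = sets borel \<and> prob_space \<mu> \<and> absolutely_continuous lborel \<mu> \<and>
     emeasure \<mu> {p..q} = 1 \<and>
     (\<forall>A\<in>sets borel. emeasure \<mu> (T -` A \<inter> {p..q}) = emeasure \<mu> A)"

text \<open>A density of an invariant measure of the restriction of \<open>T\<close> to \<open>{p..q}\<close>, in its representative
  of bounded variation as a function on [0,1].  (If \<open>p\<close> is interior to [0,1], its value at \<open>p\<close> is
  half the limit from inside \<open>{p..q}\<close>, and similarly for \<open>q\<close>.)\<close>

definition acim_density :: "(real \<Rightarrow> real) \<Rightarrow> real \<Rightarrow> real \<Rightarrow> (real \<Rightarrow> real) \<Rightarrow> bool" where
  "acim_density T p q \<phi> \<longleftrightarrow>
     \<phi> \<in> BV \<and> (\<forall>x. 0 \<le> \<phi> x) \<and> (\<forall>x. x \<notin> {p..q} \<longrightarrow> \<phi> x = 0) \<and>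
     acim T p q (density lborel (\<lambda>x. ennreal (\<phi> x)))"

text \<open>The Perron--Frobenius operator.  The defining sum is meaningful off the finite set of images of
  critical points; passing to the representative of bounded variation removes the dependence on the
  values of the sum on that set.\<close>

definition perron_frobenius ::
  "(real \<Rightarrow> real) \<Rightarrow> (nat \<Rightarrow> real) \<Rightarrow> nat \<Rightarrow>
   (real \<Rightarrow> 'a::real_normed_vector) \<Rightarrow> real \<Rightarrow> 'a" where
  "perron_frobenius T c d f = bv_version (\<lambda>x. \<Sum>i=1..d.
     let branch = restr T (c (i - 1)) (c i);
         J = branch ` {c (i - 1)..c i};
         \<xi> = the_inv_into {c (i - 1)..c i} branch
     in if x \<in> J then \<bar>deriv \<xi> x\<bar> *\<^sub>R f (\<xi> x) else 0)"

text \<open>Convergence of the extensions in the \<open>C\<^sup>2\<close> topology is uniform convergence of the function and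
  its first two derivatives on the fixed compact interval.\<close>

definition C2_small_perturbations ::
  "(real \<Rightarrow> real \<Rightarrow> real) \<Rightarrow> (real \<Rightarrow> nat \<Rightarrow> real) \<Rightarrow> nat \<Rightarrow> bool" where
  "C2_small_perturbations T c d \<longleftrightarrow>
     (\<forall>\<epsilon>>0. piecewise_C2 (T \<epsilon>) (c \<epsilon>) d) \<and>
     (\<forall>i\<le>d. C2_on {0..} (\<lambda>\<epsilon>. c \<epsilon> i)) \<and>
     (\<exists>\<delta>>0. \<exists>\<epsilon>\<^sub>0>0. \<exists>F F' F'' :: nat \<Rightarrow> real \<Rightarrow> real \<Rightarrow> real.
        \<forall>i<d.
          (\<forall>\<epsilon>\<in>{0..<\<epsilon>\<^sub>0}.
             {c \<epsilon> i..c \<epsilon> (Suc i)} \<subseteq> {c 0 i - \<delta>..c 0 (Suc i) + \<delta>} \<and>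
             C2_with_derivs {c 0 i - \<delta>..c 0 (Suc i) + \<delta>} (F i \<epsilon>) (F' i \<epsilon>) (F'' i \<epsilon>) \<and>
             (\<forall>x\<in>{c \<epsilon> i..c \<epsilon> (Suc i)}. F i \<epsilon> x = restr (T \<epsilon>) (c \<epsilon> i) (c \<epsilon> (Suc i)) x)) \<and>
          uniform_limit {c 0 i - \<delta>..c 0 (Suc i) + \<delta>} (F i) (F i 0) (at_right 0) \<and>
          uniform_limit {c 0 i - \<delta>..c 0 (Suc i) + \<delta>} (F' i) (F' i 0) (at_right 0) \<and>
          uniform_limit {c 0 i - \<delta>..c 0 (Suc i) + \<delta>} (F'' i) (F'' i 0) (at_right 0))"

text \<open>\<open>\<rho> \<epsilon>\<close> is, for small \<open>\<epsilon> > 0\<close>, the second eigenvalue near 1 of the operator \<open>A \<epsilon>\<close> on the complex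
  space of functions of bounded variation.\<close>

definition second_eigenvalue_near_1 ::
  "(real \<Rightarrow> (real \<Rightarrow> complex) \<Rightarrow> real \<Rightarrow> complex) \<Rightarrow> (real \<Rightarrow> real) \<Rightarrow> bool" where
  "second_eigenvalue_near_1 A \<rho> \<longleftrightarrow>
     (\<exists>\<delta>>0. \<forall>\<^sub>F \<epsilon> in at_right 0.
        \<rho> \<epsilon> < 1 \<and>
        BV_spectrum (A \<epsilon>) \<inter> ball 1 \<delta> = {1, complex_of_real (\<rho> \<epsilon>)} \<and>
        simple_eigenvalue (A \<epsilon>) 1 \<and> simple_eigenvalue (A \<epsilon>) (complex_of_real (\<rho> \<epsilon>))) \<and>
     (\<rho> \<longlongrightarrow> 1) (at_right 0)"

definition normalized_eigenfunction ::
  "((real \<Rightarrow> real) \<Rightarrow> real \<Rightarrow> real) \<Rightarrow> real \<Rightarrow> real \<Rightarrow> (real \<Rightarrow> real) \<Rightarrow> bool" where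
  "normalized_eigenfunction A r b \<psi> \<longleftrightarrow>
     \<psi> \<in> BV \<and> A \<psi> = (\<lambda>x. r * \<psi> x) \<and> L1_norm \<psi> = 1 \<and> 0 < (LINT x:{0..b}|lborel. \<psi> x)"

end

theory Submission
  imports Defs "HOL-Complex_Analysis.Great_Picard"
begin

text \<open>
  Compactness argument. The normalised real eigenfunctions of \<open>L\<^sub>\<epsilon>\<close> for \<open>\<rho>\<^sub>\<epsilon>\<close> have uniformly
  bounded variation, so along every sequence \<open>\<epsilon>\<^sub>n \<rightarrow> 0\<close> a subsequence converges in \<open>L\<^sup>1\<close>. The limit has norm 1
  and integral 0 and is invariant under \<open>T\<^sub>0\<close>; its positive and negative parts are then invariant too,
  and by uniqueness of the two invariant densities it is \<open>\<plusminus>(\<phi>\<^sub>l - \<phi>\<^sub>r) / 2\<close>. The sign condition selects one of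
  the two limits, and simplicity of \<open>\<rho>\<^sub>\<epsilon>\<close> gives uniqueness.

  Variation is handled dually: it is the norm of \<open>g \<mapsto> \<integral> f g'\<close> with respect to \<open>sup |g|\<close>. As
  \<open>\<integral> (L f) g' = \<integral> f (g' \<circ> T)\<close>, one step of the Lasota--Yorke estimate replaces \<open>g\<close> by
  \<open>(g \<circ> T) / T'\<close> on each branch, minus narrow tents which make it vanish at the interior critical points. This gains
  the expansion factor but may double the supremum near a critical point. With expansion above 2
  a single step contracts. Otherwise no interior critical point returns near itself within a given number \<open>N\<close> of steps,
  for small perturbations, so each of them doubles at most once along an orbit and the factor
  is \<open>2\<^sup>d / \<lambda>\<^sup>N < 1\<close> for \<open>N\<close> large.
\<close>

section \<open>Functions of bounded variation and their dual description\<close>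

text \<open>A direct Lasota-Yorke estimate for an iterate of \<open>T \<epsilon>\<close> may fail to
  be uniform, since the iterate can acquire arbitrarily short monotonicity intervals as \<epsilon>
  tends to 0. The iterate is therefore never formed: test functions are pulled back one step at a
  time through the cells of \<open>T \<epsilon>\<close> itself, whose lengths stay bounded below, so
  that each step costs a fixed multiple of the L1 norm. The price is the doubling at the tents. A
  uniform supremum bound could double at every step, so the bound is kept pointwise: at x it carries
  the factor 2 to the number of distinct interior critical points still within reach of x. Test
  functions may take any values at 0 and 1. Hence no tent stands there and these two points never
  double anything, which absorbs the exception for fixed end points. An eigenfunction is only known
  to have some finite variation. The estimate turns a bound V into q V + C with q < 1, and iterating
  it erases the initial V.\<close>

definition test_pair :: "(real \<Rightarrow> real) \<Rightarrow> (real \<Rightarrow> real) \<Rightarrow> bool" where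
  "test_pair g s \<longleftrightarrow> continuous_on {0..1} g \<and> s \<in> borel_measurable borel \<and> (\<exists>K. \<forall>x. \<bar>s x\<bar> \<le> K) \<and>
     (\<exists>S. finite S \<and> (\<forall>x\<in>{0<..<1} - S. (g has_real_derivative s x) (at x)))"

text \<open>As \<open>g\<close> is free at 0 and 1, for functions vanishing off [0,1] this measures
  the variation on the whole line, including the jumps at the two end points. \<open>B\<close> is
  any bound of \<open>g\<close>, so pull-backs need only upper estimates.\<close>

definition weak_variation_le :: "(real \<Rightarrow> real) \<Rightarrow> real \<Rightarrow> bool" where
  "weak_variation_le f V \<longleftrightarrow>
     (\<forall>g s B. test_pair g s \<longrightarrow> (\<forall>x\<in>{0..1}. \<bar>g x\<bar> \<le> B) \<longrightarrow> \<bar>LINT x|lborel. f x * s x\<bar> \<le> V * B)"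

definition partition_sum :: "(real \<Rightarrow> 'a::real_normed_vector) \<Rightarrow> nat \<Rightarrow> (nat \<Rightarrow> real) \<Rightarrow> real" where
  "partition_sum f n t = (\<Sum>i<n. norm (f (t (Suc i)) - f (t i)))"

section \<open>Partition sums, Jordan decomposition and one-sided limits\<close>

lemma partition_sum_le_total_variation:
  assumes "total_variation f < \<infinity>" "mono_on {..n} t" "t ` {..n} \<subseteq> {0..1}"
  shows "partition_sum f n t \<le> enn2real (total_variation f)"
proof -
  have "ennreal (partition_sum f n t) \<le> total_variation f"
    unfolding total_variation_def partition_sum_def by (rule Sup_upper) (use assms in blast)
  moreover have "0 \<le> partition_sum f n t"
    by (auto simp: partition_sum_def intro: sum_nonneg)
  ultimately show ?thesis
    using assms(1) by (metis enn2real_leI enn2real_mono enn2real_ennreal infinity_ennreal_def top.not_eq_extremum)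
qed

lemma total_variation_le:
  assumes "\<And>n t. mono_on {..n} t \<Longrightarrow> t ` {..n} \<subseteq> {0..1} \<Longrightarrow> partition_sum f n t \<le> C"
  shows "total_variation f \<le> ennreal C"
  unfolding total_variation_def
  by (rule Sup_least) (use assms in \<open>auto intro!: ennreal_leI simp: partition_sum_def\<close>)

lemma total_variation_bounded_linear:
  assumes "bounded_linear L" "total_variation f < \<infinity>"
  shows "total_variation (\<lambda>x. L (f x)) < \<infinity>"
proof -
  interpret bounded_linear L by fact
  obtain K where K: "0 \<le> K" "\<And>x. norm (L x) \<le> norm x * K"
    using nonneg_bounded by blast
  have "total_variation (\<lambda>x. L (f x)) \<le> ennreal (K * enn2real (total_variation f))"
  proof (rule total_variation_le)
    fix n and t :: "nat \<Rightarrow> real" assume t: "mono_on {..n} t" "t ` {..n} \<subseteq> {0..1}"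
    have "partition_sum (\<lambda>x. L (f x)) n t \<le> (\<Sum>i<n. K * norm (f (t (Suc i)) - f (t i)))"
      unfolding partition_sum_def
      by (rule sum_mono) (metis K(2) diff mult.commute)
    also have "\<dots> = K * partition_sum f n t"
      by (simp add: partition_sum_def sum_distrib_left)
    also have "\<dots> \<le> K * enn2real (total_variation f)"
      using partition_sum_le_total_variation[OF assms(2) t] K(1) by (rule mult_left_mono)
    finally show "partition_sum (\<lambda>x. L (f x)) n t \<le> K * enn2real (total_variation f)" .
  qed
  then show ?thesis
    by (metis ennreal_less_top infinity_ennreal_def order_le_less_trans)
qed

text \<open>Jordan decomposition, with \<open>v\<close> the variation on [0,x]: by
  \<open>key\<close> every increment of f is dominated by that of \<open>v\<close>, which makes both
  \<open>v\<close> and \<open>v - f\<close> increasing.\<close>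

lemma bounded_variation_monotone_difference:
  fixes f :: "real \<Rightarrow> real"
  assumes fin: "total_variation f < \<infinity>"
  obtains P Q where "mono P" "mono Q" "\<And>x. x \<in> {0..1} \<Longrightarrow> f x = P x - Q x"
proof -
  define W where "W x = {partition_sum f n t | n t. mono_on {..n} t \<and> t ` {..n} \<subseteq> {0..x}}" for x
  define v where "v x = Sup (W x)" for x
  have bdd: "bdd_above (W x)" if "x \<le> 1" for x
    unfolding bdd_above_def W_def
    using that by (auto intro!: exI[of _ "enn2real (total_variation f)"]
        partition_sum_le_total_variation[OF fin] elim: order_trans)
  have ne: "W x \<noteq> {}" if "0 \<le> x" for x
  proof -
    have "partition_sum f 0 (\<lambda>_. 0) \<in> W x"
      unfolding W_def using that by (fastforce simp: mono_on_def)
    then show ?thesis by blast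
  qed
  have key: "v x + \<bar>f y - f x\<bar> \<le> v y" if "0 \<le> x" "x \<le> y" "y \<le> 1" for x y
  proof -
    have "w \<le> v y - \<bar>f y - f x\<bar>" if w: "w \<in> W x" for w
    proof -
      obtain n t where nt: "w = partition_sum f n t" "mono_on {..n} t" "t ` {..n} \<subseteq> {0..x}"
        using w unfolding W_def by blast
      define t' where "t' i = (if i \<le> n then t i else if i = Suc n then x else y)" for i
      have tx: "i \<le> n \<Longrightarrow> 0 \<le> t i \<and> t i \<le> x" for i using nt(3) by auto
      have "mono_on {..Suc (Suc n)} t'"
        using nt(2) tx \<open>x \<le> y\<close> unfolding t'_def mono_on_def
        by (auto; metis order_trans order_refl)
      moreover have "t' ` {..Suc (Suc n)} \<subseteq> {0..y}"
        using tx that \<open>x \<le> y\<close> \<open>0 \<le> x\<close> by (fastforce simp: t'_def)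
      ultimately have "partition_sum f (Suc (Suc n)) t' \<in> W y" unfolding W_def by blast
      then have "partition_sum f (Suc (Suc n)) t' \<le> v y"
        unfolding v_def using bdd \<open>y \<le> 1\<close> by (intro cSup_upper) auto
      moreover have "partition_sum f (Suc (Suc n)) t' = w + \<bar>f x - f (t n)\<bar> + \<bar>f y - f x\<bar>"
      proof -
        have "(\<Sum>i<n. norm (f (t' (Suc i)) - f (t' i))) = (\<Sum>i<n. norm (f (t (Suc i)) - f (t i)))"
          by (rule sum.cong) (auto simp: t'_def)
        then show ?thesis by (simp add: partition_sum_def nt(1)) (simp add: t'_def)
      qed
      ultimately show ?thesis by linarith
    qed
    then have "v x \<le> v y - \<bar>f y - f x\<bar>"
      unfolding v_def[of x] using ne \<open>0 \<le> x\<close> by (intro cSup_least) auto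
    then show ?thesis by simp
  qed
  \<comment> \<open>Clamping to [0,1] extends both functions monotonically to the line, so that
    global facts about \<open>mono\<close> apply.\<close>
  define cl where "cl x = max 0 (min 1 x)" for x :: real
  have cl: "0 \<le> cl x" "cl x \<le> 1" "x \<le> y \<Longrightarrow> cl x \<le> cl y" for x y by (auto simp: cl_def)
  show thesis
  proof
    show "mono (\<lambda>x. v (cl x))" 
      using key[OF cl(1) cl(3) cl(2)] by (intro monoI) (smt (verit))
    show "mono (\<lambda>x. v (cl x) - f (cl x))"
      using key[OF cl(1) cl(3) cl(2)] by (intro monoI) (smt (verit))
  qed (auto simp: cl_def)
qed

lemma mono_has_one_sided_limits:
  fixes P :: "real \<Rightarrow> real"
  assumes "mono P"
  shows "\<exists>l. (P \<longlongrightarrow> l) (at_left x)" "\<exists>l. (P \<longlongrightarrow> l) (at_right x)"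
proof -
  show "\<exists>l. (P \<longlongrightarrow> l) (at_right x)"
    using Lim_right_bound[of UNIV x P "P x"] assms by (auto simp: mono_def)
  show "\<exists>l. (P \<longlongrightarrow> l) (at_left x)"
    using Lim_left_bound[of UNIV x P "P x"] assms by (auto simp: mono_def)
qed

lemma one_sided_limits_if_bounded_variation:
  fixes f :: "real \<Rightarrow> real"
  assumes "total_variation f < \<infinity>"
  shows "0 < x \<Longrightarrow> x \<le> 1 \<Longrightarrow> \<exists>l. (f \<longlongrightarrow> l) (at_left x)"
    and "0 \<le> x \<Longrightarrow> x < 1 \<Longrightarrow> \<exists>l. (f \<longlongrightarrow> l) (at_right x)"
proof -
  obtain P Q where PQ: "mono P" "mono Q" "\<And>x. x \<in> {0..1} \<Longrightarrow> f x = P x - Q x"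
    using bounded_variation_monotone_difference[OF assms] by blast
  show "\<exists>l. (f \<longlongrightarrow> l) (at_left x)" if "0 < x" "x \<le> 1"
  proof -
    obtain p q where "(P \<longlongrightarrow> p) (at_left x)" "(Q \<longlongrightarrow> q) (at_left x)"
      using mono_has_one_sided_limits PQ(1,2) by meson
    then have "((\<lambda>x. P x - Q x) \<longlongrightarrow> p - q) (at_left x)" by (rule tendsto_diff)
    moreover have "\<forall>\<^sub>F y in at_left x. P y - Q y = f y"
      using eventually_at_left_real[OF \<open>0 < x\<close>] by eventually_elim (use PQ(3) that in auto)
    ultimately show ?thesis by (blast intro: Lim_transform_eventually)
  qed
  show "\<exists>l. (f \<longlongrightarrow> l) (at_right x)" if "0 \<le> x" "x < 1"
  proof -
    obtain p q where "(P \<longlongrightarrow> p) (at_right x)" "(Q \<longlongrightarrow> q) (at_right x)"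
      using mono_has_one_sided_limits PQ(1,2) by meson
    then have "((\<lambda>x. P x - Q x) \<longlongrightarrow> p - q) (at_right x)" by (rule tendsto_diff)
    moreover have "\<forall>\<^sub>F y in at_right x. P y - Q y = f y"
      using eventually_at_right_real[OF \<open>x < 1\<close>] by eventually_elim (use PQ(3) that in auto)
    ultimately show ?thesis by (blast intro: Lim_transform_eventually)
  qed
qed

lemma BV_eq_0: "f \<in> BV \<Longrightarrow> x \<notin> {0..1} \<Longrightarrow> f x = 0"
  unfolding BV_def by (metis (mono_tags, lifting) atLeastAtMost_iff bv_version_def mem_Collect_eq not_le)

text \<open>Apart from 0 and 1, a discontinuity of f must come from one of its two monotone
  parts.\<close>

lemma BV_countable_discontinuities:
  fixes f :: "real \<Rightarrow> real"
  assumes "f \<in> BV"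
  shows "countable {x. \<not> isCont f x}"
proof -
  obtain P Q where PQ: "mono P" "mono Q" "\<And>x. x \<in> {0..1} \<Longrightarrow> f x = P x - Q x"
    using bounded_variation_monotone_difference assms unfolding BV_def by blast
  have "isCont f x" if "isCont P x" "isCont Q x" "x \<noteq> 0" "x \<noteq> 1" for x
  proof (cases "x \<in> {0<..<1}")
    case True
    have "isCont (\<lambda>x. P x - Q x) x" using that by (intro continuous_intros)
    moreover have "\<forall>\<^sub>F y in nhds x. P y - Q y = f y"
      using eventually_nhds_in_open[OF _ True] by (rule eventually_mono) (use PQ(3) in auto)
    ultimately show ?thesis using isCont_cong[of "\<lambda>x. P x - Q x" f x] by simp
  next
    case False
    then have "x \<in> - {0..1}" using that by auto
    with open_Compl[OF closed_real_atLeastAtMost] have "\<forall>\<^sub>F y in nhds x. y \<in> - {0..1}"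
      by (rule eventually_nhds_in_open)
    then have "\<forall>\<^sub>F y in nhds x. f y = 0"
      by (rule eventually_mono) (use BV_eq_0[OF assms] in auto)
    then have "isCont f x \<longleftrightarrow> isCont (\<lambda>_. 0::real) x" by (rule isCont_cong)
    then show ?thesis by simp
  qed
  then have "{x. \<not> isCont f x} \<subseteq> {x. \<not> isCont P x} \<union> {x. \<not> isCont Q x} \<union> {0, 1}" by auto
  moreover have "countable \<dots>" using mono_ctble_discont PQ(1,2) by auto
  ultimately show ?thesis by (rule countable_subset)
qed

lemma BV_bounded:
  fixes f :: "real \<Rightarrow> real"
  assumes "f \<in> BV"
  shows "\<exists>K. \<forall>x. \<bar>f x\<bar> \<le> K"
proof -
  obtain P Q where PQ: "mono P" "mono Q" "\<And>x. x \<in> {0..1} \<Longrightarrow> f x = P x - Q x"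
    using bounded_variation_monotone_difference assms unfolding BV_def by blast
  have "\<bar>f x\<bar> \<le> \<bar>P 0\<bar> + \<bar>P 1\<bar> + \<bar>Q 0\<bar> + \<bar>Q 1\<bar>" for x
  proof (cases "x \<in> {0..1}")
    case True
    then have "P 0 \<le> P x" "P x \<le> P 1" "Q 0 \<le> Q x" "Q x \<le> Q 1"
      using PQ(1,2) by (auto simp: mono_def)
    then show ?thesis using PQ(3)[OF True] by linarith
  qed (use BV_eq_0[OF assms] in auto)
  then show ?thesis by blast
qed

lemma BV_borel_measurable:
  fixes f :: "real \<Rightarrow> real"
  assumes "f \<in> BV"
  shows "f \<in> borel_measurable borel"
proof -
  obtain P Q where PQ: "mono P" "mono Q" "\<And>x. x \<in> {0..1} \<Longrightarrow> f x = P x - Q x"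
    using bounded_variation_monotone_difference assms unfolding BV_def by blast
  have "f = (\<lambda>x. indicator {0..1} x * (P x - Q x))"
    using PQ(3) BV_eq_0[OF assms] by (auto simp: fun_eq_iff indicator_def)
  moreover have "\<dots> \<in> borel_measurable borel"
    using PQ(1,2)[THEN borel_measurable_mono] by measurable
  ultimately show ?thesis by simp
qed

section \<open>Integrals against bounded functions and against derivatives of test functions\<close>

lemma integrable_bounded_on_unit_interval:
  fixes f :: "real \<Rightarrow> real"
  assumes "f \<in> borel_measurable borel" "\<And>x. \<bar>f x\<bar> \<le> K" "\<And>x. x \<notin> {0..1} \<Longrightarrow> f x = 0"
  shows "integrable lborel f"
proof (rule Bochner_Integration.integrable_bound)
  show "integrable lborel (\<lambda>x. K * indicator {0..1::real} x)" by simp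
  show "AE x in lborel. norm (f x) \<le> norm (K * indicator {0..1} x)"
  proof (intro AE_I2)
    fix x show "norm (f x) \<le> norm (K * indicator {0..1} x)"
      using assms(2)[of x] assms(3)[of x] by (cases "x \<in> {0..1}") auto
  qed
qed (use assms(1) in auto)

lemma BV_integrable:
  fixes f :: "real \<Rightarrow> real"
  assumes "f \<in> BV"
  shows "integrable lborel f"
  using BV_bounded[OF assms] BV_borel_measurable[OF assms] BV_eq_0[OF assms]
  by (blast intro: integrable_bounded_on_unit_interval)

lemma L1_norm_eq_lborel:
  assumes "\<And>x. x \<notin> {0..1} \<Longrightarrow> f x = 0"
  shows "L1_norm f = (LINT x|lborel. norm (f x))"
  unfolding L1_norm_def set_lebesgue_integral_def
  by (rule Bochner_Integration.integral_cong) (use assms in \<open>auto simp: indicator_def\<close>)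

lemma integrable_times_bounded:
  fixes f s :: "real \<Rightarrow> real"
  assumes "integrable lborel f" "s \<in> borel_measurable borel" "\<And>x. \<bar>s x\<bar> \<le> K"
  shows "integrable lborel (\<lambda>x. f x * s x)"
proof (rule Bochner_Integration.integrable_bound)
  show "integrable lborel (\<lambda>x. K * f x)" using assms(1) by simp
  show "AE x in lborel. norm (f x * s x) \<le> norm (K * f x)"
  proof (intro AE_I2)
    fix x
    have "\<bar>s x\<bar> \<le> \<bar>K\<bar>" using assms(3)[of x] by linarith
    then show "norm (f x * s x) \<le> norm (K * f x)"
      using mult_right_mono[of "\<bar>s x\<bar>" "\<bar>K\<bar>" "\<bar>f x\<bar>"] by (simp add: abs_mult mult.commute)
  qed
qed (use assms in auto)

lemma abs_integral_times_le:
  fixes f s :: "real \<Rightarrow> real"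
  assumes "integrable lborel f" "s \<in> borel_measurable borel" "AE x in lborel. f x = 0 \<or> \<bar>s x\<bar> \<le> K"
  shows "\<bar>LINT x|lborel. f x * s x\<bar> \<le> K * (LINT x|lborel. \<bar>f x\<bar>)"
proof -
  have le: "AE x in lborel. \<bar>f x * s x\<bar> \<le> K * \<bar>f x\<bar>"
    using assms(3)
  proof eventually_elim
    case (elim x)
    then show ?case
      using mult_right_mono[of "\<bar>s x\<bar>" K "\<bar>f x\<bar>"] by (auto simp: abs_mult mult.commute)
  qed
  have int: "integrable lborel (\<lambda>x. K * \<bar>f x\<bar>)" using assms(1) by simp
  have "AE x in lborel. norm (f x * s x) \<le> norm (K * \<bar>f x\<bar>)"
    using le by eventually_elim auto
  then have "integrable lborel (\<lambda>x. f x * s x)"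
    by (rule Bochner_Integration.integrable_bound[OF int, rotated]) (use assms in auto)
  then have "(LINT x|lborel. \<bar>f x * s x\<bar>) \<le> (LINT x|lborel. K * \<bar>f x\<bar>)"
    using le int by (intro integral_mono_AE integrable_abs)
  moreover have "\<bar>LINT x|lborel. f x * s x\<bar> \<le> (LINT x|lborel. \<bar>f x * s x\<bar>)"
    by (rule integral_abs_bound)
  moreover have "(LINT x|lborel. K * \<bar>f x\<bar>) = K * (LINT x|lborel. \<bar>f x\<bar>)" by simp
  ultimately show ?thesis by linarith
qed

lemma test_pair_measurable [measurable_dest]: "test_pair g s \<Longrightarrow> s \<in> borel_measurable borel"
  by (simp add: test_pair_def)

text \<open>The gauge integral form of the fundamental theorem tolerates the finite set on which
  \<open>s\<close> is not the derivative.\<close>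

lemma test_pair_has_integral:
  assumes "test_pair g s" "0 \<le> u" "u \<le> v" "v \<le> 1"
  shows "(s has_integral (g v - g u)) {u..v}"
proof -
  obtain S where S: "finite S" "\<And>x. x\<in>{0<..<1} - S \<Longrightarrow> (g has_real_derivative s x) (at x)"
    using assms(1) unfolding test_pair_def by blast
  show ?thesis
  proof (rule fundamental_theorem_of_calculus_interior_strong[OF S(1) \<open>u \<le> v\<close>])
    show "(g has_vector_derivative s x) (at x)" if "x \<in> {u<..<v} - S" for x
      using S(2)[of x] that assms(2,4) by (simp add: has_real_derivative_iff_has_vector_derivative)
    have "continuous_on {0..1} g" using assms(1) by (simp add: test_pair_def)
    then show "continuous_on {u..v} g"
      by (rule continuous_on_subset) (use assms in auto)
  qed
qed

text \<open>Second mean value theorem: for monotone P, the integral of \<open>P * s\<close> is a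
  combination of \<open>P 0\<close> and \<open>P 1\<close> with two increments of \<open>g\<close>,
  each at most \<open>2 * B\<close> in size. The constant is crude; it only provides a finite start
  for \<open>weak_variation_fixed_bound\<close>.\<close>

lemma BV_weak_variation_finite:
  fixes f :: "real \<Rightarrow> real"
  assumes "f \<in> BV"
  shows "\<exists>V. weak_variation_le f V"
proof -
  obtain P Q where PQ: "mono P" "mono Q" "\<And>x. x \<in> {0..1} \<Longrightarrow> f x = P x - Q x"
    using bounded_variation_monotone_difference assms unfolding BV_def by blast
  have mono_bound: "\<bar>integral {0..1} (\<lambda>x. P x * s x)\<bar> \<le> 2 * (\<bar>P 0\<bar> + \<bar>P 1\<bar>) * B \<and>
      (\<lambda>x. P x * s x) integrable_on {0..1}"
    if P: "mono P" and gs: "test_pair g s" and B: "\<forall>x\<in>{0..1}. \<bar>g x\<bar> \<le> B" for P g s B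
  proof -
    have "s integrable_on {0..1}" using test_pair_has_integral[OF gs, of 0 1] by auto
    then obtain c where c: "c \<in> {0..1}" and
      i: "((\<lambda>x. P x * s x) has_integral (P 0 * integral {0..c} s + P 1 * integral {c..1} s)) {0..1}"
      using second_mean_value_theorem_full[of s 0 1 P] P by (auto simp: mono_def)
    have "integral {0..c} s = g c - g 0" "integral {c..1} s = g 1 - g c"
      using test_pair_has_integral[OF gs] c by (auto intro!: integral_unique)
    moreover have "\<bar>g c\<bar> \<le> B" "\<bar>g 0\<bar> \<le> B" "\<bar>g 1\<bar> \<le> B" using B c by auto
    ultimately have "\<bar>integral {0..c} s\<bar> \<le> 2 * B" "\<bar>integral {c..1} s\<bar> \<le> 2 * B" by linarith+
    then have "\<bar>P 0\<bar> * \<bar>integral {0..c} s\<bar> \<le> \<bar>P 0\<bar> * (2 * B)"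
       "\<bar>P 1\<bar> * \<bar>integral {c..1} s\<bar> \<le> \<bar>P 1\<bar> * (2 * B)"
      by (auto intro: mult_left_mono)
    moreover have "\<bar>integral {0..1} (\<lambda>x. P x * s x)\<bar> \<le>
        \<bar>P 0\<bar> * \<bar>integral {0..c} s\<bar> + \<bar>P 1\<bar> * \<bar>integral {c..1} s\<bar>"
      using integral_unique[OF i] by (simp add: abs_mult[symmetric])
    ultimately show ?thesis using i by (auto simp: algebra_simps)
  qed
  have "weak_variation_le f (2 * (\<bar>P 0\<bar> + \<bar>P 1\<bar>) + 2 * (\<bar>Q 0\<bar> + \<bar>Q 1\<bar>))"
    unfolding weak_variation_le_def
  proof (intro allI impI)
    fix g s B assume gs: "test_pair g s" and B: "\<forall>x\<in>{0..1}. \<bar>g x\<bar> \<le> B"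
    obtain K where K: "\<And>x. \<bar>s x\<bar> \<le> K" using gs by (auto simp: test_pair_def)
    have "(LINT x|lborel. f x * s x) = integral UNIV (\<lambda>x. f x * s x)"
      by (rule integral_lborel[symmetric], rule integrable_times_bounded[OF BV_integrable[OF assms]])
         (use gs K in \<open>auto simp: test_pair_def\<close>)
    also have "\<dots> = integral {0..1} (\<lambda>x. f x * s x)"
    proof -
      have "(\<lambda>x. f x * s x) = (\<lambda>x. if x \<in> {0..1} then f x * s x else 0)"
        using BV_eq_0[OF assms] by (auto simp: fun_eq_iff)
      then show ?thesis by (metis integral_restrict_UNIV)
    qed
    also have "\<dots> = integral {0..1} (\<lambda>x. P x * s x - Q x * s x)"
      using PQ(3) by (intro Henstock_Kurzweil_Integration.integral_cong) (simp add: left_diff_distrib)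
    also have "\<dots> = integral {0..1} (\<lambda>x. P x * s x) - integral {0..1} (\<lambda>x. Q x * s x)"
      using mono_bound[OF PQ(1) gs B] mono_bound[OF PQ(2) gs B]
      by (intro Henstock_Kurzweil_Integration.integral_diff) auto
    finally show "\<bar>LINT x|lborel. f x * s x\<bar> \<le> (2 * (\<bar>P 0\<bar> + \<bar>P 1\<bar>) + 2 * (\<bar>Q 0\<bar> + \<bar>Q 1\<bar>)) * B"
      using mono_bound[OF PQ(1) gs B] mono_bound[OF PQ(2) gs B]
      by (simp add: distrib_right) linarith
  qed
  then show ?thesis by blast
qed

section \<open>Partitions of the unit interval and gluing of test functions\<close>

lemma partition_mono:
  fixes p :: "nat \<Rightarrow> real"
  assumes "\<And>i. i < d \<Longrightarrow> p i < p (Suc i)" "i \<le> j" "j \<le> d"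
  shows "p i \<le> p j"
  using assms(2,3)
proof (induction rule: dec_induct)
  case (step n) then show ?case using assms(1)[of n] by simp
qed simp

lemma partition_cell_exists:
  fixes p :: "nat \<Rightarrow> real"
  assumes "p 0 \<le> x" "x < p d"
  shows "\<exists>i<d. p i \<le> x \<and> x < p (Suc i)"
  using assms
proof (induction d)
  case (Suc d)
  then show ?case by (cases "x < p d") (auto simp: less_Suc_eq)
qed simp

lemma partition_cell_exists_closed:
  fixes p :: "nat \<Rightarrow> real"
  assumes "p 0 = 0" "p d = 1" "\<And>i. i < d \<Longrightarrow> p i < p (Suc i)" "x \<in> {0..1}"
  shows "\<exists>i<d. x \<in> {p i..p (Suc i)}"
proof (cases "x = 1")
  case True
  have "d \<noteq> 0" using assms by (intro notI) auto
  then show ?thesis using True assms(2) assms(3)[of "d - 1"] by (intro exI[of _ "d - 1"]) auto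
next
  case False
  then show ?thesis using partition_cell_exists[of p x d] assms by (auto intro: less_imp_le)
qed

text \<open>Neighbouring pieces have to agree in value, not in slope; this is arranged by letting
  both vanish at every interior break point. The guards \<open>0 < i\<close> and
  \<open>Suc i < d\<close> leave the values at 0 and 1 free.\<close>

lemma test_pair_glue:
  fixes p :: "nat \<Rightarrow> real"
  assumes p: "p 0 = 0" "p d = 1" "\<And>i. i < d \<Longrightarrow> p i < p (Suc i)"
    and cont: "\<And>i. i < d \<Longrightarrow> continuous_on {p i..p (Suc i)} (g i)"
    and zero: "\<And>i. i < d \<Longrightarrow> 0 < i \<Longrightarrow> g i (p i) = 0" "\<And>i. Suc i < d \<Longrightarrow> g i (p (Suc i)) = 0"
    and der: "\<And>i. i < d \<Longrightarrow>
      \<exists>S. finite S \<and> (\<forall>x\<in>{p i<..<p (Suc i)} - S. (g i has_real_derivative s i x) (at x))"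
    and meas: "\<And>i. i < d \<Longrightarrow> s i \<in> borel_measurable borel"
    and bound: "\<And>i x. i < d \<Longrightarrow> x \<in> {p i<..<p (Suc i)} \<Longrightarrow> \<bar>s i x\<bar> \<le> K"
  obtains G S where "test_pair G S" "\<And>i x. i < d \<Longrightarrow> x \<in> {p i..p (Suc i)} \<Longrightarrow> G x = g i x"
    "\<And>i x. i < d \<Longrightarrow> x \<in> {p i<..<p (Suc i)} \<Longrightarrow> S x = s i x"
proof -
  \<comment> \<open>Extending each piece by its (zero) end values makes the sum of all pieces continuous.\<close>
  define cl where "cl i x = max (p i) (min (p (Suc i)) x)" for i x
  define G where "G x = (\<Sum>i<d. g i (cl i x))" for x
  define S where "S x = (\<Sum>i<d. indicator {p i<..<p (Suc i)} x * s i x)" for x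
  have cl: "cl i x \<in> {p i..p (Suc i)}" if "i < d" for i x using p(3)[OF that] by (auto simp: cl_def)
  have pm: "p i \<le> p j" if "i \<le> j" "j \<le> d" for i j using partition_mono[of d p, OF p(3) that] .
  have G_eq: "G x = g i x" if i: "i < d" "x \<in> {p i..p (Suc i)}" for i x
  proof -
    have "g j (cl j x) = (if j = i then g i x else 0)" if "j < d" for j
    proof -
      consider "j < i" | "j = i" | "i < j" by linarith
      then show ?thesis
      proof cases
        case 1
        then have "p (Suc j) \<le> p i" using i(1) by (intro pm) auto
        then have "cl j x = p (Suc j)" using i(2) p(3)[OF that] by (auto simp: cl_def)
        then show ?thesis using 1 zero(2)[of j] i(1) by simp
      next
        case 2 then show ?thesis using i(2) by (auto simp: cl_def min_def max_def)
      next
        case 3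
        then have "p (Suc i) \<le> p j" using that by (intro pm) auto
        then have "cl j x = p j" using i(2) p(3)[OF that] by (auto simp: cl_def)
        then show ?thesis using 3 zero(1)[of j] that by simp
      qed
    qed
    then have "G x = (\<Sum>j<d. if j = i then g i x else 0)" unfolding G_def by (intro sum.cong) auto
    then show ?thesis using i(1) by simp
  qed
  have S_eq: "S x = s i x" if i: "i < d" "x \<in> {p i<..<p (Suc i)}" for i x
  proof -
    have "indicator {p j<..<p (Suc j)} x * s j x = (if j = i then s i x else 0)" if "j < d" for j
    proof -
      consider "j < i" | "j = i" | "i < j" by linarith
      then show ?thesis
      proof cases
        case 1
        then have "p (Suc j) \<le> p i" using i(1) by (intro pm) auto
        then show ?thesis using i(2) 1 by (auto simp: indicator_def)
      next
        case 2 then show ?thesis using i(2) by auto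
      next
        case 3
        then have "p (Suc i) \<le> p j" using that by (intro pm) auto
        then show ?thesis using i(2) 3 by (auto simp: indicator_def)
      qed
    qed
    then have "S x = (\<Sum>j<d. if j = i then s i x else 0)" unfolding S_def by (intro sum.cong) auto
    then show ?thesis using i(1) by simp
  qed
  have "continuous_on UNIV (\<lambda>x. g i (cl i x))" if "i < d" for i
    by (rule continuous_on_compose2[OF cont[OF that]])
       (use cl[OF that] in \<open>auto simp: cl_def intro!: continuous_intros\<close>)
  then have "continuous_on {0..1} G"
    unfolding G_def by (intro continuous_intros) (auto intro: continuous_on_subset)
  moreover have "S \<in> borel_measurable borel"
    unfolding S_def using meas by (intro borel_measurable_sum borel_measurable_times) auto
  moreover have "\<bar>S x\<bar> \<le> real d * \<bar>K\<bar>" for x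
  proof -
    have "\<bar>S x\<bar> \<le> (\<Sum>i<d. \<bar>indicator {p i<..<p (Suc i)} x * s i x\<bar>)"
      unfolding S_def by (rule sum_abs)
    also have "\<dots> \<le> (\<Sum>i<d. \<bar>K\<bar>)"
      by (rule sum_mono) (use bound in \<open>fastforce simp: indicator_def abs_mult intro: order_trans\<close>)
    finally show ?thesis by simp
  qed
  moreover have "\<exists>E. finite E \<and> (\<forall>x\<in>{0<..<1} - E. (G has_real_derivative S x) (at x))"
  proof -
    obtain E where E: "\<And>i. i < d \<Longrightarrow> finite (E i)"
      "\<And>i x. i < d \<Longrightarrow> x\<in>{p i<..<p (Suc i)} - E i \<Longrightarrow> (g i has_real_derivative s i x) (at x)"
      using der by metis
    have "(G has_real_derivative S x) (at x)"
      if x: "x \<in> {0<..<1} - ((\<Union>i<d. E i) \<union> p ` {..d})" for x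
    proof -
      obtain i where i: "i < d" "x \<in> {p i..p (Suc i)}"
        using partition_cell_exists_closed[OF p] x by (metis DiffD1 greaterThanLessThan_subseteq_atLeastAtMost_iff order_refl subsetD)
      have "x \<noteq> p i" "x \<noteq> p (Suc i)" using i(1) x by auto
      then have x': "x \<in> {p i<..<p (Suc i)}" using i(2) by auto
      then have "(g i has_real_derivative S x) (at x)" using E(2)[OF i(1)] x i(1) S_eq[OF i(1) x'] by auto
      moreover have "\<forall>\<^sub>F y in nhds x. g i y = G y"
        using eventually_nhds_in_open[OF open_greaterThanLessThan x'] by (rule eventually_mono) (use G_eq[OF i(1)] in auto)
      ultimately show ?thesis by (metis DERIV_cong_ev)
    qed
    then show ?thesis using E(1) by (intro exI[of _ "(\<Union>i<d. E i) \<union> p ` {..d}"]) auto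
  qed
  ultimately have "test_pair G S" unfolding test_pair_def by blast
  then show thesis using G_eq S_eq that by blast
qed

text \<open>An almost everywhere convergent subsequence provides the limit, and Fatou's lemma turns
  the Cauchy bound into a bound on the distance to it.\<close>

lemma L1_Cauchy_converges:
  fixes f :: "nat \<Rightarrow> 'a \<Rightarrow> real"
  assumes int [measurable]: "\<And>n. integrable M (f n)"
    and Cauchy: "\<And>e. e > 0 \<Longrightarrow> \<exists>N. \<forall>m\<ge>N. \<forall>n\<ge>N. (LINT x|M. \<bar>f m x - f n x\<bar>) < e"
  obtains h where "integrable M h" "(\<lambda>n. LINT x|M. \<bar>f n x - h x\<bar>) \<longlonglongrightarrow> 0"
proof -
  obtain r where r: "strict_mono r" "AE x in M. Cauchy (\<lambda>k. f (r k) x)"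
    using cauchy_L1_AE_cauchy_subseq[of M f] int Cauchy by (auto simp: real_norm_def)
  define h where "h x = lim (\<lambda>k. f (r k) x)" for x
  have [measurable]: "h \<in> borel_measurable M" unfolding h_def by measurable
  have bound: "\<exists>N. \<forall>n\<ge>N. (\<integral>\<^sup>+x. ennreal \<bar>f n x - h x\<bar> \<partial>M) \<le> ennreal e" if e: "e > 0" for e
  proof -
    obtain N where N: "\<And>m n. N \<le> m \<Longrightarrow> N \<le> n \<Longrightarrow> (LINT x|M. \<bar>f m x - f n x\<bar>) < e"
      using Cauchy[OF e] by blast
    have "(\<integral>\<^sup>+x. ennreal \<bar>f n x - h x\<bar> \<partial>M) \<le> ennreal e" if n: "n \<ge> N" for n
    proof -
      have "AE x in M. ennreal \<bar>f n x - h x\<bar> = liminf (\<lambda>k. ennreal \<bar>f n x - f (r k) x\<bar>)"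
        using r(2)
      proof eventually_elim
        case (elim x)
        then have "(\<lambda>k. f (r k) x) \<longlonglongrightarrow> h x"
          unfolding h_def by (simp add: Cauchy_convergent_iff convergent_LIMSEQ_iff)
        then have "(\<lambda>k. ennreal \<bar>f n x - f (r k) x\<bar>) \<longlonglongrightarrow> ennreal \<bar>f n x - h x\<bar>"
          by (intro tendsto_intros)
        then show ?case by (rule lim_imp_Liminf[OF trivial_limit_sequentially, symmetric])
      qed
      then have "(\<integral>\<^sup>+x. ennreal \<bar>f n x - h x\<bar> \<partial>M) = (\<integral>\<^sup>+x. liminf (\<lambda>k. ennreal \<bar>f n x - f (r k) x\<bar>) \<partial>M)"
        by (rule nn_integral_cong_AE)
      also have "\<dots> \<le> liminf (\<lambda>k. \<integral>\<^sup>+x. ennreal \<bar>f n x - f (r k) x\<bar> \<partial>M)"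
        by (rule nn_integral_liminf) measurable
      also have "\<dots> \<le> liminf (\<lambda>k. ennreal e)"
      proof (rule Liminf_mono)
        show "\<forall>\<^sub>F k in sequentially. (\<integral>\<^sup>+x. ennreal \<bar>f n x - f (r k) x\<bar> \<partial>M) \<le> ennreal e"
          using eventually_ge_at_top[of N]
        proof eventually_elim
          case (elim k)
          then have "(LINT x|M. \<bar>f n x - f (r k) x\<bar>) < e"
            using N[OF n] seq_suble[OF r(1), of k] by simp
          then show ?case
            using int by (subst nn_integral_eq_integral) (auto intro: ennreal_leI)
        qed
      qed
      finally show ?thesis by (simp add: Liminf_const)
    qed
    then show ?thesis by blast
  qed
  have h: "integrable M h"
  proof -
    obtain N where "(\<integral>\<^sup>+x. ennreal \<bar>f N x - h x\<bar> \<partial>M) \<le> ennreal 1" using bound[of 1] by auto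
    then have "integrable M (\<lambda>x. f N x - h x)"
      by (intro integrableI_bounded) (auto intro: le_less_trans)
    from Bochner_Integration.integrable_diff[OF int[of N] this] show ?thesis by simp
  qed
  have "(\<lambda>n. LINT x|M. \<bar>f n x - h x\<bar>) \<longlonglongrightarrow> 0"
  proof (rule LIMSEQ_I)
    fix e :: real assume "e > 0"
    then obtain N where N: "\<And>n. n \<ge> N \<Longrightarrow> (\<integral>\<^sup>+x. ennreal \<bar>f n x - h x\<bar> \<partial>M) \<le> ennreal (e / 2)"
      using bound[of "e / 2"] by auto
    have "norm ((LINT x|M. \<bar>f n x - h x\<bar>) - 0) < e" if "n \<ge> N" for n
      using N[OF that] int h \<open>e > 0\<close> by (subst (asm) nn_integral_eq_integral) auto
    then show "\<exists>N. \<forall>n\<ge>N. norm ((LINT x|M. \<bar>f n x - h x\<bar>) - 0) < e" by blast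
  qed
  then show thesis using that h by blast
qed

section \<open>Compactness\<close>

text \<open>Serves to recover the L1 norm of \<open>u\<close> from pairings with continuous
  functions, which have antiderivatives and so lead to test functions. Clamping to [-1,1] does not
  disturb the limit, since \<open>sgn\<close> takes its values there.\<close>

lemma sgn_limit_of_continuous:
  fixes u :: "real \<Rightarrow> real"
  assumes "u \<in> borel_measurable borel"
  obtains \<sigma> where "\<And>n. continuous_on UNIV (\<sigma> n)" "\<And>n x. \<bar>\<sigma> n x\<bar> \<le> 1"
    "AE x in lborel. (\<lambda>n. \<sigma> n x) \<longlonglongrightarrow> sgn (u x)"
proof -
  have "(\<lambda>x. sgn (u x)) \<in> borel_measurable lebesgue"
    using assms by (intro measurable_completion) simp
  then have "(\<lambda>x. sgn (u x)) measurable_on UNIV"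
    by (rule lebesgue_measurable_imp_measurable_on) simp
  then obtain N g where N: "negligible N" and g: "\<And>n. continuous_on UNIV (g n)"
    "\<And>x. x \<notin> N \<Longrightarrow> (\<lambda>n. g n x) \<longlonglongrightarrow> sgn (u x)"
    unfolding measurable_on_def by auto
  define \<sigma> where "\<sigma> n x = max (-1) (min 1 (g n x))" for n and x :: real
  show thesis
  proof
    show "continuous_on UNIV (\<sigma> n)" for n
      unfolding \<sigma>_def by (intro continuous_intros g)
    show "\<bar>\<sigma> n x\<bar> \<le> 1" for n x by (auto simp: \<sigma>_def)
    have "AE x in lebesgue. x \<notin> N"
      using N by (simp add: AE_not_in negligible_iff_null_sets)
    then have "AE x in lborel. x \<notin> N" by (simp add: AE_completion_iff)
    then show "AE x in lborel. (\<lambda>n. \<sigma> n x) \<longlonglongrightarrow> sgn (u x)"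
    proof eventually_elim
      case (elim x)
      have "(\<lambda>n. max (-1) (min 1 (g n x))) \<longlonglongrightarrow> max (-1) (min 1 (sgn (u x)))"
        by (intro tendsto_intros g elim)
      then show ?case by (simp add: \<sigma>_def sgn_if split: if_splits)
    qed
  qed
qed

text \<open>On each of m equal cells the mean of \<sigma> is subtracted. The antiderivative of the
  remainder vanishes at the cell ends, hence glues to a test function of size at most 2/m; the
  means, at most 1 in size, meet only the cell integrals of \<open>u\<close>.\<close>

lemma integral_continuous_le_weak_variation:
  fixes u \<sigma> :: "real \<Rightarrow> real"
  assumes u: "integrable lborel u" "\<And>x. x \<notin> {0..1} \<Longrightarrow> u x = 0" "weak_variation_le u W"
    and \<sigma>: "continuous_on UNIV \<sigma>" "\<And>x. \<bar>\<sigma> x\<bar> \<le> 1" and m: "0 < m"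
  shows "\<bar>LINT x|lborel. u x * \<sigma> x\<bar> \<le> W * (2 / real m) +
    (\<Sum>j<m. \<bar>LINT x|lborel. u x * indicator {real j / m<..real (Suc j) / m} x\<bar>)"
proof -
  define p where "p j = real j / m" for j
  have p: "p 0 = 0" "p m = 1" "p (Suc j) = p j + 1 / m" for j
    using m by (auto simp: p_def field_simps)
  have plt: "p j < p (Suc j)" for j using p(3)[of j] m by simp
  define S where "S j x = integral {p j..x} \<sigma>" for j x
  \<comment> \<open>The mean of \<sigma> over cell j, which makes \<open>g j\<close> return to 0 at
    the right end.\<close>
  define a where "a j = m * S j (p (Suc j))" for j
  have \<sigma>int: "\<sigma> integrable_on {x..y}" for x y
    by (rule integrable_continuous_real) (use \<sigma>(1) continuous_on_subset in blast)
  have S_le: "\<bar>S j x\<bar> \<le> 1 / m" if "x \<in> {p j..p (Suc j)}" for j x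
  proof -
    have "\<bar>S j x\<bar> \<le> 1 * (x - p j)"
      unfolding S_def using integral_bound[of "p j" x \<sigma> 1] that \<sigma> 
      by (auto intro: continuous_on_subset)
    then show ?thesis using that p(3)[of j] by simp
  qed
  have a_le: "\<bar>a j\<bar> \<le> 1" for j
  proof -
    have "m * \<bar>S j (p (Suc j))\<bar> \<le> m * (1 / m)"
      using S_le[of "p (Suc j)" j] plt[of j] m by (intro mult_left_mono) auto
    then show ?thesis using m by (simp add: a_def abs_mult)
  qed
  define g where "g j x = S j x - (x - p j) * a j" for j x
  have g_le: "\<bar>g j x\<bar> \<le> 2 / m" if "x \<in> {p j..p (Suc j)}" for j x
  proof -
    have "\<bar>(x - p j) * a j\<bar> \<le> (1 / m) * 1"
      unfolding abs_mult using that p(3)[of j] a_le[of j] by (intro mult_mono) auto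
    then show ?thesis using S_le[OF that] unfolding g_def by (simp add: field_simps)
  qed
  have gder: "(g j has_real_derivative \<sigma> x - a j) (at x)" if "x \<in> {p j<..<p (Suc j)}" for j x
  proof -
    have "(S j has_vector_derivative \<sigma> x) (at x within {p j..p (Suc j)})"
      unfolding S_def
      by (rule integral_has_vector_derivative) (use that \<sigma>(1) in \<open>auto intro: continuous_on_subset\<close>)
    then have "(S j has_real_derivative \<sigma> x) (at x within {p j..p (Suc j)})"
      by (simp add: has_real_derivative_iff_has_vector_derivative)
    then have "(S j has_real_derivative \<sigma> x) (at x)"
      using that at_within_interior[of x "{p j..p (Suc j)}"] by simp
    then show ?thesis unfolding g_def by (auto intro!: derivative_eq_intros)
  qed
  have gcont: "continuous_on {p j..p (Suc j)} (g j)" for j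
    unfolding g_def S_def by (intro continuous_intros indefinite_integral_continuous_1 \<sigma>int)
  have gz: "g j (p j) = 0" "g j (p (Suc j)) = 0" for j
    using p(3)[of j] m by (auto simp: g_def a_def S_def)
  have \<sigma>m [measurable]: "\<sigma> \<in> borel_measurable borel"
    using \<sigma>(1) by (rule borel_measurable_continuous_onI)
  obtain G s where Gs: "test_pair G s" "\<And>i x. i < m \<Longrightarrow> x \<in> {p i..p (Suc i)} \<Longrightarrow> G x = g i x"
    "\<And>i x. i < m \<Longrightarrow> x \<in> {p i<..<p (Suc i)} \<Longrightarrow> s x = \<sigma> x - a i"
  proof (rule test_pair_glue[of p m g "\<lambda>j x. \<sigma> x - a j" 2])
    show "\<exists>S. finite S \<and> (\<forall>x\<in>{p i<..<p (Suc i)} - S. (g i has_real_derivative \<sigma> x - a i) (at x))" for i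
      using gder by (intro exI[of _ "{}"]) auto
    show "\<bar>\<sigma> x - a i\<bar> \<le> 2" for i x using a_le[of i] \<sigma>(2)[of x] by linarith
  qed (use p plt gcont gz in auto)
  have GB: "\<forall>x\<in>{0..1}. \<bar>G x\<bar> \<le> 2 / m"
  proof
    fix x :: real assume "x \<in> {0..1}"
    then obtain i where "i < m" "x \<in> {p i..p (Suc i)}"
      using partition_cell_exists_closed[OF p(1,2) plt] by blast
    then show "\<bar>G x\<bar> \<le> 2 / m" using Gs(2) g_le by auto
  qed
  define I where "I j x = (indicator {p j<..p (Suc j)} x :: real)" for j x
  obtain K where K: "\<And>x. \<bar>s x\<bar> \<le> K" using Gs(1) unfolding test_pair_def by blast
  have s [measurable]: "s \<in> borel_measurable borel" using Gs(1) by (rule test_pair_measurable)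
  have "AE x in lborel. x \<notin> p ` {..m}"
    by (intro AE_not_in countable_imp_null_set_lborel) auto
  then have "AE x in lborel. u x * \<sigma> x = u x * s x + (\<Sum>j<m. a j * (u x * I j x))"
  proof eventually_elim
    case (elim x)
    show ?case
    proof (cases "x \<in> {0..1}")
      case True
      then obtain i where i: "i < m" "x \<in> {p i..p (Suc i)}"
        using partition_cell_exists_closed[OF p(1,2) plt] by blast
      then have "x \<noteq> p i" "x \<noteq> p (Suc i)" using elim by auto
      then have x: "x \<in> {p i<..<p (Suc i)}" using i by auto
      have "I j x = (if j = i then 1 else 0)" for j
      proof -
        have "p (Suc j) \<le> p i" if "j < i" using that m by (auto simp: p_def divide_right_mono)
        moreover have "p (Suc i) \<le> p j" if "i < j" using that m by (auto simp: p_def divide_right_mono)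
        ultimately show ?thesis using x by (auto simp: I_def indicator_def) (meson linorder_neqE_nat not_le order_trans)+
      qed
      then have "(\<Sum>j<m. a j * (u x * I j x)) = (\<Sum>j<m. if j = i then a i * u x else 0)"
        by (intro sum.cong) auto
      then show ?thesis using Gs(3)[OF i(1) x] i(1) by (simp add: right_diff_distrib mult.commute)
    qed (use u(2) in auto)
  qed
  then have "(LINT x|lborel. u x * \<sigma> x) = (LINT x|lborel. u x * s x + (\<Sum>j<m. a j * (u x * I j x)))"
    using u(1) by (intro integral_cong_AE) (auto simp: I_def)
  also have "\<dots> = (LINT x|lborel. u x * s x) + (\<Sum>j<m. a j * (LINT x|lborel. u x * I j x))"
  proof -
    have "integrable lborel (\<lambda>x. u x * I j x)" for j
      by (rule integrable_times_bounded[OF u(1), of _ 1]) (auto simp: I_def indicator_def)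
    then show ?thesis
      using integrable_times_bounded[OF u(1) s K] by (simp add: Bochner_Integration.integral_sum)
  qed
  finally have eq: "(LINT x|lborel. u x * \<sigma> x) =
    (LINT x|lborel. u x * s x) + (\<Sum>j<m. a j * (LINT x|lborel. u x * I j x))" .
  have "\<bar>\<Sum>j<m. a j * (LINT x|lborel. u x * I j x)\<bar> \<le> (\<Sum>j<m. \<bar>a j * (LINT x|lborel. u x * I j x)\<bar>)"
    by (rule sum_abs)
  also have "\<dots> \<le> (\<Sum>j<m. \<bar>LINT x|lborel. u x * I j x\<bar>)"
    using a_le by (intro sum_mono) (simp add: abs_mult mult_left_le_one_le)
  finally have "\<bar>\<Sum>j<m. a j * (LINT x|lborel. u x * I j x)\<bar> \<le> (\<Sum>j<m. \<bar>LINT x|lborel. u x * I j x\<bar>)" .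
  moreover have "\<bar>LINT x|lborel. u x * s x\<bar> \<le> W * (2 / m)"
    using u(3) Gs(1) GB unfolding weak_variation_le_def by blast
  ultimately show ?thesis unfolding eq I_def p_def by linarith
qed

text \<open>The source of compactness: up to an error proportional to the mesh, the L1 norm is
  controlled by finitely many linear functionals.\<close>

lemma L1_norm_le_weak_variation:
  fixes u :: "real \<Rightarrow> real"
  assumes u: "integrable lborel u" "\<And>x. x \<notin> {0..1} \<Longrightarrow> u x = 0" "weak_variation_le u W"
    and m: "0 < m"
  shows "(LINT x|lborel. \<bar>u x\<bar>) \<le> W * (2 / real m) +
    (\<Sum>j<m. \<bar>LINT x|lborel. u x * indicator {real j / m<..real (Suc j) / m} x\<bar>)" (is "_ \<le> ?R")
proof -
  have um [measurable]: "u \<in> borel_measurable borel" using u(1) by auto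
  obtain \<sigma> where \<sigma>: "\<And>n. continuous_on UNIV (\<sigma> n)" "\<And>n x. \<bar>\<sigma> n x\<bar> \<le> 1"
    "AE x in lborel. (\<lambda>n. \<sigma> n x) \<longlonglongrightarrow> sgn (u x)"
    using sgn_limit_of_continuous[OF um] by blast
  have [measurable]: "\<sigma> n \<in> borel_measurable borel" for n
    using \<sigma>(1) by (rule borel_measurable_continuous_onI)
  have "(\<lambda>n. LINT x|lborel. u x * \<sigma> n x) \<longlonglongrightarrow> (LINT x|lborel. \<bar>u x\<bar>)"
  proof (rule integral_dominated_convergence[where w = "\<lambda>x. \<bar>u x\<bar>"])
    show "AE x in lborel. (\<lambda>n. u x * \<sigma> n x) \<longlonglongrightarrow> \<bar>u x\<bar>"
      using \<sigma>(3) by eventually_elim (metis abs_sgn tendsto_mult_left)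
    show "AE x in lborel. norm (u x * \<sigma> n x) \<le> \<bar>u x\<bar>" for n
      using \<sigma>(2) by (intro AE_I2) (auto simp: abs_mult intro: mult_right_le_one_le)
  qed (use u(1) in auto)
  moreover have "(LINT x|lborel. u x * \<sigma> n x) \<le> ?R" for n
    using integral_continuous_le_weak_variation[OF u \<sigma>(1) \<sigma>(2) m, of n] by linarith
  ultimately show ?thesis by (intro LIMSEQ_le_const2) auto
qed

lemma weak_variation_le_diff:
  assumes "weak_variation_le f V" "weak_variation_le g W" "integrable lborel f" "integrable lborel g"
  shows "weak_variation_le (\<lambda>x. f x - g x) (V + W)"
  unfolding weak_variation_le_def
proof (intro allI impI)
  fix h s B assume h: "test_pair h s" "\<forall>x\<in>{0..1}. \<bar>h x\<bar> \<le> B"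
  obtain K where K: "\<And>x. \<bar>s x\<bar> \<le> K" using h(1) unfolding test_pair_def by blast
  have s: "s \<in> borel_measurable borel" using h(1) by (rule test_pair_measurable)
  have "(LINT x|lborel. (f x - g x) * s x) = (LINT x|lborel. f x * s x) - (LINT x|lborel. g x * s x)"
    unfolding left_diff_distrib
    by (intro Bochner_Integration.integral_diff integrable_times_bounded[OF _ s K] assms)
  moreover have "\<bar>LINT x|lborel. f x * s x\<bar> \<le> V * B" "\<bar>LINT x|lborel. g x * s x\<bar> \<le> W * B"
    using assms(1,2) h unfolding weak_variation_le_def by blast+
  ultimately show "\<bar>LINT x|lborel. (f x - g x) * s x\<bar> \<le> (V + W) * B"
    by (simp add: distrib_right)
qed

text \<open>A diagonal subsequence makes the primitives \<open>F n\<close> converge at all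
  rationals. Integrals over cells with rational ends are differences of such values, hence Cauchy
  for any fixed mesh, and \<open>L1_norm_le_weak_variation\<close> is applied to differences of
  members.\<close>

lemma weak_variation_compactness:
  fixes f :: "nat \<Rightarrow> real \<Rightarrow> real"
  assumes int: "\<And>n. integrable lborel (f n)" and supp: "\<And>n x. x \<notin> {0..1} \<Longrightarrow> f n x = 0"
    and var: "\<And>n. weak_variation_le (f n) V" and norm: "\<And>n. (LINT x|lborel. \<bar>f n x\<bar>) \<le> M"
  obtains r h where "strict_mono (r :: nat \<Rightarrow> nat)" "integrable lborel h"
    "(\<lambda>n. LINT x|lborel. \<bar>f (r n) x - h x\<bar>) \<longlonglongrightarrow> 0"
proof -
  define F where "F n q = (LINT x|lborel. f n x * indicator {..q} x)" for n and q :: real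
  have Fint: "integrable lborel (\<lambda>x. f n x * indicator {..q} x)" for n and q :: real
    by (rule integrable_times_bounded[OF int, of _ 1]) (auto simp: indicator_def)
  have F_le: "norm (F n q) \<le> M" for n q
  proof -
    have "\<bar>F n q\<bar> \<le> 1 * (LINT x|lborel. \<bar>f n x\<bar>)"
      unfolding F_def by (rule abs_integral_times_le[OF int]) (auto simp: indicator_def)
    then show ?thesis using norm[of n] by simp
  qed
  obtain r where r: "strict_mono (r :: nat \<Rightarrow> nat)" "\<And>q. q \<in> \<rat> \<Longrightarrow> \<exists>l. (\<lambda>n. F (r n) q) \<longlonglongrightarrow> l"
    using function_convergent_subsequence[of "\<rat>" F M] F_le countable_rat by blast
  have "\<exists>N. \<forall>k\<ge>N. \<forall>n\<ge>N. (LINT x|lborel. \<bar>f (r k) x - f (r n) x\<bar>) < e" if e: "e > 0" for e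
  proof -
    \<comment> \<open>The mesh is fixed before the indices, so that the variation term takes at most
      half of \<open>e\<close>; the other half is shared equally by the m cells.\<close>
    obtain m :: nat where m: "0 < m" "(V + V) * (2 / m) < e / 2"
    proof -
      obtain m :: nat where m: "4 * \<bar>V + V\<bar> / e < m" using reals_Archimedean2 by blast
      moreover have "0 \<le> 4 * \<bar>V + V\<bar> / e" using e by simp
      ultimately have "0 < real m" by linarith
      then have "2 * \<bar>V + V\<bar> < m * (e / 2)" using m e by (simp add: field_simps)
      then have "2 * (V + V) < m * (e / 2)" using abs_ge_self[of "V + V"] by (smt (verit))
      then show thesis using that[of m] \<open>0 < real m\<close> by (auto simp: field_simps)
    qed
    define \<Delta> where "\<Delta> n j = F (r n) (real (Suc j) / m) - F (r n) (real j / m)" for n j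
    have "\<exists>N. \<forall>k\<ge>N. \<forall>n\<ge>N. \<bar>\<Delta> k j - \<Delta> n j\<bar> < e / (2 * m)" for j
    proof -
      have q: "real (Suc j) / m \<in> \<rat>" "real j / m \<in> \<rat>" by (auto intro!: Rats_divide simp del: of_nat_Suc)
      have "convergent (\<lambda>n. \<Delta> n j)"
        unfolding \<Delta>_def using r(2)[OF q(1)] r(2)[OF q(2)]
        unfolding convergent_def[symmetric] by (rule convergent_diff)
      then have "Cauchy (\<lambda>n. \<Delta> n j)" by (rule convergent_Cauchy)
      then show ?thesis using e m(1) by (auto simp: Cauchy_iff)
    qed
    then obtain N where N: "\<And>j k n. N j \<le> k \<Longrightarrow> N j \<le> n \<Longrightarrow> \<bar>\<Delta> k j - \<Delta> n j\<bar> < e / (2 * m)" by metis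
    \<comment> \<open>The sum of the \<open>N j\<close> exceeds each of them and serves as a common
      threshold for all cells.\<close>
    have "(LINT x|lborel. \<bar>f (r k) x - f (r n) x\<bar>) < e"
      if k: "k \<ge> (\<Sum>j<m. N j)" and n: "n \<ge> (\<Sum>j<m. N j)" for k n
    proof -
      \<comment> \<open>Half-open cells make the indicator exactly a difference of two half-line
        indicators.\<close>
      have cell: "(LINT x|lborel. (f (r k) x - f (r n) x) * indicator {real j / m<..real (Suc j) / m} x) = \<Delta> k j - \<Delta> n j" for j
      proof -
        have le: "real j / m \<le> real (Suc j) / m" by (simp add: divide_right_mono)
        have "(f (r k) x - f (r n) x) * indicator {real j / m<..real (Suc j) / m} x =
          (f (r k) x * indicator {..real (Suc j) / m} x - f (r k) x * indicator {..real j / m} x) -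
          (f (r n) x * indicator {..real (Suc j) / m} x - f (r n) x * indicator {..real j / m} x)" for x
          using le by (auto simp: indicator_def simp del: of_nat_Suc)
        then show ?thesis
          unfolding \<Delta>_def F_def using Fint
          by (simp del: of_nat_Suc add: Bochner_Integration.integral_diff Bochner_Integration.integrable_diff)
      qed
      have "(LINT x|lborel. \<bar>f (r k) x - f (r n) x\<bar>) \<le> (V + V) * (2 / real m) + (\<Sum>j<m. \<bar>\<Delta> k j - \<Delta> n j\<bar>)"
        using L1_norm_le_weak_variation[OF _ _ weak_variation_le_diff[OF var[of "r k"] var[of "r n"] int int] m(1)]
          int supp unfolding cell by (auto intro: Bochner_Integration.integrable_diff)
      moreover have "(\<Sum>j<m. \<bar>\<Delta> k j - \<Delta> n j\<bar>) \<le> (\<Sum>j<m. e / (2 * m))"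
      proof (rule sum_mono)
        fix j assume j: "j \<in> {..<m}"
        have "N j \<le> (\<Sum>j<m. N j)" using j by (intro member_le_sum) auto
        then show "\<bar>\<Delta> k j - \<Delta> n j\<bar> \<le> e / (2 * m)" using N[of j k n] k n by linarith
      qed
      moreover have "(\<Sum>j<m. e / (2 * m)) = e / 2" using m(1) by simp
      ultimately show ?thesis using m(2) by linarith
    qed
    then show ?thesis by blast
  qed
  then obtain h where "integrable lborel h" "(\<lambda>n. LINT x|lborel. \<bar>f (r n) x - h x\<bar>) \<longlonglongrightarrow> 0"
    using L1_Cauchy_converges[of lborel "\<lambda>n. f (r n)"] int by blast
  then show thesis using that r(1) by blast
qed

section \<open>The Perron--Frobenius operator and its dual\<close>

text \<open>\<open>Lim\<close> is unspecified where no limit exists. Existence of all one-sided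
  limits is what lets \<open>bv_version\<close> commute with bounded linear maps.\<close>

definition regulated :: "(real \<Rightarrow> 'a::real_normed_vector) \<Rightarrow> bool" where
  "regulated f \<longleftrightarrow> (\<forall>x. (\<exists>l. (f \<longlongrightarrow> l) (at_left x)) \<and> (\<exists>l. (f \<longlongrightarrow> l) (at_right x)))"

text \<open>Applied to real and imaginary parts, to the embedding of the reals and to scalings, this
  moves eigenfunctions between the real and the complex space.\<close>

lemma bv_version_bounded_linear:
  assumes L: "bounded_linear L" and f: "regulated f"
  shows "bv_version (\<lambda>x. L (f x)) = (\<lambda>x. L (bv_version f x))"
proof -
  interpret bounded_linear L by fact
  have Lim_eq: "Lim F (\<lambda>x. L (f x)) = L (Lim F f)" if "F \<noteq> bot" "\<exists>l. (f \<longlongrightarrow> l) F" for F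
    using that by (metis tendsto tendsto_Lim)
  have "Lim (at_left x) (\<lambda>x. L (f x)) = L (Lim (at_left x) f)"
    "Lim (at_right x) (\<lambda>x. L (f x)) = L (Lim (at_right x) f)" for x
    using f by (auto intro!: Lim_eq simp: regulated_def)
  then show ?thesis by (auto simp: fun_eq_iff bv_version_def scaleR add zero)
qed

lemma bv_version_isCont:
  assumes "isCont f x" "0 < x" "x < 1"
  shows "bv_version f x = f x"
proof -
  have "(f \<longlongrightarrow> f x) (at x)" using assms(1) by (simp add: isCont_def)
  then have "Lim (at_left x) f = f x" "Lim (at_right x) f = f x"
    by (auto intro!: tendsto_Lim intro: tendsto_within_subset)
  then show ?thesis using assms(2,3) by (simp add: bv_version_def scaleR_2[symmetric])
qed

lemma regulated_zero_outside:
  assumes "\<And>x. x \<notin> {0..1} \<Longrightarrow> f x = 0"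
    and "\<And>x. 0 < x \<Longrightarrow> x \<le> 1 \<Longrightarrow> \<exists>l. (f \<longlongrightarrow> l) (at_left x)"
    and "\<And>x. 0 \<le> x \<Longrightarrow> x < 1 \<Longrightarrow> \<exists>l. (f \<longlongrightarrow> l) (at_right x)"
  shows "regulated f"
  unfolding regulated_def
proof (intro allI conjI)
  fix x :: real
  show "\<exists>l. (f \<longlongrightarrow> l) (at_left x)"
  proof (cases "0 < x \<and> x \<le> 1")
    case False
    have "\<forall>\<^sub>F y in at_left x. f y = 0"
    proof (cases "x \<le> 0")
      case True then show ?thesis
        using assms(1) by (auto simp: eventually_at_filter intro!: always_eventually)
    next
      case False
      with \<open>\<not> (0 < x \<and> x \<le> 1)\<close> have "1 < x" by auto
      from eventually_at_left_real[OF this] show ?thesis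
        by eventually_elim (use assms(1) in auto)
    qed
    then show ?thesis using tendsto_eventually by blast
  qed (use assms(2) in auto)
  show "\<exists>l. (f \<longlongrightarrow> l) (at_right x)"
  proof (cases "0 \<le> x \<and> x < 1")
    case False
    have "\<forall>\<^sub>F y in at_right x. f y = 0"
    proof (cases "1 \<le> x")
      case True then show ?thesis
        using assms(1) by (auto simp: eventually_at_filter intro!: always_eventually)
    next
      case False
      with \<open>\<not> (0 \<le> x \<and> x < 1)\<close> have "x < 0" by auto
      from eventually_at_right_real[OF this] show ?thesis
        by eventually_elim (use assms(1) in auto)
    qed
    then show ?thesis using tendsto_eventually by blast
  qed (use assms(3) in auto)
qed

lemma BV_regulated: "(f :: real \<Rightarrow> real) \<in> BV \<Longrightarrow> regulated f"
  using one_sided_limits_if_bounded_variation[of f] BV_eq_0[of f]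
  by (intro regulated_zero_outside) (auto simp: BV_def)

lemma BV_complex_regulated:
  fixes f :: "real \<Rightarrow> complex"
  assumes "f \<in> BV"
  shows "regulated f"
proof -
  have "total_variation (\<lambda>x. Re (f x)) < \<infinity>" "total_variation (\<lambda>x. Im (f x)) < \<infinity>"
    using assms total_variation_bounded_linear[OF bounded_linear_Re, of f]
      total_variation_bounded_linear[OF bounded_linear_Im, of f] by (auto simp: BV_def)
  then have *: "regulated (\<lambda>x. Re (f x))" "regulated (\<lambda>x. Im (f x))"
    using one_sided_limits_if_bounded_variation BV_eq_0[OF assms]
    by (auto intro!: regulated_zero_outside)
  have "\<exists>l. (f \<longlongrightarrow> l) F" if "\<exists>l. ((\<lambda>x. Re (f x)) \<longlongrightarrow> l) F" "\<exists>l. ((\<lambda>x. Im (f x)) \<longlongrightarrow> l) F" for F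
    using that tendsto_Complex by fastforce
  then show ?thesis using * unfolding regulated_def by blast
qed

lemma BV_bounded_linear:
  assumes "bounded_linear L" "f \<in> BV" "regulated f"
  shows "(\<lambda>x. L (f x)) \<in> BV"
  using assms total_variation_bounded_linear[OF assms(1), of f] bv_version_bounded_linear[OF assms(1,3)]
  unfolding BV_def by simp

text \<open>Strict monotonicity prevents the limit value from being attained, so a one-sided
  approach is mapped to a one-sided approach, on the other side if \<xi> decreases. One-sided limits
  of a function then pass to its composition with \<xi>.\<close>

lemma monotone_continuous_one_sided:
  fixes \<xi> :: "real \<Rightarrow> real"
  assumes cont: "continuous_on {p..q} \<xi>"
    and mono: "(\<forall>x\<in>{p..q}. \<forall>y\<in>{p..q}. x < y \<longrightarrow> \<xi> x < \<xi> y) \<or> (\<forall>x\<in>{p..q}. \<forall>y\<in>{p..q}. x < y \<longrightarrow> \<xi> y < \<xi> x)"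
  shows "p < y \<Longrightarrow> y \<le> q \<Longrightarrow>
      filterlim \<xi> (at_left (\<xi> y)) (at_left y) \<or> filterlim \<xi> (at_right (\<xi> y)) (at_left y)"
    and "p \<le> y \<Longrightarrow> y < q \<Longrightarrow>
      filterlim \<xi> (at_left (\<xi> y)) (at_right y) \<or> filterlim \<xi> (at_right (\<xi> y)) (at_right y)"
proof -
  assume y: "p < y" "y \<le> q"
  have "(\<xi> \<longlongrightarrow> \<xi> y) (at y within {p..y})"
    by (rule tendsto_within_subset[of _ _ _ "{p..q}"]) (use cont y in \<open>auto simp: continuous_on_def\<close>)
  then have t: "(\<xi> \<longlongrightarrow> \<xi> y) (at_left y)" using y(1) by (simp add: at_within_Icc_at_left)
  have e: "\<forall>\<^sub>F z in at_left y. z \<in> {p<..<y}" using y(1) by (rule eventually_at_left_real)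
  show "filterlim \<xi> (at_left (\<xi> y)) (at_left y) \<or> filterlim \<xi> (at_right (\<xi> y)) (at_left y)"
    using mono
  proof
    assume "\<forall>x\<in>{p..q}. \<forall>y\<in>{p..q}. x < y \<longrightarrow> \<xi> x < \<xi> y"
    then have "\<forall>\<^sub>F z in at_left y. \<xi> z < \<xi> y" using e by (rule_tac eventually_mono[OF e]) (use y in auto)
    then show ?thesis using t by (auto intro!: tendsto_imp_filterlim_at_left)
  next
    assume "\<forall>x\<in>{p..q}. \<forall>y\<in>{p..q}. x < y \<longrightarrow> \<xi> y < \<xi> x"
    then have "\<forall>\<^sub>F z in at_left y. \<xi> y < \<xi> z" using e by (rule_tac eventually_mono[OF e]) (use y in auto)
    then show ?thesis using t by (auto intro!: tendsto_imp_filterlim_at_right)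
  qed
next
  assume y: "p \<le> y" "y < q"
  have "(\<xi> \<longlongrightarrow> \<xi> y) (at y within {y..q})"
    by (rule tendsto_within_subset[of _ _ _ "{p..q}"]) (use cont y in \<open>auto simp: continuous_on_def\<close>)
  then have t: "(\<xi> \<longlongrightarrow> \<xi> y) (at_right y)" using y(2) by (simp add: at_within_Icc_at_right)
  have e: "\<forall>\<^sub>F z in at_right y. z \<in> {y<..<q}" using y(2) by (rule eventually_at_right_real)
  show "filterlim \<xi> (at_left (\<xi> y)) (at_right y) \<or> filterlim \<xi> (at_right (\<xi> y)) (at_right y)"
    using mono
  proof
    assume "\<forall>x\<in>{p..q}. \<forall>y\<in>{p..q}. x < y \<longrightarrow> \<xi> x < \<xi> y"
    then have "\<forall>\<^sub>F z in at_right y. \<xi> y < \<xi> z" using e by (rule_tac eventually_mono[OF e]) (use y in auto)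
    then show ?thesis using t by (auto intro!: tendsto_imp_filterlim_at_right)
  next
    assume "\<forall>x\<in>{p..q}. \<forall>y\<in>{p..q}. x < y \<longrightarrow> \<xi> y < \<xi> x"
    then have "\<forall>\<^sub>F z in at_right y. \<xi> z < \<xi> y" using e by (rule_tac eventually_mono[OF e]) (use y in auto)
    then show ?thesis using t by (auto intro!: tendsto_imp_filterlim_at_left)
  qed
qed

text \<open>Branch i is carried by \<open>F i\<close>, not by \<open>T\<close>, because
  \<open>T\<close> is unconstrained at critical points while \<open>F i\<close> is smooth up to the
  ends of its closed cell. \<open>lam\<close> and \<open>M\<close> are parameters so that one pair
  can serve all small \<epsilon>.\<close>

locale expanding_branches =
  fixes T :: "real \<Rightarrow> real" and c :: "nat \<Rightarrow> real" and d :: nat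
    and F F' F'' :: "nat \<Rightarrow> real \<Rightarrow> real" and lam M :: real
  assumes c_ends: "c 0 = 0" "c d = 1"
    and c_less: "\<And>i. i < d \<Longrightarrow> c i < c (Suc i)"
    and lam_gt_1: "1 < lam"
    and F_deriv: "\<And>i x. i < d \<Longrightarrow> x \<in> {c i..c (Suc i)} \<Longrightarrow>
      (F i has_real_derivative F' i x) (at x within {c i..c (Suc i)})"
    and F'_deriv: "\<And>i x. i < d \<Longrightarrow> x \<in> {c i..c (Suc i)} \<Longrightarrow>
      (F' i has_real_derivative F'' i x) (at x within {c i..c (Suc i)})"
    and F''_cont: "\<And>i. i < d \<Longrightarrow> continuous_on {c i..c (Suc i)} (F'' i)"
    and F'_ge: "\<And>i x. i < d \<Longrightarrow> x \<in> {c i..c (Suc i)} \<Longrightarrow> lam \<le> \<bar>F' i x\<bar>"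
    and F''_le: "\<And>i x. i < d \<Longrightarrow> x \<in> {c i..c (Suc i)} \<Longrightarrow> \<bar>F'' i x\<bar> \<le> M"
    and F_restr: "\<And>i x. i < d \<Longrightarrow> x \<in> {c i..c (Suc i)} \<Longrightarrow> F i x = restr T (c i) (c (Suc i)) x"
    and F_range: "\<And>i x. i < d \<Longrightarrow> x \<in> {c i..c (Suc i)} \<Longrightarrow> F i x \<in> {0..1}"
begin

section \<open>Geometry of the branches and of their inverses\<close>

lemma c_mono: "i \<le> j \<Longrightarrow> j \<le> d \<Longrightarrow> c i \<le> c j"
  using partition_mono[of d c, OF c_less] .

lemma cell_subset: "i < d \<Longrightarrow> {c i..c (Suc i)} \<subseteq> {0..1}"
  using c_mono[of 0 i] c_mono[of "Suc i" d] c_ends by auto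

lemma cell_exists: "x \<in> {0..1} \<Longrightarrow> \<exists>i<d. x \<in> {c i..c (Suc i)}"
  using partition_cell_exists_closed[OF c_ends c_less] .

lemma F_cont: "i < d \<Longrightarrow> continuous_on {c i..c (Suc i)} (F i)"
  using F_deriv by (intro DERIV_continuous_on)

lemma F'_cont: "i < d \<Longrightarrow> continuous_on {c i..c (Suc i)} (F' i)"
  using F'_deriv by (intro DERIV_continuous_on)

lemma F'_nonzero: "i < d \<Longrightarrow> x \<in> {c i..c (Suc i)} \<Longrightarrow> F' i x \<noteq> 0"
  using F'_ge[of i x] lam_gt_1 by auto

lemma interior_deriv:
  assumes "i < d" "x \<in> {c i<..<c (Suc i)}"
  shows "(F i has_real_derivative F' i x) (at x)" "(F' i has_real_derivative F'' i x) (at x)"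
  using F_deriv[of i x] F'_deriv[of i x] assms at_within_interior[of x "{c i..c (Suc i)}"] by auto

text \<open>\<open>F' i\<close> is continuous and has no zero, so its sign is constant on the
  cell.\<close>

lemma F_monotone:
  assumes i: "i < d"
  shows "(\<forall>x\<in>{c i..c (Suc i)}. \<forall>y\<in>{c i..c (Suc i)}. x < y \<longrightarrow> F i x < F i y) \<or>
    (\<forall>x\<in>{c i..c (Suc i)}. \<forall>y\<in>{c i..c (Suc i)}. x < y \<longrightarrow> F i y < F i x)"
proof -
  have sign: "(\<forall>x\<in>{c i..c (Suc i)}. 0 < F' i x) \<or> (\<forall>x\<in>{c i..c (Suc i)}. F' i x < 0)"
  proof (rule ccontr)
    assume "\<not> ?thesis"
    then obtain x y where xy: "x \<in> {c i..c (Suc i)}" "y \<in> {c i..c (Suc i)}" "F' i x \<le> 0" "0 \<le> F' i y"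
      by (meson not_le)
    have "connected (F' i ` {c i..c (Suc i)})"
      by (intro connected_continuous_image F'_cont i) simp
    then have "0 \<in> F' i ` {c i..c (Suc i)}"
      using xy by (meson connectedD_interval imageI)
    then show False using F'_nonzero[OF i] by auto
  qed
  then show ?thesis
  proof
    assume pos: "\<forall>x\<in>{c i..c (Suc i)}. 0 < F' i x"
    have "F i x < F i y" if "x \<in> {c i..c (Suc i)}" "y \<in> {c i..c (Suc i)}" "x < y" for x y
    proof (rule DERIV_pos_imp_increasing_open[OF that(3)])
      show "continuous_on {x..y} (F i)" using F_cont[OF i] that by (auto intro: continuous_on_subset)
      show "\<exists>D. (F i has_real_derivative D) (at z) \<and> 0 < D" if "x < z" "z < y" for z
        using interior_deriv(1)[OF i, of z] pos that \<open>x \<in> _\<close> \<open>y \<in> _\<close> by (intro exI[of _ "F' i z"]) auto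
    qed
    then show ?thesis by blast
  next
    assume neg: "\<forall>x\<in>{c i..c (Suc i)}. F' i x < 0"
    have "F i y < F i x" if "x \<in> {c i..c (Suc i)}" "y \<in> {c i..c (Suc i)}" "x < y" for x y
    proof (rule DERIV_neg_imp_decreasing_open[OF that(3)])
      show "continuous_on {x..y} (F i)" using F_cont[OF i] that by (auto intro: continuous_on_subset)
      show "\<exists>D. (F i has_real_derivative D) (at z) \<and> D < 0" if "x < z" "z < y" for z
        using interior_deriv(1)[OF i, of z] neg that \<open>x \<in> _\<close> \<open>y \<in> _\<close> by (intro exI[of _ "F' i z"]) auto
    qed
    then show ?thesis by blast
  qed
qed

lemma F_inj: "i < d \<Longrightarrow> inj_on (F i) {c i..c (Suc i)}"
  by (rule linorder_inj_onI') (metis F_monotone less_irrefl)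

definition \<xi> :: "nat \<Rightarrow> real \<Rightarrow> real" where "\<xi> i = the_inv_into {c i..c (Suc i)} (F i)"
definition J :: "nat \<Rightarrow> real set" where "J i = F i ` {c i..c (Suc i)}"
definition lo :: "nat \<Rightarrow> real" where "lo i = min (F i (c i)) (F i (c (Suc i)))"
definition hi :: "nat \<Rightarrow> real" where "hi i = max (F i (c i)) (F i (c (Suc i)))"

lemma \<xi>_F: "i < d \<Longrightarrow> x \<in> {c i..c (Suc i)} \<Longrightarrow> \<xi> i (F i x) = x"
  unfolding \<xi>_def by (rule the_inv_into_f_f[OF F_inj])

lemma F_\<xi>: "i < d \<Longrightarrow> y \<in> J i \<Longrightarrow> F i (\<xi> i y) = y"
  unfolding \<xi>_def J_def by (rule f_the_inv_into_f[OF F_inj])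

lemma \<xi>_in: "i < d \<Longrightarrow> y \<in> J i \<Longrightarrow> \<xi> i y \<in> {c i..c (Suc i)}"
  using \<xi>_F by (auto simp: J_def)

lemma J_eq:
  assumes i: "i < d"
  shows "J i = {lo i..hi i}"
proof
  have le: "c i \<le> c (Suc i)" using c_less[OF i] by simp
  show "J i \<subseteq> {lo i..hi i}"
  proof
    fix y assume "y \<in> J i"
    then obtain x where x: "x \<in> {c i..c (Suc i)}" "y = F i x" by (auto simp: J_def)
    have ends: "c i \<in> {c i..c (Suc i)}" "c (Suc i) \<in> {c i..c (Suc i)}" using le by auto
    have "c i = x \<or> c i < x" "x = c (Suc i) \<or> x < c (Suc i)" using x(1) by auto
    then have "F i (c i) \<le> F i x \<and> F i x \<le> F i (c (Suc i)) \<or> F i (c (Suc i)) \<le> F i x \<and> F i x \<le> F i (c i)"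
      using F_monotone[OF i] x(1) ends by (metis less_imp_le order_refl)
    then show "y \<in> {lo i..hi i}"
      using x(2) by (auto simp: lo_def hi_def)
  qed
  have conn: "connected (J i)" unfolding J_def by (intro connected_continuous_image F_cont i) simp
  have "F i (c i) \<in> J i" "F i (c (Suc i)) \<in> J i" using le by (auto simp: J_def)
  then have "lo i \<in> J i" "hi i \<in> J i" by (auto simp: lo_def hi_def min_def max_def)
  then show "{lo i..hi i} \<subseteq> J i" using connected_contains_Icc[OF conn] by blast
qed

lemma \<xi>_monotone:
  assumes i: "i < d"
  shows "(\<forall>x\<in>J i. \<forall>y\<in>J i. x < y \<longrightarrow> \<xi> i x < \<xi> i y) \<or> (\<forall>x\<in>J i. \<forall>y\<in>J i. x < y \<longrightarrow> \<xi> i y < \<xi> i x)"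
  using F_monotone[OF i]
proof
  assume *: "\<forall>x\<in>{c i..c (Suc i)}. \<forall>y\<in>{c i..c (Suc i)}. x < y \<longrightarrow> F i x < F i y"
  have "\<xi> i x < \<xi> i y" if "x \<in> J i" "y \<in> J i" "x < y" for x y
    using * \<xi>_in[OF i] F_\<xi>[OF i] that by (metis less_asym linorder_neqE)
  then show ?thesis by blast
next
  assume *: "\<forall>x\<in>{c i..c (Suc i)}. \<forall>y\<in>{c i..c (Suc i)}. x < y \<longrightarrow> F i y < F i x"
  have "\<xi> i y < \<xi> i x" if "x \<in> J i" "y \<in> J i" "x < y" for x y
    using * \<xi>_in[OF i] F_\<xi>[OF i] that by (metis less_asym linorder_neqE)
  then show ?thesis by blast
qed

lemma \<xi>_cont: "i < d \<Longrightarrow> continuous_on (J i) (\<xi> i)"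
  unfolding J_def by (rule continuous_on_inv[OF F_cont]) (auto simp: \<xi>_F)

lemma \<xi>_interior:
  assumes "i < d" "y \<in> {lo i<..<hi i}"
  shows "\<xi> i y \<in> {c i<..<c (Suc i)}"
proof -
  have "y \<in> J i" using assms J_eq by auto
  then have "\<xi> i y \<in> {c i..c (Suc i)}" "F i (\<xi> i y) = y" using \<xi>_in F_\<xi> assms(1) by auto
  moreover have "y \<noteq> F i (c i)" "y \<noteq> F i (c (Suc i))" using assms(2) by (auto simp: lo_def hi_def)
  ultimately show ?thesis by (metis atLeastAtMost_iff greaterThanLessThan_iff order_le_less)
qed

lemma \<xi>_isCont:
  assumes "i < d" "y \<in> {lo i<..<hi i}"
  shows "isCont (\<xi> i) y"
  using \<xi>_cont[OF assms(1)] assms(2) unfolding J_eq[OF assms(1)]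
  by (auto intro: continuous_on_interior)

lemma deriv_\<xi>:
  assumes "i < d" "y \<in> {lo i<..<hi i}"
  shows "deriv (\<xi> i) y = 1 / F' i (\<xi> i y)"
proof -
  have x: "\<xi> i y \<in> {c i<..<c (Suc i)}" using \<xi>_interior[OF assms] .
  have "(\<xi> i has_real_derivative inverse (F' i (\<xi> i y))) (at y)"
  proof (rule DERIV_inverse_function[where a = "lo i" and b = "hi i"])
    show "(F i has_real_derivative F' i (\<xi> i y)) (at (\<xi> i y))" using interior_deriv(1)[OF assms(1) x] .
    show "F' i (\<xi> i y) \<noteq> 0" using F'_nonzero[OF assms(1)] x by auto
    show "F i (\<xi> i z) = z" if "lo i < z" "z < hi i" for z
      using F_\<xi>[OF assms(1)] J_eq[OF assms(1)] that by auto
    show "isCont (\<xi> i) y" using \<xi>_isCont[OF assms] .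
  qed (use assms in auto)
  then show ?thesis by (simp add: DERIV_imp_deriv inverse_eq_divide)
qed

section \<open>The summands of the Perron-Frobenius operator\<close>

definition pf_term :: "nat \<Rightarrow> (real \<Rightarrow> 'a::real_normed_vector) \<Rightarrow> real \<Rightarrow> 'a" where
  "pf_term i f x = (if x \<in> J i then \<bar>deriv (\<xi> i) x\<bar> *\<^sub>R f (\<xi> i x) else 0)"

lemma perron_frobenius_eq: "perron_frobenius T c d f = bv_version (\<lambda>x. \<Sum>i<d. pf_term i f x)"
proof -
  have inv: "the_inv_into {c i..c (Suc i)} (restr T (c i) (c (Suc i))) = \<xi> i" if "i < d" for i
    unfolding \<xi>_def the_inv_into_def using F_restr[OF that] by (simp cong: conj_cong)
  have im: "restr T (c i) (c (Suc i)) ` {c i..c (Suc i)} = J i" if "i < d" for i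
    unfolding J_def using F_restr[OF that] by (intro image_cong) auto
  show ?thesis
    unfolding perron_frobenius_def Let_def One_nat_def sum.atLeast1_atMost_eq
    by (intro arg_cong[of _ _ bv_version] ext sum.cong) (auto simp: inv im pf_term_def)
qed

lemma pf_term_eq: "i < d \<Longrightarrow> y \<in> {lo i<..<hi i} \<Longrightarrow> pf_term i f y = \<bar>1 / F' i (\<xi> i y)\<bar> *\<^sub>R f (\<xi> i y)"
  using J_eq[of i] by (simp add: pf_term_def deriv_\<xi>)

lemma pf_term_limit:
  assumes f: "regulated f" and i: "i < d" and y: "y \<in> J i" and G: "G \<noteq> bot" "G \<le> at y within {lo i..hi i}"
    "\<forall>\<^sub>F z in G. z \<in> {lo i<..<hi i}"
    and lim: "filterlim (\<xi> i) (at_left (\<xi> i y)) G \<or> filterlim (\<xi> i) (at_right (\<xi> i y)) G"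
  shows "\<exists>l. (pf_term i f \<longlongrightarrow> l) G"
proof -
  obtain l where l: "((\<lambda>z. f (\<xi> i z)) \<longlongrightarrow> l) G"
    using f lim unfolding regulated_def by (metis filterlim_compose)
  have "continuous_on (J i) (\<lambda>z. F' i (\<xi> i z))"
    by (rule continuous_on_compose2[OF F'_cont[OF i] \<xi>_cont[OF i]]) (use \<xi>_in[OF i] in auto)
  then have "((\<lambda>z. F' i (\<xi> i z)) \<longlongrightarrow> F' i (\<xi> i y)) G"
    using y G(2) unfolding continuous_on_def J_eq[OF i] by (meson tendsto_mono)
  then have "((\<lambda>z. \<bar>1 / F' i (\<xi> i z)\<bar> *\<^sub>R f (\<xi> i z)) \<longlongrightarrow> \<bar>1 / F' i (\<xi> i y)\<bar> *\<^sub>R l) G"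
    by (intro tendsto_intros l) (use F'_nonzero[OF i \<xi>_in[OF i y]] in auto)
  moreover have "\<forall>\<^sub>F z in G. \<bar>1 / F' i (\<xi> i z)\<bar> *\<^sub>R f (\<xi> i z) = pf_term i f z"
    using G(3) by eventually_elim (simp add: pf_term_eq[OF i])
  ultimately show ?thesis by (blast intro: Lim_transform_eventually)
qed

text \<open>On a side where y is approached through the image of the branch, the limit comes from a
  one-sided limit of f by way of \<xi>; on any other side the summand vanishes near y.\<close>

lemma regulated_pf_term:
  assumes f: "regulated f" and i: "i < d"
  shows "regulated (pf_term i f)"
  unfolding regulated_def
proof (intro allI conjI)
  fix y
  note sided = monotone_continuous_one_sided[OF \<xi>_cont[OF i, unfolded J_eq[OF i]] \<xi>_monotone[OF i, unfolded J_eq[OF i]]]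
  show "\<exists>l. (pf_term i f \<longlongrightarrow> l) (at_left y)"
  proof (cases "lo i < y \<and> y \<le> hi i")
    case True
    have "at_left y = at y within {lo i..y}" using True by (simp add: at_within_Icc_at_left)
    then have "at_left y \<le> at y within {lo i..hi i}" using True by (auto intro: at_le)
    moreover have "\<forall>\<^sub>F z in at_left y. z \<in> {lo i<..<hi i}"
      using eventually_at_left_real[of "lo i" y] True by (auto elim: eventually_mono)
    ultimately show ?thesis using sided(1)[of y] True J_eq[OF i]
      by (intro pf_term_limit[OF f i]) auto
  next
    case False
    have "\<forall>\<^sub>F z in at_left y. z \<notin> J i"
    proof (cases "y \<le> lo i")
      case True then show ?thesis using J_eq[OF i] by (auto simp: eventually_at_filter intro!: always_eventually)
    next
      case False
      then have "hi i < y" using \<open>\<not> (lo i < y \<and> y \<le> hi i)\<close> by auto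
      from eventually_at_left_real[OF this] show ?thesis using J_eq[OF i] by (auto elim: eventually_mono)
    qed
    then have "\<forall>\<^sub>F z in at_left y. pf_term i f z = 0" by eventually_elim (simp add: pf_term_def)
    then show ?thesis using tendsto_eventually by blast
  qed
  show "\<exists>l. (pf_term i f \<longlongrightarrow> l) (at_right y)"
  proof (cases "lo i \<le> y \<and> y < hi i")
    case True
    have "at_right y = at y within {y..hi i}" using True by (simp add: at_within_Icc_at_right)
    then have "at_right y \<le> at y within {lo i..hi i}" using True by (auto intro: at_le)
    moreover have "\<forall>\<^sub>F z in at_right y. z \<in> {lo i<..<hi i}"
      using eventually_at_right_real[of y "hi i"] True by (auto elim: eventually_mono)
    ultimately show ?thesis using sided(2)[of y] True J_eq[OF i]
      by (intro pf_term_limit[OF f i]) auto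
  next
    case False
    have "\<forall>\<^sub>F z in at_right y. z \<notin> J i"
    proof (cases "hi i \<le> y")
      case True then show ?thesis using J_eq[OF i] by (auto simp: eventually_at_filter intro!: always_eventually)
    next
      case False
      then have "y < lo i" using \<open>\<not> (lo i \<le> y \<and> y < hi i)\<close> by auto
      from eventually_at_right_real[OF this] show ?thesis using J_eq[OF i] by (auto elim: eventually_mono)
    qed
    then have "\<forall>\<^sub>F z in at_right y. pf_term i f z = 0" by eventually_elim (simp add: pf_term_def)
    then show ?thesis using tendsto_eventually by blast
  qed
qed

lemma regulated_pf_sum:
  assumes "regulated f"
  shows "regulated (\<lambda>x. \<Sum>i<d. pf_term i f x)"
proof -
  have "\<exists>l. ((\<lambda>x. \<Sum>i<d. pf_term i f x) \<longlongrightarrow> l) G" if "\<And>i. i < d \<Longrightarrow> \<exists>l. (pf_term i f \<longlongrightarrow> l) G" for G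
  proof -
    have "\<forall>i\<in>{..<d}. \<exists>l. (pf_term i f \<longlongrightarrow> l) G" using that by blast
    then obtain l where "\<forall>i\<in>{..<d}. (pf_term i f \<longlongrightarrow> l i) G" by (rule bchoice[THEN exE])
    then have "((\<lambda>x. \<Sum>i<d. pf_term i f x) \<longlongrightarrow> (\<Sum>i<d. l i)) G" by (intro tendsto_sum) auto
    then show ?thesis by blast
  qed
  then show ?thesis using regulated_pf_term[OF assms] unfolding regulated_def by blast
qed

lemma perron_frobenius_bounded_linear:
  assumes "bounded_linear L" "regulated f"
  shows "perron_frobenius T c d (\<lambda>x. L (f x)) = (\<lambda>x. L (perron_frobenius T c d f x))"
proof -
  interpret bounded_linear L by fact
  have "(\<lambda>x. \<Sum>i<d. pf_term i (\<lambda>x. L (f x)) x) = (\<lambda>x. L (\<Sum>i<d. pf_term i f x))"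
    by (auto simp: sum pf_term_def scaleR zero intro!: sum.cong)
  then show ?thesis
    unfolding perron_frobenius_eq
    using bv_version_bounded_linear[OF assms(1) regulated_pf_sum[OF assms(2)]] by simp
qed

text \<open>Taking means of one-sided limits changes nothing at points of continuity. The exceptions
  are 0 and 1, the ends of the branch images and the images of discontinuities of f: a countable
  set, invisible to integrals.\<close>

lemma perron_frobenius_eq_off_countable:
  fixes f :: "real \<Rightarrow> real"
  assumes f: "f \<in> BV"
  shows "\<exists>E. countable E \<and> (\<forall>x. x \<notin> E \<longrightarrow> perron_frobenius T c d f x = (\<Sum>i<d. pf_term i f x))"
proof -
  define D where "D = {x. \<not> isCont f x}"
  define E where "E = {0, 1} \<union> (\<Union>i<d. {lo i, hi i} \<union> F i ` D)"
  have "countable E" unfolding E_def D_def using BV_countable_discontinuities[OF f] by auto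
  moreover have "perron_frobenius T c d f x = (\<Sum>i<d. pf_term i f x)" if x: "x \<notin> E" for x
  proof (cases "0 < x \<and> x < 1")
    case True
    have "isCont (pf_term i f) x" if i: "i < d" for i
    proof (cases "x \<in> J i")
      case True
      then have x': "x \<in> {lo i<..<hi i}" using x i J_eq[OF i] unfolding E_def by force
      have "\<xi> i x \<notin> D"
      proof
        assume "\<xi> i x \<in> D"
        then have "F i (\<xi> i x) \<in> F i ` D" by blast
        then show False using F_\<xi>[OF i True] x i unfolding E_def by auto
      qed
      then have fc: "isCont f (\<xi> i x)" by (simp add: D_def)
      have xi: "\<xi> i x \<in> {c i<..<c (Suc i)}" using \<xi>_interior[OF i x'] .
      have F'c: "isCont (F' i) (\<xi> i x)" using interior_deriv(2)[OF i xi] by (rule DERIV_isCont)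
      have \<xi>c: "isCont (\<xi> i) x" using \<xi>_isCont[OF i x'] .
      have "isCont (\<lambda>z. F' i (\<xi> i z)) x" "isCont (\<lambda>z. f (\<xi> i z)) x"
        by (rule isCont_o2[OF \<xi>c F'c], rule isCont_o2[OF \<xi>c fc])
      then have "isCont (\<lambda>z. \<bar>1 / F' i (\<xi> i z)\<bar> *\<^sub>R f (\<xi> i z)) x"
        using F'_nonzero[OF i, of "\<xi> i x"] xi by (intro continuous_intros) auto
      moreover have "\<forall>\<^sub>F z in nhds x. \<bar>1 / F' i (\<xi> i z)\<bar> *\<^sub>R f (\<xi> i z) = pf_term i f z"
        using eventually_nhds_in_open[OF open_greaterThanLessThan x']
        by (rule eventually_mono) (simp add: pf_term_eq[OF i])
      ultimately show ?thesis using isCont_cong by fast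
    next
      case False
      have "open (- J i)" unfolding J_eq[OF i] by (intro open_Compl closed_real_atLeastAtMost)
      then have "\<forall>\<^sub>F z in nhds x. z \<in> - J i"
        by (rule eventually_nhds_in_open) (use False in auto)
      then have "\<forall>\<^sub>F z in nhds x. pf_term i f z = 0" by eventually_elim (simp add: pf_term_def)
      then show ?thesis using isCont_cong[of "pf_term i f" "\<lambda>_. 0" x] by simp
    qed
    then have "isCont (\<lambda>x. \<Sum>i<d. pf_term i f x) x" by (intro continuous_intros) auto
    then show ?thesis unfolding perron_frobenius_eq using True by (intro bv_version_isCont) auto
  next
    case False
    then have x': "x < 0 \<or> 1 < x" using x unfolding E_def by force
    have "x \<notin> J i" if "i < d" for i
      using F_range[OF that] x' by (force simp: J_def)
    then have "pf_term i f x = 0" if "i < d" for i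
      using that by (simp add: pf_term_def)
    then show ?thesis unfolding perron_frobenius_eq bv_version_def using x' by simp
  qed
  ultimately show ?thesis by blast
qed

text \<open>A Borel version of \<open>T\<close> on the whole line: it agrees with \<open>T\<close>
  inside the cells and is 0 at critical points and off [0,1], where \<open>T\<close> may be
  anything. The clamp makes each summand measurable although \<open>F i\<close> is controlled on its
  cell only.\<close>

definition T_meas :: "real \<Rightarrow> real" where
  "T_meas x = (\<Sum>i<d. indicator {c i<..<c (Suc i)} x * F i (max (c i) (min (c (Suc i)) x)))"

lemma T_meas_eq:
  assumes "i < d" "x \<in> {c i<..<c (Suc i)}"
  shows "T_meas x = F i x"
proof -
  have "indicator {c j<..<c (Suc j)} x * F j (max (c j) (min (c (Suc j)) x)) = (if j = i then F i x else 0)"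
    if "j < d" for j
  proof -
    have "c (Suc j) \<le> c i" if "j < i" using that assms by (intro c_mono) auto
    moreover have "c (Suc i) \<le> c j" if "i < j" using that \<open>j < d\<close> by (intro c_mono) auto
    ultimately show ?thesis using assms(2) by (cases j i rule: linorder_cases) (auto simp: indicator_def)
  qed
  then have "T_meas x = (\<Sum>j<d. if j = i then F i x else 0)"
    unfolding T_meas_def by (intro sum.cong) auto
  then show ?thesis using assms(1) by simp
qed

lemma F_eq_T: "i < d \<Longrightarrow> x \<in> {c i<..<c (Suc i)} \<Longrightarrow> F i x = T x"
  using F_restr[of i x] by (auto simp: restr_def)

lemma clamp_cont: 
  assumes "i < d" "continuous_on {c i..c (Suc i)} g"
  shows "continuous_on UNIV (\<lambda>x. g (max (c i) (min (c (Suc i)) x)))"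
  by (rule continuous_on_compose2[OF assms(2)]) (use c_less[OF assms(1)] in \<open>auto intro!: continuous_intros\<close>)

lemma clamp_measurable [measurable]: 
  assumes "i < d" "continuous_on {c i..c (Suc i)} g"
  shows "(\<lambda>x. g (max (c i) (min (c (Suc i)) x))) \<in> borel_measurable borel"
  using clamp_cont[OF assms] by (rule borel_measurable_continuous_onI)

lemma T_meas_measurable [measurable]: "T_meas \<in> borel_measurable borel"
  unfolding T_meas_def by (intro borel_measurable_sum borel_measurable_times clamp_measurable F_cont) auto

lemma AE_interior: "AE x in lborel. x \<in> {0..1} \<longrightarrow> (\<exists>i<d. x \<in> {c i<..<c (Suc i)})"
proof -
  have "AE x in lborel. x \<notin> c ` {..d}"
    by (intro AE_not_in countable_imp_null_set_lborel) auto
  then show ?thesis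
  proof eventually_elim
    case (elim x)
    show ?case
    proof
      assume "x \<in> {0..1}"
      then obtain i where i: "i < d" "x \<in> {c i..c (Suc i)}" using cell_exists by blast
      moreover have "x \<noteq> c i" "x \<noteq> c (Suc i)" using elim i by auto
      ultimately show "\<exists>i<d. x \<in> {c i<..<c (Suc i)}" by (intro exI[of _ i]) auto
    qed
  qed
qed

text \<open>Change of variables y = \<open>F i x\<close>: the derivative factor in
  \<open>pf_term\<close> cancels the Jacobian. Integrating over the whole line is harmless because,
  off the image of the open cell, the summand can be nonzero only at the two end values.\<close>

lemma pf_term_integral:
  fixes f g :: "real \<Rightarrow> real"
  assumes f: "f \<in> BV" and g: "g \<in> borel_measurable borel" "\<And>x. \<bar>g x\<bar> \<le> B" and i: "i < d"
  shows "((\<lambda>y. pf_term i f y * g y) has_integral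
    (LINT x|lborel. indicator {c i<..<c (Suc i)} x * (f x * g (T_meas x)))) UNIV"
proof -
  let ?S = "{c i<..<c (Suc i)}"
  let ?b = "LINT x|lborel. indicator ?S x * (f x * g (T_meas x))"
  let ?h = "\<lambda>y. pf_term i f y * g y"
  have eq: "\<bar>F' i x\<bar> * ?h (F i x) = f x * g (T_meas x)" if x: "x \<in> ?S" for x
  proof -
    have "F i x \<in> J i" using x by (auto simp: J_def)
    moreover have "F i x \<noteq> F i (c i)" "F i x \<noteq> F i (c (Suc i))"
      using F_inj[OF i] x c_less[OF i] by (auto dest!: inj_onD)
    ultimately have "F i x \<in> {lo i<..<hi i}"
      unfolding J_eq[OF i] by (auto simp: lo_def hi_def min_def max_def split: if_splits)
    then show ?thesis
      using x i F'_nonzero[OF i, of x] by (simp add: pf_term_eq \<xi>_F T_meas_eq)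
  qed
  have "(\<lambda>x. g (T_meas x)) \<in> borel_measurable borel" using g(1) by measurable
  then have int: "integrable lborel (\<lambda>x. indicator ?S x * (f x * g (T_meas x)))"
    using integrable_mult_indicator[of ?S lborel "\<lambda>x. f x * g (T_meas x)"]
      integrable_times_bounded[OF BV_integrable[OF f], of "\<lambda>x. g (T_meas x)" B] g(2) by simp
  then have si: "set_integrable lborel ?S (\<lambda>x. f x * g (T_meas x))"
    by (simp add: set_integrable_def)
  have ai: "(\<lambda>x. f x * g (T_meas x)) absolutely_integrable_on ?S"
    using si integrable_completion[of "\<lambda>x. indicator ?S x *\<^sub>R (f x * g (T_meas x))" lborel]
      borel_measurable_integrable[OF int] by (simp add: set_integrable_def)
  have hi: "integral ?S (\<lambda>x. f x * g (T_meas x)) = ?b"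
    using set_borel_integral_eq_integral(2)[OF si] by (simp add: set_lebesgue_integral_def)
  have "(\<lambda>x. \<bar>F' i x\<bar> * ?h (F i x)) absolutely_integrable_on ?S \<and> integral ?S (\<lambda>x. \<bar>F' i x\<bar> * ?h (F i x)) = ?b"
  proof
    show "(\<lambda>x. \<bar>F' i x\<bar> * ?h (F i x)) absolutely_integrable_on ?S"
      by (rule set_integrable_cong[OF refl refl eq, THEN iffD2]) (use ai in auto)
    have "integral ?S (\<lambda>x. \<bar>F' i x\<bar> * ?h (F i x)) = integral ?S (\<lambda>x. f x * g (T_meas x))"
      by (rule Henstock_Kurzweil_Integration.integral_cong) (rule eq)
    then show "integral ?S (\<lambda>x. \<bar>F' i x\<bar> * ?h (F i x)) = ?b" using hi by simp
  qed
  moreover have "(F i has_real_derivative F' i x) (at x within ?S)" if "x \<in> ?S" for x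
    using interior_deriv(1)[OF i that] by (rule DERIV_subset) auto
  moreover have "inj_on (F i) ?S" using F_inj[OF i] by (rule inj_on_subset) auto
  ultimately have h: "?h absolutely_integrable_on (F i ` ?S)" "integral (F i ` ?S) ?h = ?b"
    using has_absolute_integral_change_of_variables_1'[of ?S "F i" "F' i" ?h ?b] by auto
  have "(?h has_integral ?b) (F i ` ?S)"
    using h set_lebesgue_integral_eq_integral(1)[OF h(1)] by (simp add: has_integral_iff)
  moreover have "negligible {x \<in> UNIV - F i ` ?S. ?h x \<noteq> 0}"
  proof (rule negligible_subset[of "{F i (c i), F i (c (Suc i))}"])
    show "{x \<in> UNIV - F i ` ?S. ?h x \<noteq> 0} \<subseteq> {F i (c i), F i (c (Suc i))}"
    proof
      fix y assume "y \<in> {x \<in> UNIV - F i ` ?S. ?h x \<noteq> 0}"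
      then have y: "y \<notin> F i ` ?S" "pf_term i f y \<noteq> 0" by auto
      then have "y \<in> J i" unfolding pf_term_def by presburger
      then obtain x where x: "x \<in> {c i..c (Suc i)}" "y = F i x" by (auto simp: J_def)
      then have "x \<notin> ?S" using y(1) by blast
      then have "x = c i \<or> x = c (Suc i)" using x(1) by auto
      then show "y \<in> {F i (c i), F i (c (Suc i))}" using x(2) by blast
    qed
  qed auto
  ultimately show ?thesis
    using has_integral_spike_set_eq[of "F i ` ?S" UNIV ?h ?b] by (simp add: negligible_subset)
qed

text \<open>The changes of variables are summed over the cells, which cover [0,1] up to finitely
  many points. Membership of the image in \<open>BV\<close> provides integrability; for an
  eigenfunction it is immediate.\<close>

lemma perron_frobenius_duality:
  fixes f g :: "real \<Rightarrow> real"
  assumes f: "f \<in> BV" and k: "perron_frobenius T c d f \<in> BV"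
    and g: "g \<in> borel_measurable borel" "\<And>x. \<bar>g x\<bar> \<le> B"
  shows "(LINT x|lborel. perron_frobenius T c d f x * g x) = (LINT x|lborel. f x * g (T_meas x))"
proof -
  let ?k = "perron_frobenius T c d f"
  obtain E where E: "countable E" "\<And>x. x \<notin> E \<Longrightarrow> ?k x = (\<Sum>i<d. pf_term i f x)"
    using perron_frobenius_eq_off_countable[OF f] by blast
  have gT [measurable]: "(\<lambda>x. g (T_meas x)) \<in> borel_measurable borel" using g(1) by measurable
  have fint: "integrable lborel (\<lambda>x. f x * g (T_meas x))"
    using integrable_times_bounded[OF BV_integrable[OF f] gT] g(2) by blast
  have sum_int: "((\<lambda>y. \<Sum>i<d. pf_term i f y * g y) has_integral
      (\<Sum>i<d. LINT x|lborel. indicator {c i<..<c (Suc i)} x * (f x * g (T_meas x)))) UNIV"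
    by (intro has_integral_sum pf_term_integral[OF f g]) auto
  have k_eq: "?k y * g y = (\<Sum>i<d. pf_term i f y * g y)" if "y \<in> UNIV - E" for y
    using E(2)[of y] that by (simp add: sum_distrib_right)
  have "negligible E"
    using E(1) by (simp add: negligible_iff_null_sets countable_imp_null_set_lborel null_sets_completionI)
  then have "((\<lambda>y. ?k y * g y) has_integral
      (\<Sum>i<d. LINT x|lborel. indicator {c i<..<c (Suc i)} x * (f x * g (T_meas x)))) UNIV"
    using k_eq sum_int by (rule has_integral_spike)
  moreover have "((\<lambda>y. ?k y * g y) has_integral (LINT x|lborel. ?k x * g x)) UNIV"
    by (rule has_integral_integral_lborel, rule integrable_times_bounded[OF BV_integrable[OF k] g])
  ultimately have "(LINT x|lborel. ?k x * g x) =
      (\<Sum>i<d. LINT x|lborel. indicator {c i<..<c (Suc i)} x * (f x * g (T_meas x)))"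
    by (rule has_integral_unique[rotated])
  also have "\<dots> = (LINT x|lborel. (\<Sum>i<d. indicator {c i<..<c (Suc i)} x * (f x * g (T_meas x))))"
    using integrable_mult_indicator[OF _ fint, of "{c i<..<c (Suc i)}" for i]
    by (intro Bochner_Integration.integral_sum[symmetric]) auto
  also have "\<dots> = (LINT x|lborel. f x * g (T_meas x))"
  proof (rule integral_cong_AE)
    show "AE x in lborel. (\<Sum>i<d. indicator {c i<..<c (Suc i)} x * (f x * g (T_meas x))) = f x * g (T_meas x)"
      using AE_interior
    proof eventually_elim
      case (elim x)
      show ?case
      proof (cases "x \<in> {0..1}")
        case True
        then obtain i where i: "i < d" "x \<in> {c i<..<c (Suc i)}" using elim by blast
        have "indicator {c j<..<c (Suc j)} x * (f x * g (T_meas x)) = (if j = i then f x * g (T_meas x) else 0)"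
          if "j < d" for j
        proof -
          have "c (Suc j) \<le> c i" if "j < i" using that i by (intro c_mono) auto
          moreover have "c (Suc i) \<le> c j" if "i < j" using that \<open>j < d\<close> by (intro c_mono) auto
          ultimately show ?thesis using i(2) by (cases j i rule: linorder_cases) (auto simp: indicator_def)
        qed
        then have "(\<Sum>j<d. indicator {c j<..<c (Suc j)} x * (f x * g (T_meas x))) =
          (\<Sum>j<d. if j = i then f x * g (T_meas x) else 0)" by (intro sum.cong) auto
        then show ?thesis using i(1) by simp
      qed (use BV_eq_0[OF f] in auto)
    qed
  qed (use BV_borel_measurable[OF f] in measurable)
  finally show ?thesis .
qed

end

section \<open>Lasota--Yorke estimate along the backward iteration of test functions\<close>

text \<open>The choice \<open>z = x\<close> is an ordinary step of the orbit; the choice of a break point \<open>z\<close> near \<open>x\<close> accounts for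
  the value of \<open>g \<circ> T\<close> at the break point that a tent brings into the bound at \<open>x\<close>.\<close>

definition branch_step ::
  "(nat \<Rightarrow> real) \<Rightarrow> nat \<Rightarrow> (nat \<Rightarrow> real \<Rightarrow> real) \<Rightarrow> real \<Rightarrow> real \<Rightarrow> real \<Rightarrow> bool" where
  "branch_step c d F \<eta> x y \<longleftrightarrow> (\<exists>i<d. \<exists>z\<in>{c i..c (Suc i)}. \<bar>z - x\<bar> < \<eta> \<and> y = F i z)"

context expanding_branches begin

text \<open>The derivative of a test function is available in the open interval only, so interior
  points have to stay interior for the chain rule.\<close>

lemma F_interior:
  assumes "i < d" "x \<in> {c i<..<c (Suc i)}"
  shows "F i x \<in> {0<..<1}"
proof -
  have le: "c i \<le> c (Suc i)" using c_less[OF assms(1)] by simp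
  have "F i x \<in> J i" using assms by (auto simp: J_def)
  moreover have "F i x \<noteq> F i (c i)" "F i x \<noteq> F i (c (Suc i))"
    using F_inj[OF assms(1)] assms(2) le by (auto dest!: inj_onD)
  ultimately have "F i x \<in> {lo i<..<hi i}"
    unfolding J_eq[OF assms(1)] by (auto simp: lo_def hi_def min_def max_def split: if_splits)
  moreover have "0 \<le> lo i" "hi i \<le> 1"
    using F_range[OF assms(1), of "c i"] F_range[OF assms(1), of "c (Suc i)"] le by (auto simp: lo_def hi_def)
  ultimately show ?thesis by auto
qed

text \<open>The quotient h = (g o F) / F' has derivative s o F - (g o F) F'' / F'^2. So s o T is the
  derivative of a new test function up to a bounded error: \<open>B * M\<close> from distortion, as
  |F'| >= 1, and \<open>2 * B / \<eta>\<close> from the slopes of the tents. Cells of length at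
  least \<open>2 * \<eta>\<close> keep the two tents of a cell apart, so at most one break point
  enters the bound at x.\<close>

lemma test_pair_pullback:
  assumes gs: "test_pair g s" and B: "\<And>x. x \<in> {0..1} \<Longrightarrow> \<bar>g x\<bar> \<le> B"
    and \<eta>: "0 < \<eta>" "\<And>i. i < d \<Longrightarrow> 2 * \<eta> \<le> c (Suc i) - c i"
  obtains H S where "test_pair H S"
    "\<And>i x. i < d \<Longrightarrow> x \<in> {c i..c (Suc i)} \<Longrightarrow> \<bar>H x\<bar> \<le> \<bar>g (F i x)\<bar> / lam \<or>
       (\<exists>j\<in>{i, Suc i}. 0 < j \<and> j < d \<and> \<bar>x - c j\<bar> < \<eta> \<and>
          \<bar>H x\<bar> \<le> (\<bar>g (F i x)\<bar> + \<bar>g (F i (c j))\<bar>) / lam)"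
    "\<And>i x. i < d \<Longrightarrow> x \<in> {c i<..<c (Suc i)} \<Longrightarrow> \<bar>s (T_meas x) - S x\<bar> \<le> B * (M + 2 / \<eta>)"
proof -
  define cl where "cl i x = max (c i) (min (c (Suc i)) x)" for i x
  define h where "h i x = g (F i x) / F' i x" for i x
  define \<tau> where "\<tau> u = max 0 (1 - u / \<eta>)" for u
  \<comment> \<open>The heights of the tents are the end values of h. There is no tent at 0 and 1,
    where a test function need not vanish.\<close>
  define P where "P i = (if 0 < i then h i (c i) else 0)" for i
  define Q where "Q i = (if Suc i < d then h i (c (Suc i)) else 0)" for i
  define G where "G i x = h i x - P i * \<tau> (x - c i) - Q i * \<tau> (c (Suc i) - x)" for i x
  define r where "r i x = g (F i x) * F'' i x / (F' i x)^2" for i x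
  \<comment> \<open>Both tents are subtracted: the left one descends and contributes a positive
    multiple of \<open>P i\<close>, the right one ascends and contributes a negative multiple of
    \<open>Q i\<close>.\<close>
  define t where "t i x = (if x - c i < \<eta> then P i / \<eta> else 0) - (if c (Suc i) - x < \<eta> then Q i / \<eta> else 0)" for i x
  define s' where "s' i x = s (F i (cl i x)) - r i (cl i x) + t i x" for i x
  obtain K where K: "\<And>x. \<bar>s x\<bar> \<le> K" using gs by (auto simp: test_pair_def)
  have sm [measurable]: "s \<in> borel_measurable borel" using gs by (rule test_pair_measurable)
  have gcont: "continuous_on {0..1} g" using gs by (simp add: test_pair_def)
  obtain E where E: "finite E" "\<And>x. x \<in> {0<..<1} - E \<Longrightarrow> (g has_real_derivative s x) (at x)"
    using gs by (auto simp: test_pair_def)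
  have B0: "0 \<le> B" using B[of 0] by auto
  have ends: "c i \<in> {c i..c (Suc i)}" "c (Suc i) \<in> {c i..c (Suc i)}" if "i < d" for i
    using c_less[OF that] by auto
  have gF_cont: "continuous_on {c i..c (Suc i)} (\<lambda>x. g (F i x))" if "i < d" for i
    by (rule continuous_on_compose2[OF gcont F_cont[OF that]]) (use F_range[OF that] in auto)
  have h_cont: "continuous_on {c i..c (Suc i)} (h i)" if "i < d" for i
    unfolding h_def using F'_nonzero[OF that]
    by (intro continuous_on_divide gF_cont F'_cont that) auto
  have r_cont: "continuous_on {c i..c (Suc i)} (r i)" if "i < d" for i
    unfolding r_def using F'_nonzero[OF that]
    by (intro continuous_on_divide continuous_on_mult continuous_on_power gF_cont F'_cont F''_cont that) auto
  have h_le: "\<bar>h i x\<bar> \<le> \<bar>g (F i x)\<bar> / lam" if "i < d" "x \<in> {c i..c (Suc i)}" for i x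
    unfolding h_def abs_divide using F'_ge[OF that] lam_gt_1 by (intro divide_left_mono) (auto intro!: mult_pos_pos)
  have h_le_B: "\<bar>h i x\<bar> \<le> B" if "i < d" "x \<in> {c i..c (Suc i)}" for i x
  proof -
    have "\<bar>g (F i x)\<bar> / lam \<le> B / 1"
      using B[OF F_range[OF that]] lam_gt_1 by (intro frac_le) auto
    then show ?thesis using h_le[OF that] by simp
  qed
  have r_le: "\<bar>r i x\<bar> \<le> B * M" if "i < d" "x \<in> {c i..c (Suc i)}" for i x
  proof -
    have F1: "1 \<le> \<bar>F' i x\<bar>" using F'_ge[OF that] lam_gt_1 by simp
    have "\<bar>g (F i x) * F'' i x\<bar> \<le> B * M"
      unfolding abs_mult using B[OF F_range[OF that]] F''_le[OF that] B0 by (intro mult_mono) auto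
    moreover have "1 \<le> \<bar>F' i x\<bar>^2" using F1 by (rule one_le_power)
    ultimately have "\<bar>g (F i x) * F'' i x\<bar> / \<bar>F' i x\<bar>^2 \<le> (B * M) / 1"
      by (intro frac_le) auto
    then show ?thesis by (simp add: r_def abs_divide power_abs)
  qed
  have PQ_le: "\<bar>P i\<bar> \<le> B" "\<bar>Q i\<bar> \<le> B" if "i < d" for i
    using h_le_B[OF that] ends[OF that] B0 by (auto simp: P_def Q_def)
  have t_le: "\<bar>t i x\<bar> \<le> B * (2 / \<eta>)" if "i < d" for i x
  proof -
    have "\<bar>P i / \<eta>\<bar> \<le> B / \<eta>" "\<bar>Q i / \<eta>\<bar> \<le> B / \<eta>"
      using PQ_le[OF that] \<eta>(1) by (simp_all add: abs_divide divide_right_mono)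
    moreover have "\<bar>(if a then p else 0) - (if b then q else 0)\<bar> \<le> \<bar>p\<bar> + \<bar>q\<bar>" for a b and p q :: real
      by auto
    ultimately have "\<bar>t i x\<bar> \<le> B / \<eta> + B / \<eta>" unfolding t_def by (meson add_mono order_trans)
    then show ?thesis by (simp add: mult.commute)
  qed
  have s'_eq: "s' i x = s (F i x) - r i x + t i x" if "x \<in> {c i..c (Suc i)}" for i x
    using that by (simp add: s'_def cl_def)
  have \<tau>_0: "\<tau> 0 = 1" "\<eta> \<le> u \<Longrightarrow> \<tau> u = 0" for u using \<eta>(1) by (auto simp: \<tau>_def field_simps)
  have \<tau>_01: "0 \<le> u \<Longrightarrow> 0 \<le> \<tau> u \<and> \<tau> u \<le> 1" for u using \<eta>(1) by (auto simp: \<tau>_def)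
  have \<tau>_lt: "u < \<eta> \<Longrightarrow> \<tau> u = 1 - u / \<eta>" for u using \<eta>(1) by (auto simp: \<tau>_def field_simps)
  have \<tau>_cont: "continuous_on A \<tau>" for A unfolding \<tau>_def using \<eta>(1) by (intro continuous_intros) auto
  have \<tau>_der: "(\<tau> has_real_derivative (if u < \<eta> then - 1 / \<eta> else 0)) (at u)" if "u \<noteq> \<eta>" for u
  proof (cases "u < \<eta>")
    case True
    have "((\<lambda>u. 1 - u / \<eta>) has_real_derivative - 1 / \<eta>) (at u)"
      using \<eta>(1) by (auto intro!: derivative_eq_intros)
    moreover have "\<forall>\<^sub>F v in nhds u. 1 - v / \<eta> = \<tau> v"
      using eventually_nhds_in_open[OF open_lessThan, of u \<eta>] True
      by (auto elim!: eventually_mono simp: \<tau>_lt)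
    ultimately show ?thesis using True by (simp add: DERIV_cong_ev)
  next
    case False
    then have "\<eta> < u" using that by simp
    then have "\<forall>\<^sub>F v in nhds u. 0 = \<tau> v"
      using eventually_nhds_in_open[OF open_greaterThan, of u \<eta>]
      by (auto elim!: eventually_mono simp: \<tau>_0)
    moreover have "((\<lambda>_. 0) has_real_derivative 0) (at u)" by simp
    ultimately show ?thesis using False DERIV_cong_ev[of u u "\<lambda>_. 0" \<tau> 0 0] by simp
  qed
  have G_cont: "continuous_on {c i..c (Suc i)} (G i)" if "i < d" for i
    unfolding G_def by (intro continuous_intros h_cont that continuous_on_compose2[OF \<tau>_cont[of UNIV]]) auto
  have G_zero1: "G i (c i) = 0" if "i < d" "0 < i" for i
    using \<eta>(1) \<eta>(2)[OF that(1)] that by (simp add: G_def \<tau>_0 P_def)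
  have G_zero2: "G i (c (Suc i)) = 0" if "Suc i < d" for i
    using \<eta>(1) \<eta>(2)[of i] that by (simp add: G_def \<tau>_0 Q_def)
  have G_der: "\<exists>E. finite E \<and> (\<forall>x\<in>{c i<..<c (Suc i)} - E. (G i has_real_derivative s' i x) (at x))"
    if i: "i < d" for i
  proof -
    \<comment> \<open>Finite by injectivity: each exceptional point of \<open>g\<close> has at most
      one preimage in the cell. The two further points are the kinks of the tents.\<close>
    let ?E = "{x \<in> {c i..c (Suc i)}. F i x \<in> E} \<union> {c i + \<eta>, c (Suc i) - \<eta>}"
    have "finite ?E" using finite_inverse_image_gen[OF E(1), of "F i"]
      finite_vimage_IntI[OF E(1) F_inj[OF i]] by (auto simp: vimage_def Int_def conj_commute)
    moreover have "(G i has_real_derivative s' i x) (at x)" if x: "x \<in> {c i<..<c (Suc i)} - ?E" for x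
    proof -
      have xi: "x \<in> {c i<..<c (Suc i)}" using x by blast
      have "F i x \<in> {0<..<1} - E" using F_interior[OF i xi] x by auto
      then have "((\<lambda>x. g (F i x)) has_real_derivative s (F i x) * F' i x) (at x)"
        using DERIV_chain2[OF E(2) interior_deriv(1)[OF i xi]] by blast
      from DERIV_quotient[OF this interior_deriv(2)[OF i xi]] F'_nonzero[OF i, of x] xi
      have h': "(h i has_real_derivative (s (F i x) * F' i x * F' i x - F'' i x * g (F i x)) / (F' i x ^ Suc (Suc 0))) (at x)"
        unfolding h_def[abs_def] by (auto simp: mult.commute)
      have \<tau>1: "((\<lambda>x. \<tau> (x - c i)) has_real_derivative (if x - c i < \<eta> then - 1 / \<eta> else 0) * 1) (at x)"
        by (rule DERIV_chain2[OF \<tau>_der]) (use x in \<open>auto intro!: derivative_eq_intros\<close>)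
      have \<tau>2: "((\<lambda>x. \<tau> (c (Suc i) - x)) has_real_derivative (if c (Suc i) - x < \<eta> then - 1 / \<eta> else 0) * (-1)) (at x)"
        by (rule DERIV_chain2[OF \<tau>_der]) (use x in \<open>auto intro!: derivative_eq_intros\<close>)
      have "(G i has_real_derivative ((s (F i x) * F' i x * F' i x - F'' i x * g (F i x)) / (F' i x ^ Suc (Suc 0))
          - P i * ((if x - c i < \<eta> then - 1 / \<eta> else 0) * 1)) - Q i * ((if c (Suc i) - x < \<eta> then - 1 / \<eta> else 0) * (-1))) (at x)"
        unfolding G_def[abs_def] by (intro DERIV_diff DERIV_cmult h' \<tau>1 \<tau>2)
      moreover have "(s (F i x) * F' i x * F' i x - F'' i x * g (F i x)) / (F' i x ^ Suc (Suc 0)) = s (F i x) - r i x"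
        using F'_nonzero[OF i, of x] xi unfolding r_def
        by (simp add: diff_divide_distrib power2_eq_square mult.commute)
      ultimately show ?thesis using xi by (auto simp: s'_eq t_def add_diff_eq)
    qed
    ultimately show ?thesis by blast
  qed
  have s'_meas: "s' i \<in> borel_measurable borel" if "i < d" for i
  proof -
    have [measurable]: "(\<lambda>x. F i (cl i x)) \<in> borel_measurable borel" "(\<lambda>x. r i (cl i x)) \<in> borel_measurable borel"
      unfolding cl_def by (intro clamp_measurable that F_cont r_cont)+
    show ?thesis unfolding s'_def t_def by measurable
  qed
  have s'_le: "\<bar>s' i x\<bar> \<le> K + B * M + B * (2 / \<eta>)" if "i < d" "x \<in> {c i<..<c (Suc i)}" for i x
  proof -
    have x: "x \<in> {c i..c (Suc i)}" using that(2) by auto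
    show ?thesis using K[of "F i x"] r_le[OF that(1) x] t_le[OF that(1), of x] s'_eq[OF x] by linarith
  qed
  obtain H S where HS: "test_pair H S" "\<And>i x. i < d \<Longrightarrow> x \<in> {c i..c (Suc i)} \<Longrightarrow> H x = G i x"
    "\<And>i x. i < d \<Longrightarrow> x \<in> {c i<..<c (Suc i)} \<Longrightarrow> S x = s' i x"
    using test_pair_glue[OF c_ends c_less G_cont G_zero1 G_zero2 G_der s'_meas s'_le] by blast
  show thesis
  proof
    show "test_pair H S" by fact
    show "\<bar>s (T_meas x) - S x\<bar> \<le> B * (M + 2 / \<eta>)" if "i < d" "x \<in> {c i<..<c (Suc i)}" for i x
    proof -
      have x: "x \<in> {c i..c (Suc i)}" using that(2) by auto
      have "s (T_meas x) - S x = r i x - t i x"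
        unfolding T_meas_eq[OF that] HS(3)[OF that] s'_eq[OF x] by simp
      then show ?thesis using r_le[OF that(1) x] t_le[OF that(1), of x] by (simp add: distrib_left)
    qed
    show "\<bar>H x\<bar> \<le> \<bar>g (F i x)\<bar> / lam \<or>
       (\<exists>j\<in>{i, Suc i}. 0 < j \<and> j < d \<and> \<bar>x - c j\<bar> < \<eta> \<and>
          \<bar>H x\<bar> \<le> (\<bar>g (F i x)\<bar> + \<bar>g (F i (c j))\<bar>) / lam)"
      if i: "i < d" and x: "x \<in> {c i..c (Suc i)}" for i x
    proof -
      consider (l) "x - c i < \<eta>" "0 < i" | (r) "c (Suc i) - x < \<eta>" "Suc i < d"
        | (n) "\<eta> \<le> x - c i \<or> i = 0" "\<eta> \<le> c (Suc i) - x \<or> \<not> Suc i < d" by linarith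
      then show ?thesis
      proof cases
        case l
        have "\<tau> (c (Suc i) - x) = 0" using l(1) \<eta>(2)[OF i] by (intro \<tau>_0) auto
        then have "\<bar>H x\<bar> \<le> \<bar>h i x\<bar> + \<bar>P i * \<tau> (x - c i)\<bar>"
          unfolding HS(2)[OF i x] G_def by simp
        moreover have "\<bar>P i * \<tau> (x - c i)\<bar> \<le> \<bar>P i\<bar>"
          using \<tau>_01[of "x - c i"] x by (auto simp: abs_mult intro: mult_right_le_one_le)
        moreover have "\<bar>P i\<bar> \<le> \<bar>g (F i (c i))\<bar> / lam"
          using h_le[OF i ends(1)[OF i]] l(2) by (simp add: P_def)
        ultimately show ?thesis using l i x h_le[OF i x] by (auto simp: add_divide_distrib)
      next
        case r
        have "\<tau> (x - c i) = 0" using r(1) \<eta>(2)[OF i] by (intro \<tau>_0) auto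
        then have "\<bar>H x\<bar> \<le> \<bar>h i x\<bar> + \<bar>Q i * \<tau> (c (Suc i) - x)\<bar>"
          unfolding HS(2)[OF i x] G_def by simp
        moreover have "\<bar>Q i * \<tau> (c (Suc i) - x)\<bar> \<le> \<bar>Q i\<bar>"
          using \<tau>_01[of "c (Suc i) - x"] x by (auto simp: abs_mult intro: mult_right_le_one_le)
        moreover have "\<bar>Q i\<bar> \<le> \<bar>g (F i (c (Suc i)))\<bar> / lam"
          using h_le[OF i ends(2)[OF i]] r(2) by (simp add: Q_def)
        ultimately show ?thesis using r i x h_le[OF i x] by (auto simp: add_divide_distrib)
      next
        case n
        have "P i * \<tau> (x - c i) = 0" "Q i * \<tau> (c (Suc i) - x) = 0"
          using n \<tau>_0 by (auto simp: P_def Q_def)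
        then have "H x = h i x" unfolding HS(2)[OF i x] G_def by linarith
        then show ?thesis using h_le[OF i x] by simp
      qed
    qed
  qed
qed

section \<open>Critical points within reach of an orbit\<close>

abbreviation step :: "real \<Rightarrow> real \<Rightarrow> real \<Rightarrow> bool" where
  "step \<equiv> branch_step c d F"

text \<open>Its cardinality is the exponent of the doubling factor at x. Indices 0 and d are left
  out as there are no tents at 0 and 1; \<open>m < k\<close> because during k pull-backs tents act
  at times 0 to k - 1 of the orbit.\<close>

definition reach :: "real \<Rightarrow> nat \<Rightarrow> real \<Rightarrow> nat set" where
  "reach \<eta> k x = {j. 0 < j \<and> j < d \<and> (\<exists>m<k. \<exists>y. (step \<eta> ^^ m) x y \<and> \<bar>y - c j\<bar> < \<eta>)}"

lemma reach_subset: "reach \<eta> k x \<subseteq> {0<..<d}" by (auto simp: reach_def)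

lemma finite_reach [simp]: "finite (reach \<eta> k x)"
  by (rule finite_subset[OF reach_subset]) simp

lemma card_reach_le: "card (reach \<eta> k x) \<le> d"
  using card_mono[OF _ reach_subset, of \<eta> k x] by simp

lemma reach_mono: "k \<le> l \<Longrightarrow> reach \<eta> k x \<subseteq> reach \<eta> l x"
  unfolding reach_def by (auto dest: order_less_le_trans)

lemma reach_step: "step \<eta> x y \<Longrightarrow> reach \<eta> k y \<subseteq> reach \<eta> (Suc k) x"
proof
  fix j assume st: "step \<eta> x y" and "j \<in> reach \<eta> k y"
  then obtain m y' where m: "0 < j" "j < d" "m < k" "(step \<eta> ^^ m) y y'" "\<bar>y' - c j\<bar> < \<eta>"
    by (auto simp: reach_def)
  show "j \<in> reach \<eta> (Suc k) x"
    unfolding reach_def mem_Collect_eq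
    using m relpowp_Suc_I2[of "step \<eta>" x y m y', OF st m(4)]
    by (intro conjI exI[of _ "Suc m"] exI[of _ y']) (simp_all del: relpowp.simps)
qed

text \<open>Duality rewrites \<rho> times the pairing with s as the pairing of f with s o T;
  replacing s o T by \<open>S\<close> costs the uniform error times the L1 norm of f.\<close>

lemma weak_step:
  assumes f: "f \<in> BV" "perron_frobenius T c d f = (\<lambda>x. \<rho> * f x)" "(LINT x|lborel. \<bar>f x\<bar>) \<le> 1"
    and s: "test_pair g s" "test_pair H S"
    and B: "0 \<le> B" "\<And>i x. i < d \<Longrightarrow> x \<in> {c i<..<c (Suc i)} \<Longrightarrow> \<bar>s (T_meas x) - S x\<bar> \<le> B"
  shows "\<bar>\<rho> * (LINT x|lborel. f x * s x) - (LINT x|lborel. f x * S x)\<bar> \<le> B"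
proof -
  obtain K L where K: "\<And>x. \<bar>s x\<bar> \<le> K" and L: "\<And>x. \<bar>S x\<bar> \<le> L" using s by (auto simp: test_pair_def)
  have [measurable]: "s \<in> borel_measurable borel" "S \<in> borel_measurable borel"
    using s test_pair_measurable by auto
  have fi: "integrable lborel f" using BV_integrable[OF f(1)] .
  have kBV: "perron_frobenius T c d f \<in> BV"
    unfolding f(2) using BV_bounded_linear[OF bounded_linear_mult_right f(1) BV_regulated[OF f(1)]] .
  have "\<rho> * (LINT x|lborel. f x * s x) = (LINT x|lborel. perron_frobenius T c d f x * s x)"
    unfolding f(2) by (simp add: mult.assoc)
  also have "\<dots> = (LINT x|lborel. f x * s (T_meas x))"
    by (rule perron_frobenius_duality[OF f(1) kBV _ K]) measurable
  finally have "\<rho> * (LINT x|lborel. f x * s x) - (LINT x|lborel. f x * S x) =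
      (LINT x|lborel. f x * s (T_meas x) - f x * S x)"
    using integrable_times_bounded[OF fi, of "\<lambda>x. s (T_meas x)" K] integrable_times_bounded[OF fi, of S L] K L
    by simp
  also have "\<dots> = (LINT x|lborel. f x * (s (T_meas x) - S x))" by (simp add: right_diff_distrib)
  finally have eq: "\<rho> * (LINT x|lborel. f x * s x) - (LINT x|lborel. f x * S x) =
      (LINT x|lborel. f x * (s (T_meas x) - S x))" .
  have "\<bar>LINT x|lborel. f x * (s (T_meas x) - S x)\<bar> \<le> B * (LINT x|lborel. \<bar>f x\<bar>)"
  proof (rule abs_integral_times_le[OF fi])
    show "AE x in lborel. f x = 0 \<or> \<bar>s (T_meas x) - S x\<bar> \<le> B"
      using AE_interior by eventually_elim (use B(2) BV_eq_0[OF f(1)] in blast)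
  qed measurable
  also have "\<dots> \<le> B * 1" using f(3) B(1) by (rule mult_left_mono)
  finally show ?thesis unfolding eq by simp
qed

text \<open>When the tent at critical point j acts at x, the bound is a sum of two terms. Index j is
  in \<open>reach\<close> of x but, by \<open>nonrec\<close>, in \<open>reach\<close> of neither
  successor, so each term carries at most half of the weight and the sum is absorbed. Since \<rho>
  lies in [0,1], the errors of the steps merely add up.\<close>

lemma weak_iterate:
  assumes f: "f \<in> BV" "perron_frobenius T c d f = (\<lambda>x. \<rho> * f x)" "(LINT x|lborel. \<bar>f x\<bar>) \<le> 1"
    and \<rho>: "0 \<le> \<rho>" "\<rho> \<le> 1"
    and \<eta>: "0 < \<eta>" "\<And>i. i < d \<Longrightarrow> 2 * \<eta> \<le> c (Suc i) - c i"
    and nonrec: "\<And>j x y. 0 < j \<Longrightarrow> j < d \<Longrightarrow> \<bar>x - c j\<bar> < \<eta> \<Longrightarrow> step \<eta> x y \<Longrightarrow> j \<notin> reach \<eta> (N - 1) y"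
    and gs: "test_pair g s" "\<And>x. x \<in> {0..1} \<Longrightarrow> \<bar>g x\<bar> \<le> B"
    and k: "k \<le> N"
  shows "\<exists>H S. test_pair H S \<and> (\<forall>x\<in>{0..1}. \<bar>H x\<bar> \<le> B * (1 / lam)^k * 2^card (reach \<eta> k x)) \<and>
    \<bar>\<rho>^k * (LINT x|lborel. f x * s x) - (LINT x|lborel. f x * S x)\<bar> \<le> real k * (2^d * B * (M + 2 / \<eta>))"
  using k
proof (induction k)
  case 0
  then show ?case using gs by (intro exI[of _ g] exI[of _ s]) (auto simp: reach_def)
next
  case (Suc k)
  then obtain H S where HS: "test_pair H S" and H: "\<And>x. x\<in>{0..1} \<Longrightarrow> \<bar>H x\<bar> \<le> B * (1 / lam)^k * 2^card (reach \<eta> k x)"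
    and err: "\<bar>\<rho>^k * (LINT x|lborel. f x * s x) - (LINT x|lborel. f x * S x)\<bar> \<le> real k * (2^d * B * (M + 2 / \<eta>))"
    by auto
  have B0: "0 \<le> B" using gs(2)[of 0] by auto
  have M0: "0 \<le> M"
  proof -
    have "d \<noteq> 0" using c_ends by (intro notI) auto
    then show ?thesis using F''_le[of 0 "c 0"] c_less[of 0] by auto
  qed
  have C0: "0 \<le> M + 2 / \<eta>" using M0 \<eta>(1) by simp
  have lam_pow: "(1 / lam)^k \<le> 1" using lam_gt_1 by (intro power_le_one) auto
  \<comment> \<open>A bound free of x and k for all intermediate test functions: at most d
    doublings, while the expansion factors are at most 1. It makes the error of every step the
    same.\<close>
  have H': "\<bar>H x\<bar> \<le> 2^d * B" if "x \<in> {0..1}" for x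
  proof -
    have "B * (1 / lam)^k * 2^card (reach \<eta> k x) \<le> (B * 1) * 2^d"
      using B0 lam_pow card_reach_le[of \<eta> k x] lam_gt_1
      by (intro mult_mono mult_left_mono power_increasing) auto
    then show ?thesis using H[OF that] by (simp add: mult.commute)
  qed
  obtain H2 S2 where HS2: "test_pair H2 S2"
    and H2: "\<And>i x. i < d \<Longrightarrow> x \<in> {c i..c (Suc i)} \<Longrightarrow> \<bar>H2 x\<bar> \<le> \<bar>H (F i x)\<bar> / lam \<or>
       (\<exists>j\<in>{i, Suc i}. 0 < j \<and> j < d \<and> \<bar>x - c j\<bar> < \<eta> \<and>
          \<bar>H2 x\<bar> \<le> (\<bar>H (F i x)\<bar> + \<bar>H (F i (c j))\<bar>) / lam)"
    and S2: "\<And>i x. i < d \<Longrightarrow> x \<in> {c i<..<c (Suc i)} \<Longrightarrow> \<bar>S (T_meas x) - S2 x\<bar> \<le> 2^d * B * (M + 2 / \<eta>)"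
    using test_pair_pullback[OF HS H' \<eta>] by blast
  have bound: "\<bar>H2 x\<bar> \<le> B * (1 / lam)^Suc k * 2^card (reach \<eta> (Suc k) x)" if x01: "x \<in> {0..1}" for x
  proof -
    obtain i where i: "i < d" "x \<in> {c i..c (Suc i)}" using cell_exists[OF x01] by blast
    have st: "step \<eta> x (F i x)" unfolding branch_step_def using i \<eta>(1) by (intro exI[of _ i] conjI bexI[of _ x]) auto
    from H2[OF i] show ?thesis
    proof
      assume *: "\<bar>H2 x\<bar> \<le> \<bar>H (F i x)\<bar> / lam"
      have "card (reach \<eta> k (F i x)) \<le> card (reach \<eta> (Suc k) x)"
        by (rule card_mono[OF finite_reach reach_step[OF st]])
      then have "B * (1 / lam)^k * 2^card (reach \<eta> k (F i x)) \<le> B * (1 / lam)^k * 2^card (reach \<eta> (Suc k) x)"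
        using B0 lam_gt_1 by (intro mult_left_mono power_increasing) auto
      then have "\<bar>H (F i x)\<bar> \<le> B * (1 / lam)^k * 2^card (reach \<eta> (Suc k) x)"
        using H[OF F_range[OF i]] by linarith
      then have "\<bar>H (F i x)\<bar> / lam \<le> B * (1 / lam)^k * 2^card (reach \<eta> (Suc k) x) / lam"
        using lam_gt_1 by (intro divide_right_mono) auto
      then show ?thesis using * by simp
    next
      assume "\<exists>j\<in>{i, Suc i}. 0 < j \<and> j < d \<and> \<bar>x - c j\<bar> < \<eta> \<and>
          \<bar>H2 x\<bar> \<le> (\<bar>H (F i x)\<bar> + \<bar>H (F i (c j))\<bar>) / lam"
      then obtain j where j: "j \<in> {i, Suc i}" "0 < j" "j < d" "\<bar>x - c j\<bar> < \<eta>"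
        "\<bar>H2 x\<bar> \<le> (\<bar>H (F i x)\<bar> + \<bar>H (F i (c j))\<bar>) / lam" by blast
      have cj: "c j \<in> {c i..c (Suc i)}" using j(1) c_less[OF i(1)] by auto
      have st': "step \<eta> x (F i (c j))"       unfolding branch_step_def using i cj j(4) by (intro exI[of _ i] conjI bexI[of _ "c j"]) (auto simp: abs_minus_commute)
      \<comment> \<open>Losing j from \<open>reach\<close> gains the factor 2 that pays for the
        second term.\<close>
      have H_le: "\<bar>H y\<bar> \<le> B * (1 / lam)^k * 2^card (reach \<eta> (Suc k) x) / 2"
        if y: "step \<eta> x y" "y \<in> {0..1}" for y
      proof -
        have "j \<notin> reach \<eta> k y"
        proof -
          have "k \<le> N - 1" using Suc.prems by simp
          then show ?thesis using nonrec[OF j(2,3,4) y(1)] reach_mono by blast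
        qed
        moreover have "j \<in> reach \<eta> (Suc k) x"
          unfolding reach_def mem_Collect_eq using j(2,3,4)
          by (intro conjI exI[of _ "0::nat"] exI[of _ x]) auto
        ultimately have "card (reach \<eta> k y) < card (reach \<eta> (Suc k) x)"
          using reach_step[OF y(1), of k] by (intro psubset_card_mono) auto
        then have "(2::real)^Suc (card (reach \<eta> k y)) \<le> 2^card (reach \<eta> (Suc k) x)"
          by (intro power_increasing) auto
        then have "(2::real)^card (reach \<eta> k y) \<le> 2^card (reach \<eta> (Suc k) x) / 2" by simp
        then have "B * (1 / lam)^k * 2^card (reach \<eta> k y) \<le> B * (1 / lam)^k * (2^card (reach \<eta> (Suc k) x) / 2)"
          using B0 lam_gt_1 by (intro mult_left_mono) auto
        then show ?thesis using H[OF y(2)] by simp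
      qed
      have "\<bar>H (F i x)\<bar> + \<bar>H (F i (c j))\<bar> \<le> B * (1 / lam)^k * 2^card (reach \<eta> (Suc k) x)"
        using H_le[OF st F_range[OF i]] H_le[OF st' F_range[OF i(1) cj]] by linarith
      then have "(\<bar>H (F i x)\<bar> + \<bar>H (F i (c j))\<bar>) / lam \<le> B * (1 / lam)^k * 2^card (reach \<eta> (Suc k) x) / lam"
        using lam_gt_1 by (intro divide_right_mono) auto
      then show ?thesis using j(5) by simp
    qed
  qed
  let ?I = "LINT x|lborel. f x * s x" and ?J = "LINT x|lborel. f x * S x" and ?L = "LINT x|lborel. f x * S2 x"
  let ?e = "2^d * B * (M + 2 / \<eta>)"
  have "0 \<le> ?e" using B0 C0 by simp
  have "\<bar>\<rho> * ?J - ?L\<bar> \<le> ?e"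
    by (rule weak_step[OF f HS HS2 \<open>0 \<le> ?e\<close>]) (rule S2)
  moreover have "\<bar>\<rho> * (\<rho>^k * ?I - ?J)\<bar> \<le> real k * ?e"
  proof -
    have "\<bar>\<rho> * (\<rho>^k * ?I - ?J)\<bar> \<le> 1 * \<bar>\<rho>^k * ?I - ?J\<bar>"
      unfolding abs_mult using \<rho> by (intro mult_right_mono) auto
    then show ?thesis using err by simp
  qed
  moreover have "\<rho>^Suc k * ?I - ?L = \<rho> * (\<rho>^k * ?I - ?J) + (\<rho> * ?J - ?L)" by (simp add: algebra_simps)
  ultimately have "\<bar>\<rho>^Suc k * ?I - ?L\<bar> \<le> real (Suc k) * ?e" by (simp add: distrib_right)
  then show ?case using HS2 bound by blast
qed

text \<open>After N pull-backs the test function has size at most \<open>B * 2^K / lam^N\<close>, so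
  any bound V for the weak variation can be applied to it; division by \<open>\<rho>^N\<close> then
  gives an affine improvement of V.\<close>

lemma weak_variation_contraction:
  assumes f: "f \<in> BV" "perron_frobenius T c d f = (\<lambda>x. \<rho> * f x)" "(LINT x|lborel. \<bar>f x\<bar>) \<le> 1"
    and \<rho>: "0 < \<rho>" "\<rho> \<le> 1"
    and \<eta>: "0 < \<eta>" "\<And>i. i < d \<Longrightarrow> 2 * \<eta> \<le> c (Suc i) - c i"
    and nonrec: "\<And>j x y. 0 < j \<Longrightarrow> j < d \<Longrightarrow> \<bar>x - c j\<bar> < \<eta> \<Longrightarrow> step \<eta> x y \<Longrightarrow> j \<notin> reach \<eta> (N - 1) y"
    and K: "\<And>x. card (reach \<eta> N x) \<le> K"
    and V: "weak_variation_le f V"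
  shows "weak_variation_le f ((2^K / lam^N) / \<rho>^N * V + real N * (2^d * (M + 2 / \<eta>)) / \<rho>^N)"
  unfolding weak_variation_le_def
proof (intro allI impI)
  fix g s B assume gs: "test_pair g s" "\<forall>x\<in>{0..1}. \<bar>g x\<bar> \<le> B"
  have B0: "0 \<le> B" using gs(2) by force
  obtain H S where HS: "test_pair H S" and
    H: "\<And>x. x\<in>{0..1} \<Longrightarrow> \<bar>H x\<bar> \<le> B * (1 / lam)^N * 2^card (reach \<eta> N x)" and
    err: "\<bar>\<rho>^N * (LINT x|lborel. f x * s x) - (LINT x|lborel. f x * S x)\<bar> \<le> real N * (2^d * B * (M + 2 / \<eta>))"
  proof -
    have "\<exists>H S. test_pair H S \<and> (\<forall>x\<in>{0..1}. \<bar>H x\<bar> \<le> B * (1 / lam)^N * 2^card (reach \<eta> N x)) \<and>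
      \<bar>\<rho>^N * (LINT x|lborel. f x * s x) - (LINT x|lborel. f x * S x)\<bar> \<le> real N * (2^d * B * (M + 2 / \<eta>))"
    proof (rule weak_iterate[OF f _ \<rho>(2) \<eta> _ gs(1) _ order_refl])
      show "j \<notin> reach \<eta> (N - 1) y" if "0 < j" "j < d" "\<bar>x - c j\<bar> < \<eta>" "step \<eta> x y" for j x y
        using nonrec[OF that] .
    qed (use gs(2) \<rho>(1) in auto)
    then show thesis using that by blast
  qed
  have "\<bar>H x\<bar> \<le> B * (1 / lam)^N * 2^K" if "x \<in> {0..1}" for x
  proof -
    have "B * (1 / lam)^N * 2^card (reach \<eta> N x) \<le> B * (1 / lam)^N * 2^K"
      using B0 lam_gt_1 K[of x] by (intro mult_left_mono power_increasing) auto
    then show ?thesis using H[OF that] by linarith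
  qed
  then have "\<bar>LINT x|lborel. f x * S x\<bar> \<le> V * (B * (1 / lam)^N * 2^K)"
    using V HS unfolding weak_variation_le_def by blast
  then have "\<bar>\<rho>^N * (LINT x|lborel. f x * s x)\<bar> \<le> V * (B * (1 / lam)^N * 2^K) + real N * (2^d * B * (M + 2 / \<eta>))"
    using err by linarith
  then have "\<rho>^N * \<bar>LINT x|lborel. f x * s x\<bar> \<le> V * (B * (1 / lam)^N * 2^K) + real N * (2^d * B * (M + 2 / \<eta>))"
    using \<rho>(1) by (simp add: abs_mult)
  then have "\<bar>LINT x|lborel. f x * s x\<bar> \<le> (V * (B * (1 / lam)^N * 2^K) + real N * (2^d * B * (M + 2 / \<eta>))) / \<rho>^N"
    using \<rho>(1) by (simp add: pos_le_divide_eq mult.commute)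
  also have "\<dots> = ((2^K / lam^N) / \<rho>^N * V + real N * (2^d * (M + 2 / \<eta>)) / \<rho>^N) * B"
    by (simp add: distrib_left distrib_right power_one_over divide_inverse power_inverse mult_ac)
  finally show "\<bar>LINT x|lborel. f x * s x\<bar> \<le> ((2^K / lam^N) / \<rho>^N * V + real N * (2^d * (M + 2 / \<eta>)) / \<rho>^N) * B" .
qed

end

text \<open>Iterating the affine map from any V leads to its fixed point \<open>C / (1 - q)\<close>,
  in which the initial bound is forgotten. The limit is taken in the inequality of each single test
  pair.\<close>

lemma weak_variation_fixed_bound:
  assumes "weak_variation_le f V" and step: "\<And>V. weak_variation_le f V \<Longrightarrow> weak_variation_le f (q * V + C)"
    and q: "0 \<le> q" "q < 1"
  shows "weak_variation_le f (C / (1 - q))"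
  unfolding weak_variation_le_def
proof (intro allI impI)
  fix g s B assume gs: "test_pair g s" "\<forall>x\<in>{0..1}. \<bar>g x\<bar> \<le> B"
  let ?L = "C / (1 - q)"
  have "weak_variation_le f (?L + q^n * (V - ?L))" for n
  proof (induction n)
    case (Suc n)
    have L: "q * ?L + C = ?L" using q by (simp add: field_simps)
    have "q * (?L + q^n * (V - ?L)) + C = (q * ?L + C) + q^Suc n * (V - ?L)"
      by (simp add: distrib_left)
    then have "q * (?L + q^n * (V - ?L)) + C = ?L + q^Suc n * (V - ?L)" unfolding L .
    then show ?case using step[OF Suc] by (simp only:)
  qed (use assms(1) in simp)
  then have le: "\<bar>LINT x|lborel. f x * s x\<bar> \<le> (?L + q^n * (V - ?L)) * B" for n
    using gs unfolding weak_variation_le_def by blast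
  have lim: "(\<lambda>n. (?L + q^n * (V - ?L)) * B) \<longlonglongrightarrow> (?L + 0 * (V - ?L)) * B"
    by (intro tendsto_intros LIMSEQ_power_zero) (use q in simp)
  have "\<bar>LINT x|lborel. f x * s x\<bar> \<le> (?L + 0 * (V - ?L)) * B"
    by (rule LIMSEQ_le_const[OF lim]) (use le in blast)
  then show "\<bar>LINT x|lborel. f x * s x\<bar> \<le> ?L * B" by simp
qed

section \<open>Uniformity over the perturbations\<close>

lemma branch_step_mono: "\<eta> \<le> \<eta>' \<Longrightarrow> branch_step c d F \<eta> x y \<Longrightarrow> branch_step c d F \<eta>' x y"
  unfolding branch_step_def by (meson order_less_le_trans)

lemma branch_step_power_mono:
  assumes "\<eta> \<le> \<eta>'"
  shows "(branch_step c d F \<eta> ^^ n) x y \<Longrightarrow> (branch_step c d F \<eta>' ^^ n) x y"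
proof (induction n arbitrary: y)
  case (Suc n)
  from Suc.prems obtain w where "(branch_step c d F \<eta> ^^ n) x w" "branch_step c d F \<eta> w y"
    by (rule relpowp_Suc_E)
  then show ?case using Suc.IH branch_step_mono[OF assms] by (blast intro: relpowp_Suc_I)
qed simp

lemma weak_variation_le_mono:
  assumes "weak_variation_le f V" "V \<le> W"
  shows "weak_variation_le f W"
  unfolding weak_variation_le_def
proof (intro allI impI)
  fix g s B assume gs: "test_pair g s" "\<forall>x\<in>{0..1}. \<bar>g x\<bar> \<le> B"
  have "\<bar>g 0\<bar> \<le> B" using gs(2) by auto
  then have "V * B \<le> W * B" using assms(2) by (intro mult_right_mono) auto
  then show "\<bar>LINT x|lborel. f x * s x\<bar> \<le> W * B"
    using assms(1) gs unfolding weak_variation_le_def by (blast intro: order_trans)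
qed

text \<open>The hypotheses on the family in unpacked form, with \<epsilon> = 0 included. All
  branches of index i live on one interval independent of \<epsilon>, where they can be compared
  although the critical points move.\<close>

locale branch_family =
  fixes T :: "real \<Rightarrow> real \<Rightarrow> real" and c :: "real \<Rightarrow> nat \<Rightarrow> real" and d :: nat
    and \<delta> \<epsilon>\<^sub>0 :: real and F F' F'' :: "nat \<Rightarrow> real \<Rightarrow> real \<Rightarrow> real"
  assumes pieces: "\<And>\<epsilon>. 0 \<le> \<epsilon> \<Longrightarrow> piecewise_C2 (T \<epsilon>) (c \<epsilon>) d"
    and \<delta>_pos: "0 < \<delta>" and \<epsilon>\<^sub>0_pos: "0 < \<epsilon>\<^sub>0"
    and c_lim: "\<And>i. i \<le> d \<Longrightarrow> ((\<lambda>\<epsilon>. c \<epsilon> i) \<longlongrightarrow> c 0 i) (at_right 0)"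
    and cell_sub: "\<And>i \<epsilon>. i < d \<Longrightarrow> 0 \<le> \<epsilon> \<Longrightarrow> \<epsilon> < \<epsilon>\<^sub>0 \<Longrightarrow>
      {c \<epsilon> i..c \<epsilon> (Suc i)} \<subseteq> {c 0 i - \<delta>..c 0 (Suc i) + \<delta>}"
    and C2: "\<And>i \<epsilon>. i < d \<Longrightarrow> 0 \<le> \<epsilon> \<Longrightarrow> \<epsilon> < \<epsilon>\<^sub>0 \<Longrightarrow>
      C2_with_derivs {c 0 i - \<delta>..c 0 (Suc i) + \<delta>} (F i \<epsilon>) (F' i \<epsilon>) (F'' i \<epsilon>)"
    and F_restr: "\<And>i \<epsilon> x. i < d \<Longrightarrow> 0 \<le> \<epsilon> \<Longrightarrow> \<epsilon> < \<epsilon>\<^sub>0 \<Longrightarrow> x \<in> {c \<epsilon> i..c \<epsilon> (Suc i)} \<Longrightarrow>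
      F i \<epsilon> x = restr (T \<epsilon>) (c \<epsilon> i) (c \<epsilon> (Suc i)) x"
    and F_unif: "\<And>i. i < d \<Longrightarrow> uniform_limit {c 0 i - \<delta>..c 0 (Suc i) + \<delta>} (F i) (F i 0) (at_right 0)"
    and F'_unif: "\<And>i. i < d \<Longrightarrow> uniform_limit {c 0 i - \<delta>..c 0 (Suc i) + \<delta>} (F' i) (F' i 0) (at_right 0)"
    and F''_unif: "\<And>i. i < d \<Longrightarrow> uniform_limit {c 0 i - \<delta>..c 0 (Suc i) + \<delta>} (F'' i) (F'' i 0) (at_right 0)"
begin

abbreviation X :: "nat \<Rightarrow> real set" where "X i \<equiv> {c 0 i - \<delta>..c 0 (Suc i) + \<delta>}"

abbreviation branches :: "real \<Rightarrow> real \<Rightarrow> real \<Rightarrow> bool" where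
  "branches \<epsilon> \<equiv> expanding_branches (T \<epsilon>) (c \<epsilon>) d (\<lambda>i. F i \<epsilon>) (\<lambda>i. F' i \<epsilon>) (\<lambda>i. F'' i \<epsilon>)"

section \<open>Constants uniform in small \<epsilon>\<close>

lemma c_ends: "0 \<le> \<epsilon> \<Longrightarrow> c \<epsilon> 0 = 0" "0 \<le> \<epsilon> \<Longrightarrow> c \<epsilon> d = 1"
  and c_less: "0 \<le> \<epsilon> \<Longrightarrow> i < d \<Longrightarrow> c \<epsilon> i < c \<epsilon> (Suc i)"
  and T_range: "0 \<le> \<epsilon> \<Longrightarrow> x \<in> {0..1} \<Longrightarrow> T \<epsilon> x \<in> {0..1}"
  using pieces[of \<epsilon>] by (auto simp: piecewise_C2_def)

lemma cell_subset: "0 \<le> \<epsilon> \<Longrightarrow> i < d \<Longrightarrow> {c \<epsilon> i..c \<epsilon> (Suc i)} \<subseteq> {0..1}"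
  using partition_mono[of d "c \<epsilon>" 0 i, OF c_less] partition_mono[of d "c \<epsilon>" "Suc i" d, OF c_less] c_ends[of \<epsilon>]
  by auto

lemma F_cont: "i < d \<Longrightarrow> 0 \<le> \<epsilon> \<Longrightarrow> \<epsilon> < \<epsilon>\<^sub>0 \<Longrightarrow> continuous_on (X i) (F i \<epsilon>)"
  and F'_cont: "i < d \<Longrightarrow> 0 \<le> \<epsilon> \<Longrightarrow> \<epsilon> < \<epsilon>\<^sub>0 \<Longrightarrow> continuous_on (X i) (F' i \<epsilon>)"
  and F''_cont: "i < d \<Longrightarrow> 0 \<le> \<epsilon> \<Longrightarrow> \<epsilon> < \<epsilon>\<^sub>0 \<Longrightarrow> continuous_on (X i) (F'' i \<epsilon>)"
  using C2[of i \<epsilon>] by (auto simp: C2_with_derivs_def intro!: DERIV_continuous_on)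

lemma F_eq_T: "i < d \<Longrightarrow> 0 \<le> \<epsilon> \<Longrightarrow> \<epsilon> < \<epsilon>\<^sub>0 \<Longrightarrow> x \<in> {c \<epsilon> i<..<c \<epsilon> (Suc i)} \<Longrightarrow> F i \<epsilon> x = T \<epsilon> x"
  using F_restr[of i \<epsilon> x] by (auto simp: restr_def)

text \<open>What is known about \<open>T\<close> concerns the branches inside open cells; continuity
  carries closed conditions to the ends.\<close>

lemma closed_cell_in_closed:
  assumes "i < d" "0 \<le> \<epsilon>" "\<epsilon> < \<epsilon>\<^sub>0" "continuous_on (X i) h" "closed A"
    and "\<And>x. x \<in> {c \<epsilon> i<..<c \<epsilon> (Suc i)} \<Longrightarrow> h x \<in> A" and x: "x \<in> {c \<epsilon> i..c \<epsilon> (Suc i)}"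
  shows "h x \<in> A"
proof -
  have cl: "closure {c \<epsilon> i<..<c \<epsilon> (Suc i)} = {c \<epsilon> i..c \<epsilon> (Suc i)}"
    using c_less[OF assms(2,1)] by (rule closure_greaterThanLessThan)
  have "continuous_on {c \<epsilon> i..c \<epsilon> (Suc i)} h"
    by (rule continuous_on_subset[OF assms(4) cell_sub[OF assms(1-3)]])
  then have "h ` closure {c \<epsilon> i<..<c \<epsilon> (Suc i)} \<subseteq> A"
    unfolding cl[symmetric] using assms(5,6) by (intro image_closure_subset) auto
  then show ?thesis using x cl by blast
qed

lemma F_range:
  assumes "i < d" "0 \<le> \<epsilon>" "\<epsilon> < \<epsilon>\<^sub>0" "x \<in> {c \<epsilon> i..c \<epsilon> (Suc i)}"
  shows "F i \<epsilon> x \<in> {0..1}"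
proof (rule closed_cell_in_closed[OF assms(1-3) F_cont[OF assms(1-3)] _ _ assms(4)])
  fix x assume x: "x \<in> {c \<epsilon> i<..<c \<epsilon> (Suc i)}"
  then have "x \<in> {0..1}" using cell_subset[of \<epsilon> i] assms by auto
  then show "F i \<epsilon> x \<in> {0..1}" using F_eq_T[OF assms(1-3) x] T_range[OF assms(2)] by simp
qed simp

lemma F'_0_ge:
  assumes i: "i < d" and x: "x \<in> {c 0 i..c 0 (Suc i)}"
  shows "min_expansion (T 0) (c 0 ` {..d}) \<le> \<bar>F' i 0 x\<bar>"
proof -
  let ?m = "min_expansion (T 0) (c 0 ` {..d})"
  have "\<bar>F' i 0 x\<bar> \<in> {?m..}"
  proof (rule closed_cell_in_closed[of i 0 "\<lambda>x. \<bar>F' i 0 x\<bar>" "{?m..}"])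
    fix x assume x: "x \<in> {c 0 i<..<c 0 (Suc i)}"
    have "x \<in> X i" using x \<delta>_pos by auto
    then have "(F i 0 has_real_derivative F' i 0 x) (at x within X i)"
      using C2[OF i order_refl \<epsilon>\<^sub>0_pos] by (auto simp: C2_with_derivs_def)
    moreover have "x \<in> interior (X i)" using x \<delta>_pos by auto
    ultimately have "(F i 0 has_real_derivative F' i 0 x) (at x)"
      using at_within_interior[of x "X i"] by simp
    moreover have "\<forall>\<^sub>F y in nhds x. F i 0 y = T 0 y"
      using eventually_nhds_in_open[OF open_greaterThanLessThan x]
      by (rule eventually_mono) (use F_eq_T[OF i order_refl \<epsilon>\<^sub>0_pos] in auto)
    ultimately have "(T 0 has_real_derivative F' i 0 x) (at x)" by (simp add: DERIV_cong_ev)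
    then have D: "deriv (T 0) x = F' i 0 x" by (rule DERIV_imp_deriv)
    have "x \<noteq> c 0 j" if "j \<le> d" for j
    proof (cases "j \<le> i")
      case True
      then have "c 0 j \<le> c 0 i" using partition_mono[of d "c 0" j i, OF c_less] i by auto
      then show ?thesis using x by auto
    next
      case False
      then have "c 0 (Suc i) \<le> c 0 j" using partition_mono[of d "c 0" "Suc i" j, OF c_less] that by auto
      then show ?thesis using x by auto
    qed
    then have "x \<in> {0..1} - c 0 ` {..d}" using cell_subset[of 0 i] i x by auto
    then have "?m \<le> \<bar>deriv (T 0) x\<bar>"
      unfolding min_expansion_def by (intro cINF_lower) (auto intro!: bdd_belowI[of _ 0])
    then show "\<bar>F' i 0 x\<bar> \<in> {?m..}" using D by simp
  qed (use i x \<epsilon>\<^sub>0_pos in \<open>auto intro!: continuous_intros F'_cont\<close>)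
  then show ?thesis by simp
qed

lemma eventually_small: "\<forall>\<^sub>F \<epsilon> in at_right 0. 0 \<le> \<epsilon> \<and> \<epsilon> < \<epsilon>\<^sub>0"
  using eventually_at_right_real[OF \<epsilon>\<^sub>0_pos] by eventually_elim auto

lemma eventually_c_close:
  assumes "0 < e"
  shows "\<forall>\<^sub>F \<epsilon> in at_right 0. \<forall>i\<le>d. \<bar>c \<epsilon> i - c 0 i\<bar> < e"
proof -
  have "\<forall>\<^sub>F \<epsilon> in at_right 0. \<forall>i\<in>{..d}. \<bar>c \<epsilon> i - c 0 i\<bar> < e"
    by (intro eventually_ball_finite) (use tendstoD[OF c_lim assms] in \<open>auto simp: dist_real_def\<close>)
  then show ?thesis by (auto elim: eventually_mono)
qed

lemma eventually_unif:
  fixes G :: "nat \<Rightarrow> real \<Rightarrow> real \<Rightarrow> real"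
  assumes "\<And>i. i < d \<Longrightarrow> uniform_limit (X i) (G i) (G i 0) (at_right 0)" "0 < e"
  shows "\<forall>\<^sub>F \<epsilon> in at_right 0. \<forall>i<d. \<forall>x\<in>X i. \<bar>G i \<epsilon> x - G i 0 x\<bar> < e"
proof -
  have "\<forall>\<^sub>F \<epsilon> in at_right 0. \<forall>i\<in>{..<d}. \<forall>x\<in>X i. \<bar>G i \<epsilon> x - G i 0 x\<bar> < e"
    by (intro eventually_ball_finite)
       (use uniform_limitD[OF assms(1) assms(2)] in \<open>auto simp: dist_real_def\<close>)[2]
  then show ?thesis by (auto elim: eventually_mono)
qed

lemma eventually_F_close: "0 < e \<Longrightarrow> \<forall>\<^sub>F \<epsilon> in at_right 0. \<forall>i<d. \<forall>x\<in>X i. \<bar>F i \<epsilon> x - F i 0 x\<bar> < e"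
  and eventually_F'_close: "0 < e \<Longrightarrow> \<forall>\<^sub>F \<epsilon> in at_right 0. \<forall>i<d. \<forall>x\<in>X i. \<bar>F' i \<epsilon> x - F' i 0 x\<bar> < e"
  and eventually_F''_close: "0 < e \<Longrightarrow> \<forall>\<^sub>F \<epsilon> in at_right 0. \<forall>i<d. \<forall>x\<in>X i. \<bar>F'' i \<epsilon> x - F'' i 0 x\<bar> < e"
  using F_unif F'_unif F''_unif by (intro eventually_unif; blast)+

lemma F''_0_bounded: "\<exists>M. \<forall>i<d. \<forall>x\<in>X i. \<bar>F'' i 0 x\<bar> \<le> M"
proof -
  have "\<exists>M. \<forall>x\<in>X i. \<bar>F'' i 0 x\<bar> \<le> M" if "i < d" for i
  proof -
    have "bounded (F'' i 0 ` X i)"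
      by (intro compact_imp_bounded compact_continuous_image F''_cont that \<epsilon>\<^sub>0_pos) auto
    then show ?thesis by (auto simp: bounded_iff)
  qed
  then obtain m where m: "\<And>i x. i < d \<Longrightarrow> x \<in> X i \<Longrightarrow> \<bar>F'' i 0 x\<bar> \<le> m i" by metis
  have "\<bar>F'' i 0 x\<bar> \<le> (\<Sum>j<d. \<bar>m j\<bar>)" if "i < d" "x \<in> X i" for i x
  proof -
    have "\<bar>m i\<bar> \<le> (\<Sum>j<d. \<bar>m j\<bar>)" using that by (intro member_le_sum) auto
    then show ?thesis using m[OF that] by linarith
  qed
  then show ?thesis by blast
qed

lemma expanding_branchesI:
  assumes \<epsilon>: "0 \<le> \<epsilon>" "\<epsilon> < \<epsilon>\<^sub>0" and lam: "1 < lam"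
    and "\<And>i x. i < d \<Longrightarrow> x \<in> {c \<epsilon> i..c \<epsilon> (Suc i)} \<Longrightarrow> lam \<le> \<bar>F' i \<epsilon> x\<bar>"
    and "\<And>i x. i < d \<Longrightarrow> x \<in> {c \<epsilon> i..c \<epsilon> (Suc i)} \<Longrightarrow> \<bar>F'' i \<epsilon> x\<bar> \<le> M"
  shows "branches \<epsilon> lam M"
proof
  fix i x assume ix: "i < d" "x \<in> {c \<epsilon> i..c \<epsilon> (Suc i)}"
  have "x \<in> X i" using cell_sub[OF ix(1) \<epsilon>] ix(2) by blast
  then have "(F i \<epsilon> has_real_derivative F' i \<epsilon> x) (at x within X i)"
    "(F' i \<epsilon> has_real_derivative F'' i \<epsilon> x) (at x within X i)"
    using C2[OF ix(1) \<epsilon>] by (auto simp: C2_with_derivs_def)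
  then show "(F i \<epsilon> has_real_derivative F' i \<epsilon> x) (at x within {c \<epsilon> i..c \<epsilon> (Suc i)})"
    "(F' i \<epsilon> has_real_derivative F'' i \<epsilon> x) (at x within {c \<epsilon> i..c \<epsilon> (Suc i)})"
    using DERIV_subset cell_sub[OF ix(1) \<epsilon>] by blast+
next
  fix i assume i: "i < d"
  show "continuous_on {c \<epsilon> i..c \<epsilon> (Suc i)} (F'' i \<epsilon>)"
    by (rule continuous_on_subset[OF F''_cont[OF i \<epsilon>] cell_sub[OF i \<epsilon>]])
next
  show "c \<epsilon> 0 = 0" "c \<epsilon> d = 1" using c_ends[OF \<epsilon>(1)] .
  show "1 < lam" using lam .
next
  fix i assume "i < d" then show "c \<epsilon> i < c \<epsilon> (Suc i)" using c_less[OF \<epsilon>(1)] by blast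
next
  fix i x assume ix: "i < d" "x \<in> {c \<epsilon> i..c \<epsilon> (Suc i)}"
  show "lam \<le> \<bar>F' i \<epsilon> x\<bar>" "\<bar>F'' i \<epsilon> x\<bar> \<le> M" using assms(4,5)[OF ix] .
  show "F i \<epsilon> x = restr (T \<epsilon>) (c \<epsilon> i) (c \<epsilon> (Suc i)) x" using F_restr[OF ix(1) \<epsilon> ix(2)] .
  show "F i \<epsilon> x \<in> {0..1}" using F_range[OF ix(1) \<epsilon> ix(2)] .
qed

text \<open>The lower bound on the derivative is known on unperturbed cells. A point of a perturbed
  cell is close to its nearest point \<open>y\<close> there; half of the spare expansion pays for
  uniform continuity of \<open>F' i 0\<close>, the other half for the convergence of
  \<open>F' i\<close>.\<close>

lemma eventually_expanding:
  assumes lam: "1 < lam" "lam < min_expansion (T 0) (c 0 ` {..d})"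
  shows "\<exists>M. branches 0 lam M \<and>
    (\<forall>\<^sub>F \<epsilon> in at_right 0. branches \<epsilon> lam M)"
proof -
  obtain M where M: "\<And>i x. i < d \<Longrightarrow> x \<in> X i \<Longrightarrow> \<bar>F'' i 0 x\<bar> \<le> M" using F''_0_bounded by blast
  define \<kappa> where "\<kappa> = (min_expansion (T 0) (c 0 ` {..d}) - lam) / 2"
  have \<kappa>: "0 < \<kappa>" "lam + 2 * \<kappa> = min_expansion (T 0) (c 0 ` {..d})" using lam by (auto simp: \<kappa>_def field_simps)
  have "\<exists>\<gamma>>0. \<forall>x\<in>X i. \<forall>y\<in>X i. \<bar>x - y\<bar> < \<gamma> \<longrightarrow> \<bar>F' i 0 x - F' i 0 y\<bar> < \<kappa>" if "i < d" for i
  proof -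
    have "uniformly_continuous_on (X i) (F' i 0)"
      by (intro compact_uniformly_continuous F'_cont that \<epsilon>\<^sub>0_pos) auto
    then show ?thesis using \<kappa>(1) unfolding uniformly_continuous_on_def dist_real_def
      by (metis abs_minus_commute)
  qed
  then obtain \<gamma> where \<gamma>: "\<And>i. i < d \<Longrightarrow> 0 < \<gamma> i"
    "\<And>i x y. i < d \<Longrightarrow> x \<in> X i \<Longrightarrow> y \<in> X i \<Longrightarrow> \<bar>x - y\<bar> < \<gamma> i \<Longrightarrow> \<bar>F' i 0 x - F' i 0 y\<bar> < \<kappa>" by metis
  have cell0: "{c 0 i..c 0 (Suc i)} \<subseteq> X i" for i using \<delta>_pos by auto
  have "\<forall>\<^sub>F \<epsilon> in at_right 0. \<forall>i\<in>{..<d}. \<bar>c \<epsilon> i - c 0 i\<bar> < \<gamma> i \<and> \<bar>c \<epsilon> (Suc i) - c 0 (Suc i)\<bar> < \<gamma> i"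
    by (intro eventually_ball_finite ballI eventually_conj)
       (use tendstoD[OF c_lim \<gamma>(1)] in \<open>auto simp: dist_real_def Suc_le_eq\<close>)
  then have ev: "\<forall>\<^sub>F \<epsilon> in at_right 0.
      branches \<epsilon> lam (M + 1)"
    using eventually_small eventually_F'_close[OF \<kappa>(1)] eventually_F''_close[OF zero_less_one]
  proof eventually_elim
    case (elim \<epsilon>)
    show ?case
    proof (rule expanding_branchesI)
      fix i x assume ix: "i < d" "x \<in> {c \<epsilon> i..c \<epsilon> (Suc i)}"
      have x: "x \<in> X i" using cell_sub ix elim(2) by blast
      then show "\<bar>F'' i \<epsilon> x\<bar> \<le> M + 1" using elim(4) M[OF ix(1) x] ix(1) by fastforce
      define y where "y = max (c 0 i) (min (c 0 (Suc i)) x)"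
      have y: "y \<in> {c 0 i..c 0 (Suc i)}" using c_less[of 0 i] ix(1) by (auto simp: y_def)
      have "\<bar>c \<epsilon> i - c 0 i\<bar> < \<gamma> i" "\<bar>c \<epsilon> (Suc i) - c 0 (Suc i)\<bar> < \<gamma> i" using elim(1) ix(1) by auto
      then have "\<bar>x - y\<bar> < \<gamma> i"
        using ix(2) \<gamma>(1)[OF ix(1)] c_less[of 0 i] ix(1) unfolding y_def min_def max_def by auto
      then have "\<bar>F' i 0 x - F' i 0 y\<bar> < \<kappa>" using \<gamma>(2)[OF ix(1) x] y cell0 by blast
      moreover have "\<bar>F' i \<epsilon> x - F' i 0 x\<bar> < \<kappa>" using elim(3) ix(1) x by blast
      ultimately show "lam \<le> \<bar>F' i \<epsilon> x\<bar>" using F'_0_ge[OF ix(1) y] \<kappa>(2) by linarith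
    qed (use elim(2) lam in auto)
  qed
  have "branches 0 lam (M + 1)"
  proof (rule expanding_branchesI)
    fix i x assume ix: "i < d" "x \<in> {c 0 i..c 0 (Suc i)}"
    show "lam \<le> \<bar>F' i 0 x\<bar>" using F'_0_ge[OF ix] lam by linarith
    show "\<bar>F'' i 0 x\<bar> \<le> M + 1" using M[OF ix(1), of x] ix(2) cell0[of i] by force
  qed (use \<epsilon>\<^sub>0_pos lam in auto)
  then show ?thesis using ev by blast
qed

section \<open>Perturbed orbits follow bi-valued orbits of the unperturbed map\<close>

lemma one_sided_value:
  assumes i: "i < d" and x: "x \<in> {c 0 i..c 0 (Suc i)}" and pq: "p \<le> c 0 i" "c 0 (Suc i) \<le> q"
  shows "F i 0 x \<in> one_sided_values p q (T 0) x"
proof -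
  have cont: "(F i 0 \<longlongrightarrow> F i 0 x) (at x within X i)"
    using F_cont[OF i order_refl \<epsilon>\<^sub>0_pos] x \<delta>_pos unfolding continuous_on_def by fastforce
  have "x \<in> interior (X i)" using x \<delta>_pos by auto
  then have cont: "(F i 0 \<longlongrightarrow> F i 0 x) (at x)"
    using cont at_within_interior[of x "X i"] by simp
  have lt: "c 0 i < c 0 (Suc i)" using c_less[of 0 i] i by simp
  show ?thesis
  proof (cases "x = c 0 i")
    case True
    have "\<forall>\<^sub>F y in at_right x. F i 0 y = T 0 y"
      using eventually_at_right_real[OF lt] unfolding True
      by eventually_elim (use F_eq_T[OF i order_refl \<epsilon>\<^sub>0_pos] in auto)
    moreover have "(F i 0 \<longlongrightarrow> F i 0 x) (at_right x)" using cont by (rule tendsto_within_subset) auto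
    ultimately have "(T 0 \<longlongrightarrow> F i 0 x) (at_right x)" by (blast intro: Lim_transform_eventually)
    then have "Lim (at_right x) (T 0) = F i 0 x" by (intro tendsto_Lim) auto
    then show ?thesis using True lt pq unfolding one_sided_values_def by auto
  next
    case False
    then have x': "c 0 i < x" using x by auto
    have "\<forall>\<^sub>F y in at_left x. F i 0 y = T 0 y"
      using eventually_at_left_real[OF x']
      by eventually_elim (use x F_eq_T[OF i order_refl \<epsilon>\<^sub>0_pos] in auto)
    moreover have "(F i 0 \<longlongrightarrow> F i 0 x) (at_left x)" using cont by (rule tendsto_within_subset) auto
    ultimately have "(T 0 \<longlongrightarrow> F i 0 x) (at_left x)" by (blast intro: Lim_transform_eventually)
    then have "Lim (at_left x) (T 0) = F i 0 x" by (intro tendsto_Lim) auto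
    then show ?thesis using x x' pq unfolding one_sided_values_def by auto
  qed
qed

text \<open>A point has at most two one-sided values. Finiteness turns the absence of a return into
  a positive distance.\<close>

lemma finite_bivalued_image: "finite A \<Longrightarrow> finite (bivalued_image (T 0) A)"
  by (auto simp: bivalued_image_def one_sided_values_def)

lemma finite_bivalued_image_power: "finite A \<Longrightarrow> finite ((bivalued_image (T 0) ^^ n) A)"
  by (induction n) (auto intro: finite_bivalued_image)

abbreviation stp :: "real \<Rightarrow> real \<Rightarrow> real \<Rightarrow> real \<Rightarrow> bool" where
  "stp \<epsilon> \<equiv> branch_step (c \<epsilon>) d (\<lambda>i. F i \<epsilon>)"

text \<open>Near x only cells whose unperturbed version contains x matter; there the branch is
  uniformly close to \<open>F i 0\<close>, whose value at x is one of the one-sided values. All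
  other cells stay away from x for small \<epsilon>.\<close>

lemma step_upper_semicontinuous:
  assumes \<gamma>: "0 < \<gamma>"
  shows "\<exists>\<eta>>0. \<forall>\<^sub>F \<epsilon> in at_right 0. \<forall>x' y. \<bar>x' - x\<bar> < \<eta> \<longrightarrow> stp \<epsilon> \<eta> x' y \<longrightarrow>
    (\<exists>y0\<in>one_sided_values 0 1 (T 0) x. \<bar>y - y0\<bar> < \<gamma>)"
proof -
  have "\<exists>\<eta>>0. \<forall>\<^sub>F \<epsilon> in at_right 0. \<forall>z\<in>{c \<epsilon> i..c \<epsilon> (Suc i)}. \<bar>z - x\<bar> < \<eta> \<longrightarrow>
    (\<exists>y0\<in>one_sided_values 0 1 (T 0) x. \<bar>F i \<epsilon> z - y0\<bar> < \<gamma>)" if i: "i < d" for i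
  proof (cases "x \<in> {c 0 i..c 0 (Suc i)}")
    case True
    have "x \<in> X i" using True \<delta>_pos by auto
    then obtain \<eta> where \<eta>: "\<eta> > 0" "\<And>z. z \<in> X i \<Longrightarrow> \<bar>z - x\<bar> < \<eta> \<Longrightarrow> \<bar>F i 0 z - F i 0 x\<bar> < \<gamma> / 2"
      using F_cont[OF i order_refl \<epsilon>\<^sub>0_pos] half_gt_zero[OF \<gamma>] unfolding continuous_on_iff dist_real_def by metis
    have "{c 0 i..c 0 (Suc i)} \<subseteq> {0..1}" using cell_subset i by blast
    then have "0 \<le> c 0 i" "c 0 (Suc i) \<le> 1" using c_less[of 0 i] i by auto
    then have val: "F i 0 x \<in> one_sided_values 0 1 (T 0) x" by (rule one_sided_value[OF i True])
    have "\<forall>\<^sub>F \<epsilon> in at_right 0. \<forall>z\<in>{c \<epsilon> i..c \<epsilon> (Suc i)}. \<bar>z - x\<bar> < \<eta> \<longrightarrow>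
      (\<exists>y0\<in>one_sided_values 0 1 (T 0) x. \<bar>F i \<epsilon> z - y0\<bar> < \<gamma>)"
      using eventually_small eventually_F_close[OF half_gt_zero[OF \<gamma>]]
    proof eventually_elim
      case (elim \<epsilon>)
      show ?case
      proof (intro ballI impI bexI[OF _ val])
        fix z assume z: "z \<in> {c \<epsilon> i..c \<epsilon> (Suc i)}" "\<bar>z - x\<bar> < \<eta>"
        then have "z \<in> X i" using cell_sub[OF i] elim(1) by blast
        then have "\<bar>F i \<epsilon> z - F i 0 z\<bar> < \<gamma> / 2" "\<bar>F i 0 z - F i 0 x\<bar> < \<gamma> / 2"
          using elim(2) i \<eta>(2) z(2) by auto
        then show "\<bar>F i \<epsilon> z - F i 0 x\<bar> < \<gamma>" by linarith
      qed
    qed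
    then show ?thesis using \<eta>(1) by blast
  next
    case False
    \<comment> \<open>Half the distance from x to the cell: if its ends move by less than that, the
      cell remains farther than \<eta> from x.\<close>
    define \<eta> where "\<eta> = (if x < c 0 i then c 0 i - x else x - c 0 (Suc i)) / 2"
    have \<eta>: "0 < \<eta>" using False by (auto simp: \<eta>_def)
    have "\<forall>\<^sub>F \<epsilon> in at_right 0. \<forall>z\<in>{c \<epsilon> i..c \<epsilon> (Suc i)}. \<bar>z - x\<bar> < \<eta> \<longrightarrow>
      (\<exists>y0\<in>one_sided_values 0 1 (T 0) x. \<bar>F i \<epsilon> z - y0\<bar> < \<gamma>)"
      using eventually_c_close[OF \<eta>]
    proof eventually_elim
      case (elim \<epsilon>)
      have "\<bar>c \<epsilon> i - c 0 i\<bar> < \<eta>" "\<bar>c \<epsilon> (Suc i) - c 0 (Suc i)\<bar> < \<eta>" using elim i by auto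
      moreover have "c 0 i = x + 2 * \<eta> \<or> c 0 (Suc i) = x - 2 * \<eta>" by (auto simp: \<eta>_def field_simps)
      ultimately have "\<not> \<bar>z - x\<bar> < \<eta>" if "z \<in> {c \<epsilon> i..c \<epsilon> (Suc i)}" for z
        using that unfolding atLeastAtMost_iff by linarith
      then show ?case by blast
    qed
    then show ?thesis using \<eta> by blast
  qed
  then have "\<forall>i\<in>{..<d}. \<exists>\<eta>>0. \<forall>\<^sub>F \<epsilon> in at_right 0. \<forall>z\<in>{c \<epsilon> i..c \<epsilon> (Suc i)}. \<bar>z - x\<bar> < \<eta> \<longrightarrow>
    (\<exists>y0\<in>one_sided_values 0 1 (T 0) x. \<bar>F i \<epsilon> z - y0\<bar> < \<gamma>)" by simp
  from bchoice[OF this] obtain \<eta> where \<eta>: "\<And>i. i < d \<Longrightarrow> 0 < \<eta> i"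
    and ev: "\<And>i. i < d \<Longrightarrow> \<forall>\<^sub>F \<epsilon> in at_right 0. \<forall>z\<in>{c \<epsilon> i..c \<epsilon> (Suc i)}. \<bar>z - x\<bar> < \<eta> i \<longrightarrow>
    (\<exists>y0\<in>one_sided_values 0 1 (T 0) x. \<bar>F i \<epsilon> z - y0\<bar> < \<gamma>)" by auto
  \<comment> \<open>Halved because the branch is evaluated at a point up to \<eta>' away from x',
    which itself may be \<eta>' away from x.\<close>
  define \<eta>' where "\<eta>' = Min (insert 1 (\<eta> ` {..<d})) / 2"
  have \<eta>': "0 < \<eta>'" "\<And>i. i < d \<Longrightarrow> 2 * \<eta>' \<le> \<eta> i" using \<eta> by (auto simp: \<eta>'_def)
  have "\<forall>\<^sub>F \<epsilon> in at_right 0. \<forall>i\<in>{..<d}. \<forall>z\<in>{c \<epsilon> i..c \<epsilon> (Suc i)}. \<bar>z - x\<bar> < \<eta> i \<longrightarrow>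
    (\<exists>y0\<in>one_sided_values 0 1 (T 0) x. \<bar>F i \<epsilon> z - y0\<bar> < \<gamma>)"
    by (intro eventually_ball_finite) (use ev in auto)
  then have "\<forall>\<^sub>F \<epsilon> in at_right 0. \<forall>x' y. \<bar>x' - x\<bar> < \<eta>' \<longrightarrow> stp \<epsilon> \<eta>' x' y \<longrightarrow>
    (\<exists>y0\<in>one_sided_values 0 1 (T 0) x. \<bar>y - y0\<bar> < \<gamma>)"
  proof eventually_elim
    case (elim \<epsilon>)
    show ?case
    proof (intro allI impI)
      fix x' y assume x': "\<bar>x' - x\<bar> < \<eta>'" "stp \<epsilon> \<eta>' x' y"
      then obtain i z where iz: "i < d" "z \<in> {c \<epsilon> i..c \<epsilon> (Suc i)}" "\<bar>z - x'\<bar> < \<eta>'" "y = F i \<epsilon> z"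
        by (auto simp: branch_step_def)
      then have "\<bar>z - x\<bar> < \<eta> i" using \<eta>'(2)[OF iz(1)] x'(1) by linarith
      then show "\<exists>y0\<in>one_sided_values 0 1 (T 0) x. \<bar>y - y0\<bar> < \<gamma>" using elim iz by blast
    qed
  qed
  then show ?thesis using \<eta>'(1) by blast
qed

text \<open>Induction along the orbit; as the n-th bi-valued images are finitely many, one tolerance
  serves all of them.\<close>

lemma steps_upper_semicontinuous:
  assumes "0 < \<gamma>"
  shows "\<exists>\<eta>>0. \<forall>\<^sub>F \<epsilon> in at_right 0. \<forall>x' y. \<bar>x' - x\<bar> < \<eta> \<longrightarrow> (stp \<epsilon> \<eta> ^^ n) x' y \<longrightarrow>
    (\<exists>y0\<in>(bivalued_image (T 0) ^^ n) {x}. \<bar>y - y0\<bar> < \<gamma>)"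
  using assms
proof (induction n arbitrary: \<gamma>)
  case 0
  then show ?case by auto
next
  case (Suc n)
  let ?A = "(bivalued_image (T 0) ^^ n) {x}"
  have fin: "finite ?A" by (intro finite_bivalued_image_power) simp
  obtain \<eta>1 where \<eta>1: "\<And>a. 0 < \<eta>1 a" and ev1: "\<And>a. \<forall>\<^sub>F \<epsilon> in at_right 0. \<forall>x' y. \<bar>x' - a\<bar> < \<eta>1 a \<longrightarrow>
    stp \<epsilon> (\<eta>1 a) x' y \<longrightarrow> (\<exists>y0\<in>one_sided_values 0 1 (T 0) a. \<bar>y - y0\<bar> < \<gamma>)"
  proof -
    have "\<forall>a. \<exists>\<eta>>0. \<forall>\<^sub>F \<epsilon> in at_right 0. \<forall>x' y. \<bar>x' - a\<bar> < \<eta> \<longrightarrow> stp \<epsilon> \<eta> x' y \<longrightarrow>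
      (\<exists>y0\<in>one_sided_values 0 1 (T 0) a. \<bar>y - y0\<bar> < \<gamma>)"
      using step_upper_semicontinuous[OF Suc.prems] by blast
    from choice[OF this] show thesis using that by blast
  qed
  define \<gamma>1 where "\<gamma>1 = Min (insert 1 (\<eta>1 ` ?A))"
  have \<gamma>1: "0 < \<gamma>1" "\<And>a. a \<in> ?A \<Longrightarrow> \<gamma>1 \<le> \<eta>1 a" using \<eta>1 fin by (auto simp: \<gamma>1_def)
  obtain \<eta>2 where \<eta>2: "0 < \<eta>2" and ev2: "\<forall>\<^sub>F \<epsilon> in at_right 0. \<forall>x' y. \<bar>x' - x\<bar> < \<eta>2 \<longrightarrow>
    (stp \<epsilon> \<eta>2 ^^ n) x' y \<longrightarrow> (\<exists>y0\<in>?A. \<bar>y - y0\<bar> < \<gamma>1)"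
    using Suc.IH[OF \<gamma>1(1)] by blast
  define \<eta> where "\<eta> = min \<gamma>1 \<eta>2"
  have "\<forall>\<^sub>F \<epsilon> in at_right 0. \<forall>a\<in>?A. \<forall>x' y. \<bar>x' - a\<bar> < \<eta>1 a \<longrightarrow>
    stp \<epsilon> (\<eta>1 a) x' y \<longrightarrow> (\<exists>y0\<in>one_sided_values 0 1 (T 0) a. \<bar>y - y0\<bar> < \<gamma>)"
    by (intro eventually_ball_finite fin) (use ev1 in auto)
  then have "\<forall>\<^sub>F \<epsilon> in at_right 0. \<forall>x' y. \<bar>x' - x\<bar> < \<eta> \<longrightarrow> (stp \<epsilon> \<eta> ^^ Suc n) x' y \<longrightarrow>
    (\<exists>y0\<in>(bivalued_image (T 0) ^^ Suc n) {x}. \<bar>y - y0\<bar> < \<gamma>)"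
    using ev2
  proof eventually_elim
    case (elim \<epsilon>)
    show ?case
    proof (intro allI impI)
      fix x' y assume x': "\<bar>x' - x\<bar> < \<eta>" "(stp \<epsilon> \<eta> ^^ Suc n) x' y"
      then obtain w where w: "(stp \<epsilon> \<eta> ^^ n) x' w" "stp \<epsilon> \<eta> w y" by auto
      have le: "\<eta> \<le> \<gamma>1" "\<eta> \<le> \<eta>2" by (auto simp: \<eta>_def)
      have "(stp \<epsilon> \<eta>2 ^^ n) x' w" using branch_step_power_mono[OF le(2) w(1)] .
      moreover have "\<bar>x' - x\<bar> < \<eta>2" using x'(1) le(2) by linarith
      ultimately obtain a where a: "a \<in> ?A" "\<bar>w - a\<bar> < \<gamma>1" using elim(2) by blast
      have "\<eta> \<le> \<eta>1 a" using le(1) \<gamma>1(2)[OF a(1)] by linarith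
      then have "stp \<epsilon> (\<eta>1 a) w y" using branch_step_mono[OF _ w(2)] by blast
      moreover have "\<bar>w - a\<bar> < \<eta>1 a" using a(2) \<gamma>1(2)[OF a(1)] by linarith
      ultimately obtain y0 where "y0 \<in> one_sided_values 0 1 (T 0) a" "\<bar>y - y0\<bar> < \<gamma>"
        using elim(1) a(1) by blast
      then show "\<exists>y0\<in>(bivalued_image (T 0) ^^ Suc n) {x}. \<bar>y - y0\<bar> < \<gamma>"
        using a(1) by (auto simp: bivalued_image_def)
    qed
  qed
  moreover have "0 < \<eta>" using \<gamma>1 \<eta>2 by (simp add: \<eta>_def)
  ultimately show ?case by blast
qed

lemma no_return_single:
  assumes j: "j \<le> d" and np: "c 0 j \<notin> (bivalued_image (T 0) ^^ n) {c 0 j}"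
  shows "\<exists>\<eta>>0. \<forall>\<^sub>F \<epsilon> in at_right 0. \<forall>x y. \<bar>x - c \<epsilon> j\<bar> < \<eta> \<longrightarrow> (stp \<epsilon> \<eta> ^^ n) x y \<longrightarrow> \<eta> \<le> \<bar>y - c \<epsilon> j\<bar>"
proof -
  let ?A = "(bivalued_image (T 0) ^^ n) {c 0 j}"
  have fin: "finite ?A" by (intro finite_bivalued_image_power) simp
  \<comment> \<open>A third of the distance from \<open>c 0 j\<close> to its n-th images: one part
    is lost to the deviation of y, one to the motion of the critical point, and one remains as the
    distance kept.\<close>
  define \<gamma> where "\<gamma> = Min (insert 1 ((\<lambda>a. \<bar>a - c 0 j\<bar>) ` ?A)) / 3"
  have \<gamma>: "0 < \<gamma>" "\<And>a. a \<in> ?A \<Longrightarrow> 3 * \<gamma> \<le> \<bar>a - c 0 j\<bar>" using np fin by (auto simp: \<gamma>_def)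
  obtain \<eta>1 where \<eta>1: "0 < \<eta>1" and ev: "\<forall>\<^sub>F \<epsilon> in at_right 0. \<forall>x' y. \<bar>x' - c 0 j\<bar> < \<eta>1 \<longrightarrow>
    (stp \<epsilon> \<eta>1 ^^ n) x' y \<longrightarrow> (\<exists>y0\<in>?A. \<bar>y - y0\<bar> < \<gamma>)"
    using steps_upper_semicontinuous[OF \<gamma>(1)] by blast
  define \<eta> where "\<eta> = min (\<eta>1 / 2) \<gamma>"
  have \<eta>: "0 < \<eta>" "2 * \<eta> \<le> \<eta>1" "\<eta> \<le> \<eta>1" "\<eta> \<le> \<gamma>" using \<eta>1 \<gamma>(1) by (auto simp: \<eta>_def)
  have "\<forall>\<^sub>F \<epsilon> in at_right 0. \<forall>x y. \<bar>x - c \<epsilon> j\<bar> < \<eta> \<longrightarrow> (stp \<epsilon> \<eta> ^^ n) x y \<longrightarrow> \<eta> \<le> \<bar>y - c \<epsilon> j\<bar>"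
    using ev eventually_c_close[OF \<eta>(1)]
  proof eventually_elim
    case (elim \<epsilon>)
    show ?case
    proof (intro allI impI)
      fix x y assume x: "\<bar>x - c \<epsilon> j\<bar> < \<eta>" "(stp \<epsilon> \<eta> ^^ n) x y"
      have cj: "\<bar>c \<epsilon> j - c 0 j\<bar> < \<eta>" using elim(2) j by blast
      then have "\<bar>x - c 0 j\<bar> < \<eta>1" using x(1) \<eta>(2) by linarith
      then obtain y0 where "y0 \<in> ?A" "\<bar>y - y0\<bar> < \<gamma>"
        using elim(1) branch_step_power_mono[OF \<eta>(3) x(2)] by blast
      then show "\<eta> \<le> \<bar>y - c \<epsilon> j\<bar>" using \<gamma>(2)[of y0] cj \<eta>(4) by linarith
    qed
  qed
  then show ?thesis using \<eta>(1) by blast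
qed

text \<open>Stated for every smaller \<eta> as well, since shrinking \<eta> admits fewer orbits and
  weakens the conclusion; \<eta> can thus still be fitted to the cell lengths.\<close>

lemma no_return:
  assumes np: "\<And>j n. 0 < j \<Longrightarrow> j < d \<Longrightarrow> 0 < n \<Longrightarrow> n \<le> N \<Longrightarrow> c 0 j \<notin> (bivalued_image (T 0) ^^ n) {c 0 j}"
  shows "\<exists>\<eta>0>0. \<forall>\<eta>. \<eta> \<le> \<eta>0 \<longrightarrow> (\<forall>\<^sub>F \<epsilon> in at_right 0. \<forall>j n x y. 0 < j \<longrightarrow> j < d \<longrightarrow> 0 < n \<longrightarrow> n \<le> N \<longrightarrow>
    \<bar>x - c \<epsilon> j\<bar> < \<eta> \<longrightarrow> (stp \<epsilon> \<eta> ^^ n) x y \<longrightarrow> \<eta> \<le> \<bar>y - c \<epsilon> j\<bar>)"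
proof -
  let ?I = "{0<..<d} \<times> {0<..N}"
  have "\<forall>p\<in>?I. \<exists>\<eta>>0. \<forall>\<^sub>F \<epsilon> in at_right 0. \<forall>x y. \<bar>x - c \<epsilon> (fst p)\<bar> < \<eta> \<longrightarrow>
      (stp \<epsilon> \<eta> ^^ snd p) x y \<longrightarrow> \<eta> \<le> \<bar>y - c \<epsilon> (fst p)\<bar>"
    using no_return_single np by auto
  from bchoice[OF this] obtain \<eta>1 where *: "\<forall>p\<in>?I. 0 < \<eta>1 p \<and> (\<forall>\<^sub>F \<epsilon> in at_right 0.
      \<forall>x y. \<bar>x - c \<epsilon> (fst p)\<bar> < \<eta>1 p \<longrightarrow>
      (stp \<epsilon> (\<eta>1 p) ^^ snd p) x y \<longrightarrow> \<eta>1 p \<le> \<bar>y - c \<epsilon> (fst p)\<bar>)" ..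
  note \<eta>1 = bspec[OF *, THEN conjunct1] and ev = bspec[OF *, THEN conjunct2]
  define \<eta>0 where "\<eta>0 = Min (insert 1 (\<eta>1 ` ?I))"
  have \<eta>0: "0 < \<eta>0" "\<And>p. p \<in> ?I \<Longrightarrow> \<eta>0 \<le> \<eta>1 p" using \<eta>1 by (auto simp: \<eta>0_def)
  have all: "\<forall>\<^sub>F \<epsilon> in at_right 0. \<forall>p\<in>?I. \<forall>x y. \<bar>x - c \<epsilon> (fst p)\<bar> < \<eta>1 p \<longrightarrow>
      (stp \<epsilon> (\<eta>1 p) ^^ snd p) x y \<longrightarrow> \<eta>1 p \<le> \<bar>y - c \<epsilon> (fst p)\<bar>"
  proof (rule eventually_ball_finite)
    show "finite ?I" by simp
    show "\<forall>p\<in>?I. \<forall>\<^sub>F \<epsilon> in at_right 0. \<forall>x y. \<bar>x - c \<epsilon> (fst p)\<bar> < \<eta>1 p \<longrightarrow>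
      (stp \<epsilon> (\<eta>1 p) ^^ snd p) x y \<longrightarrow> \<eta>1 p \<le> \<bar>y - c \<epsilon> (fst p)\<bar>" using ev by (rule ballI)
  qed
  have "\<forall>\<^sub>F \<epsilon> in at_right 0. \<forall>j n x y. 0 < j \<longrightarrow> j < d \<longrightarrow> 0 < n \<longrightarrow> n \<le> N \<longrightarrow>
    \<bar>x - c \<epsilon> j\<bar> < \<eta> \<longrightarrow> (stp \<epsilon> \<eta> ^^ n) x y \<longrightarrow> \<eta> \<le> \<bar>y - c \<epsilon> j\<bar>" if "\<eta> \<le> \<eta>0" for \<eta>
    using all
  proof eventually_elim
    case (elim \<epsilon>)
    show ?case
    proof (intro allI impI)
      fix j n x y assume *: "0 < j" "j < d" "0 < n" "n \<le> N" "\<bar>x - c \<epsilon> j\<bar> < \<eta>" "(stp \<epsilon> \<eta> ^^ n) x y"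
      then have p: "(j, n) \<in> ?I" by auto
      have le: "\<eta> \<le> \<eta>1 (j, n)" using \<eta>0(2)[OF p] that by linarith
      have "\<bar>x - c \<epsilon> j\<bar> < \<eta>1 (j, n)" using *(5) le by linarith
      moreover have "(stp \<epsilon> (\<eta>1 (j, n)) ^^ n) x y" using branch_step_power_mono[OF le *(6)] .
      ultimately have "\<eta>1 (j, n) \<le> \<bar>y - c \<epsilon> j\<bar>" using elim p by fastforce
      then show "\<eta> \<le> \<bar>y - c \<epsilon> j\<bar>" using le by linarith
    qed
  qed
  then show ?thesis using \<eta>0(1) by blast
qed

lemma eventually_cells_long: "\<exists>\<eta>0>0. \<forall>\<^sub>F \<epsilon> in at_right 0. \<forall>i<d. 2 * \<eta>0 \<le> c \<epsilon> (Suc i) - c \<epsilon> i"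
proof -
  define m where "m = Min (insert 1 ((\<lambda>i. c 0 (Suc i) - c 0 i) ` {..<d})) / 4"
  have m: "0 < m" "\<And>i. i < d \<Longrightarrow> 4 * m \<le> c 0 (Suc i) - c 0 i" using c_less[of 0] by (auto simp: m_def)
  have "\<forall>\<^sub>F \<epsilon> in at_right 0. \<forall>i<d. 2 * m \<le> c \<epsilon> (Suc i) - c \<epsilon> i"
    using eventually_c_close[OF m(1)]
  proof eventually_elim
    case (elim \<epsilon>)
    show ?case
    proof (intro allI impI)
      fix i assume i: "i < d"
      then have "\<bar>c \<epsilon> i - c 0 i\<bar> < m" "\<bar>c \<epsilon> (Suc i) - c 0 (Suc i)\<bar> < m" using elim by auto
      then show "2 * m \<le> c \<epsilon> (Suc i) - c \<epsilon> i" using m(2)[OF i] by linarith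
    qed
  qed
  then show ?thesis using m(1) by blast
qed

text \<open>The number of steps, the exponent and \<eta> are fixed from the unperturbed map before
  \<epsilon>, so the resulting bound depends neither on \<epsilon> nor on f.\<close>

lemma uniform_weak_variation:
  assumes m1: "1 < min_expansion (T 0) (c 0 ` {..d})"
    and alt: "2 < min_expansion (T 0) (c 0 ` {..d}) \<or>
      (\<forall>j n. 0 < j \<longrightarrow> j < d \<longrightarrow> 0 < n \<longrightarrow> c 0 j \<notin> (bivalued_image (T 0) ^^ n) {c 0 j})"
    and \<rho>: "(\<rho> \<longlongrightarrow> 1) (at_right 0)" "\<forall>\<^sub>F \<epsilon> in at_right 0. \<rho> \<epsilon> \<le> 1"
  shows "\<exists>V. \<forall>\<^sub>F \<epsilon> in at_right 0. \<forall>f\<in>BV. perron_frobenius (T \<epsilon>) (c \<epsilon>) d f = (\<lambda>x. \<rho> \<epsilon> * f x) \<longrightarrow>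
    (LINT x|lborel. \<bar>f x\<bar>) \<le> 1 \<longrightarrow> weak_variation_le f V"
proof -
  obtain lam N K \<eta> where lam: "1 < lam" "lam < min_expansion (T 0) (c 0 ` {..d})"
    and contr: "(2::real)^K < lam^N" and \<eta>: "0 < \<eta>"
    and long: "\<forall>\<^sub>F \<epsilon> in at_right 0. \<forall>i<d. 2 * \<eta> \<le> c \<epsilon> (Suc i) - c \<epsilon> i"
    and ret: "\<forall>\<^sub>F \<epsilon> in at_right 0. \<forall>j n x y. 0 < j \<longrightarrow> j < d \<longrightarrow> 0 < n \<longrightarrow> n < N \<longrightarrow>
      \<bar>x - c \<epsilon> j\<bar> < \<eta> \<longrightarrow> (stp \<epsilon> \<eta> ^^ n) x y \<longrightarrow> \<eta> \<le> \<bar>y - c \<epsilon> j\<bar>"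
    and NK: "N = 1 \<and> K = 1 \<or> K = d"
  proof -
    obtain \<eta>l where \<eta>l: "0 < \<eta>l" "\<forall>\<^sub>F \<epsilon> in at_right 0. \<forall>i<d. 2 * \<eta>l \<le> c \<epsilon> (Suc i) - c \<epsilon> i"
      using eventually_cells_long by blast
    from alt show thesis
    proof
      assume "2 < min_expansion (T 0) (c 0 ` {..d})"
      then obtain lam where "2 < lam" "lam < min_expansion (T 0) (c 0 ` {..d})" using dense by blast
      \<comment> \<open>One step and one doubling suffice here; the condition on returns is void, as
        no n satisfies 0 < n < 1.\<close>
      then show thesis using that[of lam 1 1 \<eta>l] \<eta>l by auto
    next
      assume np: "\<forall>j n. 0 < j \<longrightarrow> j < d \<longrightarrow> 0 < n \<longrightarrow> c 0 j \<notin> (bivalued_image (T 0) ^^ n) {c 0 j}"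
      obtain lam where lam: "1 < lam" "lam < min_expansion (T 0) (c 0 ` {..d})" using dense m1 by blast
      obtain N where N: "(2::real)^d < lam^N" using real_arch_pow[OF lam(1)] by blast
      obtain \<eta>r where \<eta>r: "0 < \<eta>r" "\<And>\<eta>. \<eta> \<le> \<eta>r \<Longrightarrow> \<forall>\<^sub>F \<epsilon> in at_right 0. \<forall>j n x y. 0 < j \<longrightarrow> j < d \<longrightarrow> 0 < n \<longrightarrow> n \<le> N \<longrightarrow>
        \<bar>x - c \<epsilon> j\<bar> < \<eta> \<longrightarrow> (stp \<epsilon> \<eta> ^^ n) x y \<longrightarrow> \<eta> \<le> \<bar>y - c \<epsilon> j\<bar>"
        using no_return[of N] np by blast
      define \<eta> where "\<eta> = min \<eta>l \<eta>r"
      have "\<forall>\<^sub>F \<epsilon> in at_right 0. \<forall>i<d. 2 * \<eta> \<le> c \<epsilon> (Suc i) - c \<epsilon> i"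
        using \<eta>l(2) by eventually_elim (force simp: \<eta>_def)
      moreover have "\<forall>\<^sub>F \<epsilon> in at_right 0. \<forall>j n x y. 0 < j \<longrightarrow> j < d \<longrightarrow> 0 < n \<longrightarrow> n < N \<longrightarrow>
        \<bar>x - c \<epsilon> j\<bar> < \<eta> \<longrightarrow> (stp \<epsilon> \<eta> ^^ n) x y \<longrightarrow> \<eta> \<le> \<bar>y - c \<epsilon> j\<bar>"
        using \<eta>r(2)[of \<eta>] by (auto simp: \<eta>_def elim!: eventually_mono)
      moreover have "0 < \<eta>" using \<eta>l(1) \<eta>r(1) by (simp add: \<eta>_def)
      ultimately show thesis using that[of lam d N \<eta>] lam N by blast
    qed
  qed
  obtain M where ex: "\<forall>\<^sub>F \<epsilon> in at_right 0.
      branches \<epsilon> lam M"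
    using eventually_expanding[OF lam] by blast
  define \<theta> where "\<theta> = 2^K / lam^N"
  have \<theta>: "0 \<le> \<theta>" "\<theta> < 1" using contr lam(1) by (auto simp: \<theta>_def)
  \<comment> \<open>Halfway between \<theta> and 1, leaving room for the factor
    \<open>1 / \<rho> \<epsilon>^N\<close>, which tends to 1.\<close>
  define q where "q = (1 + \<theta>) / 2"
  have q: "\<theta> < q" "q < 1" using \<theta> by (auto simp: q_def)
  define C where "C = real N * (2^d * (M + 2 / \<eta>))"
  have "((\<lambda>\<epsilon>. \<theta> / \<rho> \<epsilon>^N) \<longlongrightarrow> \<theta> / 1^N) (at_right 0)" "((\<lambda>\<epsilon>. C / \<rho> \<epsilon>^N) \<longlongrightarrow> C / 1^N) (at_right 0)"
    by (intro tendsto_intros \<rho>(1); simp)+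
  then have "\<forall>\<^sub>F \<epsilon> in at_right 0. \<theta> / \<rho> \<epsilon>^N < q" "\<forall>\<^sub>F \<epsilon> in at_right 0. C / \<rho> \<epsilon>^N < \<bar>C\<bar> + 1"
    using q(1) by (auto intro!: order_tendstoD(2))
  moreover have "\<forall>\<^sub>F \<epsilon> in at_right 0. 0 < \<rho> \<epsilon>" using order_tendstoD(1)[OF \<rho>(1), of 0] by simp
  ultimately have "\<forall>\<^sub>F \<epsilon> in at_right 0. \<forall>f\<in>BV. perron_frobenius (T \<epsilon>) (c \<epsilon>) d f = (\<lambda>x. \<rho> \<epsilon> * f x) \<longrightarrow>
    (LINT x|lborel. \<bar>f x\<bar>) \<le> 1 \<longrightarrow> weak_variation_le f ((\<bar>C\<bar> + 1) / (1 - q))"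
    using ex long ret \<rho>(2)
  proof eventually_elim
    case (elim \<epsilon>)
    interpret E: expanding_branches "T \<epsilon>" "c \<epsilon>" d "\<lambda>i. F i \<epsilon>" "\<lambda>i. F' i \<epsilon>" "\<lambda>i. F'' i \<epsilon>" lam M
      using elim(4) .
    have long: "2 * \<eta> \<le> c \<epsilon> (Suc i) - c \<epsilon> i" if "i < d" for i using elim(5) that by blast
    have card: "card (E.reach \<eta> N x) \<le> K" for x
      using NK
    proof
      assume NK: "N = 1 \<and> K = 1"
      \<comment> \<open>Two different critical points within \<eta> of x would be closer than
        \<open>2 * \<eta>\<close>, against the cell length.\<close>
      have "j = k" if "j \<in> E.reach \<eta> N x" "k \<in> E.reach \<eta> N x" for j k
      proof (rule ccontr)
        have *: "j < d" "k < d" "\<bar>x - c \<epsilon> j\<bar> < \<eta>" "\<bar>x - c \<epsilon> k\<bar> < \<eta>"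
          using that NK by (auto simp: E.reach_def)
        assume "j \<noteq> k"
        then consider "Suc j \<le> k" | "Suc k \<le> j" by linarith
        then show False
        proof cases
          case 1
          then show ?thesis using E.c_mono[OF 1] *  long[of j] by (smt (verit) less_imp_le)
        next
          case 2
          then show ?thesis using E.c_mono[OF 2] *  long[of k] by (smt (verit) less_imp_le)
        qed
      qed
      then show ?thesis using NK by (simp add: card_le_Suc0_iff_eq)
    qed (use E.card_reach_le in simp)
    have nonrec: "j \<notin> E.reach \<eta> (N - 1) y"
      if "0 < j" "j < d" "\<bar>x - c \<epsilon> j\<bar> < \<eta>" "stp \<epsilon> \<eta> x y" for j x y
    proof
      assume "j \<in> E.reach \<eta> (N - 1) y"
      then obtain m y' where m: "m < N - 1" "(stp \<epsilon> \<eta> ^^ m) y y'" "\<bar>y' - c \<epsilon> j\<bar> < \<eta>"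
        by (auto simp: E.reach_def)
      have "(stp \<epsilon> \<eta> ^^ Suc m) x y'"
        using relpowp_Suc_I2[of "stp \<epsilon> \<eta>" x y m y', OF that(4) m(2)] .
      moreover have "0 < Suc m" "Suc m < N" using m(1) by auto
      ultimately have "\<eta> \<le> \<bar>y' - c \<epsilon> j\<bar>" using elim(6) that(1-3) by blast
      then show False using m(3) by simp
    qed
    show ?case
    proof (intro ballI impI)
      fix f :: "real \<Rightarrow> real"
      assume f: "f \<in> BV" "perron_frobenius (T \<epsilon>) (c \<epsilon>) d f = (\<lambda>x. \<rho> \<epsilon> * f x)" "(LINT x|lborel. \<bar>f x\<bar>) \<le> 1"
      obtain V where V: "weak_variation_le f V" using BV_weak_variation_finite[OF f(1)] by blast
      have pos: "0 \<le> \<theta> / \<rho> \<epsilon>^N" using \<theta>(1) elim(3) by simp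
      have "weak_variation_le f ((C / \<rho> \<epsilon>^N) / (1 - \<theta> / \<rho> \<epsilon>^N))"
      proof (rule weak_variation_fixed_bound[OF V _ pos])
        fix V assume V: "weak_variation_le f V"
        show "weak_variation_le f (\<theta> / \<rho> \<epsilon>^N * V + C / \<rho> \<epsilon>^N)"
          unfolding \<theta>_def C_def
          by (rule E.weak_variation_contraction[OF f elim(3,7) \<eta> long _ card V])
             (use nonrec in auto)
      qed (use elim(1) q in linarith)
      moreover have "(C / \<rho> \<epsilon>^N) / (1 - \<theta> / \<rho> \<epsilon>^N) \<le> (\<bar>C\<bar> + 1) / (1 - q)"
      proof -
        have "(C / \<rho> \<epsilon>^N) / (1 - \<theta> / \<rho> \<epsilon>^N) \<le> (\<bar>C\<bar> + 1) / (1 - \<theta> / \<rho> \<epsilon>^N)"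
          using elim(1,2) q by (intro divide_right_mono) auto
        also have "\<dots> \<le> (\<bar>C\<bar> + 1) / (1 - q)"
          using elim(1) q by (intro divide_left_mono mult_pos_pos) auto
        finally show ?thesis .
      qed
      ultimately show "weak_variation_le f ((\<bar>C\<bar> + 1) / (1 - q))"
        by (rule weak_variation_le_mono)
    qed
  qed
  then show ?thesis by blast
qed

end

section \<open>Invariant limits\<close>

lemma emeasure_density_lborel:
  fixes u :: "real \<Rightarrow> real"
  assumes "integrable lborel u" "\<And>x. 0 \<le> u x" "A \<in> sets borel"
  shows "emeasure (density lborel (\<lambda>x. ennreal (u x))) A = ennreal (LINT x:A|lborel. u x)"
proof -
  have [measurable]: "u \<in> borel_measurable borel" using assms(1) by auto
  have "emeasure (density lborel (\<lambda>x. ennreal (u x))) A = (\<integral>\<^sup>+x. ennreal (u x) * indicator A x \<partial>lborel)"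
    using assms(3) by (intro emeasure_density) auto
  also have "\<dots> = (\<integral>\<^sup>+x. ennreal (indicator A x *\<^sub>R u x) \<partial>lborel)"
    by (intro nn_integral_cong) (auto simp: indicator_def)
  also have "\<dots> = ennreal (LINT x:A|lborel. u x)"
    unfolding set_lebesgue_integral_def using assms
    by (intro nn_integral_eq_integral integrable_mult_indicator) auto
  finally show ?thesis .
qed

context expanding_branches begin

text \<open>By injectivity a value has at most one preimage per cell. This disposes of the jump of a
  half-line indicator and of orbits hitting b.\<close>

lemma AE_T_meas_neq: "AE x in lborel. x \<in> {0..1} \<longrightarrow> T_meas x \<noteq> a"
proof -
  let ?E = "\<Union>i<d. {x \<in> {c i..c (Suc i)}. F i x \<in> {a}}"
  have "finite {x \<in> {c i..c (Suc i)}. F i x \<in> {a}}" if "i < d" for i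
    using finite_vimage_IntI[OF _ F_inj[OF that], of "{a}"] by (auto simp: vimage_def Int_def conj_commute)
  then have "AE x in lborel. x \<notin> ?E"
    by (intro AE_not_in countable_imp_null_set_lborel countable_finite) auto
  then show ?thesis
    using AE_interior
  proof eventually_elim
    case (elim x)
    show ?case
    proof
      assume "x \<in> {0..1}"
      then obtain i where i: "i < d" "x \<in> {c i<..<c (Suc i)}" using elim(2) by blast
      then show "T_meas x \<noteq> a" using elim(1) T_meas_eq[OF i] by force
    qed
  qed
qed

lemma T_meas_vimage [measurable]: "A \<in> sets borel \<Longrightarrow> T_meas -` A \<in> sets borel"
  using measurable_sets[OF T_meas_measurable, of A] by simp

text \<open>Half-lines generate the Borel sets and are stable under intersection, and the sets with
  equal integrals form a Dynkin system. As \<psi> is signed, the argument runs on integrals instead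
  of measures.\<close>

lemma signed_invariance:
  assumes \<psi>: "integrable lborel \<psi>"
    and basic: "\<And>a. (LINT x:T_meas -` {..a}|lborel. \<psi> x) = (LINT x:{..a}|lborel. \<psi> x :: real)"
    and A: "A \<in> sets borel"
  shows "(LINT x:T_meas -` A|lborel. \<psi> x) = (LINT x:A|lborel. \<psi> x)"
proof -
  have int: "set_integrable lborel B \<psi>" if "B \<in> sets borel" for B
    unfolding set_integrable_def using that \<psi> by (intro integrable_mult_indicator) auto
  have sb: "sigma_sets UNIV (range (\<lambda>a::real. {..a})) = sets borel"
    by (subst borel_eq_atMost) simp
  have stable: "Int_stable (range (\<lambda>a::real. {..a}))"
    by (auto simp: Int_stable_def)
  have sub: "range (\<lambda>a::real. {..a}) \<subseteq> Pow UNIV" by simp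
  have "A \<in> sigma_sets UNIV (range (\<lambda>a::real. {..a}))" using A sb by simp
  with stable sub show ?thesis
  proof (induction rule: sigma_sets_induct_disjoint)
    case basic': (basic B) then show ?case using basic by auto
  next
    case empty show ?case by simp
  next
    case (compl B)
    then have B: "B \<in> sets borel" using sb by simp
    have compl_int: "(LINT x:UNIV - C|lborel. \<psi> x) = (LINT x|lborel. \<psi> x) - (LINT x:C|lborel. \<psi> x)"
      if "C \<in> sets borel" for C
    proof -
      have "(LINT x:UNIV - C|lborel. \<psi> x) = (LINT x|lborel. \<psi> x - indicator C x *\<^sub>R \<psi> x)"
        unfolding set_lebesgue_integral_def by (intro Bochner_Integration.integral_cong) (auto simp: indicator_def)
      then show ?thesis
        using int[OF that] \<psi> unfolding set_integrable_def set_lebesgue_integral_def by simp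
    qed
    have "T_meas -` (UNIV - B) = UNIV - T_meas -` B" by auto
    then show ?case using compl_int[OF B] compl_int[OF T_meas_vimage[OF B]] compl by simp
  next
    case (union B)
    then have B: "B i \<in> sets borel" for i using sb by auto
    have disj: "B i \<inter> B j = {}" if "i \<noteq> j" for i j using union(1) that by (auto simp: disjoint_family_on_def)
    have "(LINT x:(\<Union>i. B i)|lborel. \<psi> x) = (\<Sum>i. LINT x:B i|lborel. \<psi> x)"
      using B disj by (intro lebesgue_integral_countable_add int) auto
    moreover have "(LINT x:(\<Union>i. T_meas -` B i)|lborel. \<psi> x) = (\<Sum>i. LINT x:T_meas -` B i|lborel. \<psi> x)"
      using B disj by (intro lebesgue_integral_countable_add int) auto
    ultimately show ?case using union(3) by (simp add: vimage_UN)
  qed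
qed

text \<open>The positive mass of B is the integral of \<psi> over the part of B where \<psi> > 0,
  hence over the preimage of that part, which is at most the positive mass of the preimage of B.
  Complements give the reverse inequality because the total positive mass is finite.\<close>

lemma positive_part_invariance:
  assumes \<psi>: "integrable lborel \<psi>"
    and inv: "\<And>A. A \<in> sets borel \<Longrightarrow> (LINT x:T_meas -` A|lborel. \<psi> x) = (LINT x:A|lborel. \<psi> x :: real)"
    and A: "A \<in> sets borel"
  shows "(LINT x:T_meas -` A|lborel. max 0 (\<psi> x)) = (LINT x:A|lborel. max 0 (\<psi> x))"
proof -
  have [measurable]: "\<psi> \<in> borel_measurable borel" using \<psi> by auto
  have pint: "integrable lborel (\<lambda>x. max 0 (\<psi> x))" using \<psi> by (intro integrable_max) auto
  let ?P = "{x. 0 < \<psi> x}"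
  have P: "?P \<in> sets borel" by measurable
  have le: "(LINT x:B|lborel. max 0 (\<psi> x)) \<le> (LINT x:T_meas -` B|lborel. max 0 (\<psi> x))" if B: "B \<in> sets borel" for B
  proof -
    have "(LINT x:B|lborel. max 0 (\<psi> x)) = (LINT x:B \<inter> ?P|lborel. \<psi> x)"
      unfolding set_lebesgue_integral_def by (intro Bochner_Integration.integral_cong) (auto simp: indicator_def)
    also have "\<dots> = (LINT x:T_meas -` (B \<inter> ?P)|lborel. \<psi> x)" using inv[of "B \<inter> ?P"] B P by simp
    also have "\<dots> \<le> (LINT x:T_meas -` B|lborel. max 0 (\<psi> x))"
      unfolding set_lebesgue_integral_def
      using B P \<psi> pint T_meas_vimage[of "B \<inter> ?P"] T_meas_vimage[OF B]
      by (intro integral_mono integrable_mult_indicator) (auto simp: indicator_def)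
    finally show ?thesis .
  qed
  have compl: "(LINT x:- C|lborel. max 0 (\<psi> x)) = (LINT x|lborel. max 0 (\<psi> x)) - (LINT x:C|lborel. max 0 (\<psi> x))"
    if "C \<in> sets borel" for C
  proof -
    have "(LINT x:- C|lborel. max 0 (\<psi> x)) = (LINT x|lborel. max 0 (\<psi> x) - indicator C x *\<^sub>R max 0 (\<psi> x))"
      unfolding set_lebesgue_integral_def by (intro Bochner_Integration.integral_cong) (auto simp: indicator_def)
    also have "\<dots> = (LINT x|lborel. max 0 (\<psi> x)) - (LINT x|lborel. indicator C x *\<^sub>R max 0 (\<psi> x))"
      using that pint by (intro Bochner_Integration.integral_diff integrable_mult_indicator) auto
    finally show ?thesis by (simp add: set_lebesgue_integral_def)
  qed
  have "- A \<in> sets borel" using A by (simp add: Compl_in_sets_lebesgue borel_comp)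
  from le[OF this] have "(LINT x:T_meas -` A|lborel. max 0 (\<psi> x)) \<le> (LINT x:A|lborel. max 0 (\<psi> x))"
    using compl[OF A] compl[OF T_meas_vimage[OF A]] by (simp add: vimage_Compl)
  then show ?thesis using le[OF A] by simp
qed

lemma AE_T_meas_eq_T: "AE x in lborel. x \<in> {0..1} \<longrightarrow> T_meas x = T x"
  using AE_interior
proof eventually_elim
  case (elim x)
  then show ?case using T_meas_eq F_eq_T by metis
qed

text \<open>Off the finite critical set \<open>T\<close> agrees with \<open>T_meas\<close>; its
  values on that set change the preimage by finitely many points only.\<close>

lemma T_vimage_borel:
  assumes A: "A \<in> sets borel" and pq: "{p..q} \<subseteq> {0..1}"
  shows "T -` A \<inter> {p..q} \<in> sets borel"
proof -
  let ?C = "c ` {..d}"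
  have eq: "T_meas x = T x" if "x \<in> {p..q}" "x \<notin> ?C" for x
  proof -
    have "x \<in> {0..1}" using that(1) pq by blast
    then obtain i where i: "i < d" "x \<in> {c i..c (Suc i)}" using cell_exists by blast
    moreover have "x \<noteq> c i" "x \<noteq> c (Suc i)" using that(2) i(1) by auto
    ultimately have "x \<in> {c i<..<c (Suc i)}" by auto
    then show ?thesis using T_meas_eq F_eq_T i(1) by metis
  qed
  have split: "T -` A \<inter> {p..q} = ((T_meas -` A \<inter> {p..q}) - ?C) \<union> (T -` A \<inter> {p..q} \<inter> ?C)"
    using eq by auto
  have "(T_meas -` A \<inter> {p..q}) - ?C \<in> sets borel"
    using T_meas_vimage[OF A] by (intro sets.Diff sets.Int) (auto intro: borel_closed finite_imp_closed)
  moreover have "T -` A \<inter> {p..q} \<inter> ?C \<in> sets borel"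
    by (intro borel_closed finite_imp_closed) auto
  ultimately show ?thesis by (subst split) (rule sets.Un)
qed

text \<open>By \<open>T_in\<close> and \<open>T_out\<close> no mass crosses the border of the
  interval, so the restriction of u is itself invariant and, once normalised, must be the unique
  invariant probability measure. Mass 0 is treated apart because it cannot be normalised.\<close>

lemma invariant_density_multiple:
  assumes u: "integrable lborel u" "\<And>x. 0 \<le> u x"
    and inv: "\<And>A. A \<in> sets borel \<Longrightarrow> (LINT x:T_meas -` A|lborel. u x) = (LINT x:A|lborel. u x :: real)"
    and supp: "\<And>x. x \<notin> {0..1} \<Longrightarrow> u x = 0"
    and pq: "{p..q} \<subseteq> {0..1}"
    and T_in: "AE x in lborel. x \<in> {p..q} \<longrightarrow> T_meas x \<in> {p..q}"
    and T_out: "AE x in lborel. x \<in> {0..1} - {p..q} \<longrightarrow> T_meas x \<notin> {p..q}"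
    and uniq: "\<exists>!\<mu>. acim T p q \<mu>" and \<phi>: "acim_density T p q \<phi>"
  shows "AE x in lborel. indicator {p..q} x * u x = (LINT x:{p..q}|lborel. u x) * \<phi> x"
proof -
  define m where "m = (LINT x:{p..q}|lborel. u x)"
  have [measurable]: "u \<in> borel_measurable borel" using u(1) by auto
  have iu: "integrable lborel (\<lambda>x. indicator {p..q} x * u x)"
    using integrable_mult_indicator[of "{p..q}" lborel u] u(1) by simp
  have m0: "0 \<le> m" unfolding m_def set_lebesgue_integral_def using u(2) by (intro Bochner_Integration.integral_nonneg) auto
  show ?thesis
  proof (cases "m = 0")
    case True
    then have "AE x in lborel. indicator {p..q} x * u x = 0"
      using integral_nonneg_eq_0_iff_AE[OF iu] u(2) by (simp add: m_def set_lebesgue_integral_def)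
    then show ?thesis using True by (simp add: m_def)
  next
    case False
    then have m: "0 < m" using m0 by simp
    define v where "v x = indicator {p..q} x * u x / m" for x
    have v: "integrable lborel v" "\<And>x. 0 \<le> v x"
      unfolding v_def[abs_def] using iu u(2) m0 by auto
    have [measurable]: "v \<in> borel_measurable borel" using v(1) by auto
    have v_int: "(LINT x:B|lborel. v x) = (LINT x:B \<inter> {p..q}|lborel. u x) / m" for B
      unfolding set_lebesgue_integral_def v_def
      by (subst integral_divide_zero[symmetric]) (intro Bochner_Integration.integral_cong, auto simp: indicator_def)
    let ?\<mu> = "density lborel (\<lambda>x. ennreal (v x))"
    have em: "emeasure ?\<mu> B = ennreal ((LINT x:B \<inter> {p..q}|lborel. u x) / m)" if "B \<in> sets borel" for B
      using emeasure_density_lborel[OF v that] v_int by simp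
    have "acim T p q ?\<mu>"
      unfolding acim_def
    proof (intro conjI ballI)
      show "sets ?\<mu> = sets borel" by simp
      have "emeasure ?\<mu> UNIV = 1" using em[of UNIV] m by (simp add: m_def)
      then show "prob_space ?\<mu>" by (intro prob_spaceI) simp
      show "absolutely_continuous lborel ?\<mu>" by (intro absolutely_continuousI_density) measurable
      show "emeasure ?\<mu> {p..q} = 1" using em[of "{p..q}"] m by (simp add: m_def)
      fix A :: "real set" assume A: "A \<in> sets borel"
      have "(LINT x:T -` A \<inter> {p..q}|lborel. u x) = (LINT x:T_meas -` (A \<inter> {p..q})|lborel. u x)"
        unfolding set_lebesgue_integral_def
      proof (rule integral_cong_AE)
        show "(\<lambda>x. indicat_real (T -` A \<inter> {p..q}) x *\<^sub>R u x) \<in> borel_measurable lborel"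
          using T_vimage_borel[OF A pq] by measurable
        show "(\<lambda>x. indicat_real (T_meas -` (A \<inter> {p..q})) x *\<^sub>R u x) \<in> borel_measurable lborel"
          using T_meas_vimage[of "A \<inter> {p..q}"] A by measurable
        show "AE x in lborel. indicat_real (T -` A \<inter> {p..q}) x *\<^sub>R u x = indicat_real (T_meas -` (A \<inter> {p..q})) x *\<^sub>R u x"
          using T_in T_out AE_T_meas_eq_T
        proof eventually_elim
          case (elim x)
          show ?case
          proof (cases "x \<in> {0..1}")
            case True
            then have "x \<in> T -` A \<inter> {p..q} \<longleftrightarrow> x \<in> T_meas -` (A \<inter> {p..q})" using elim by auto
            then show ?thesis by (simp add: indicator_def)
          qed (use supp in simp)
        qed
      qed
      also have "\<dots> = (LINT x:A \<inter> {p..q}|lborel. u x)" using inv[of "A \<inter> {p..q}"] A by simp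
      finally show "emeasure ?\<mu> (T -` A \<inter> {p..q}) = emeasure ?\<mu> A"
        using em[OF T_vimage_borel[OF A pq]] em[OF A] by (simp add: Int_assoc)
    qed
    moreover have "acim T p q (density lborel (\<lambda>x. ennreal (\<phi> x)))" using \<phi> by (simp add: acim_density_def)
    ultimately have eq: "?\<mu> = density lborel (\<lambda>x. ennreal (\<phi> x))" using uniq by blast
    have [measurable]: "\<phi> \<in> borel_measurable borel"
      using \<phi> by (auto simp: acim_density_def intro: BV_borel_measurable)
    have "AE x in lborel. ennreal (v x) = ennreal (\<phi> x)"
      using eq by (subst sigma_finite_measure.density_unique_iff[OF sigma_finite_lborel, symmetric]) auto
    then show ?thesis
    proof eventually_elim
      case (elim x)
      have "v x = \<phi> x" using elim v(2) \<phi> by (simp add: acim_density_def)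
      then show ?case using m by (simp add: v_def m_def field_simps)
    qed
  qed
qed

lemma invariant_signed_multiple:
  assumes \<psi>: "integrable lborel \<psi>" "\<And>x. x \<notin> {0..1} \<Longrightarrow> \<psi> x = 0"
    and inv: "\<And>A. A \<in> sets borel \<Longrightarrow> (LINT x:T_meas -` A|lborel. \<psi> x) = (LINT x:A|lborel. \<psi> x :: real)"
    and pq: "{p..q} \<subseteq> {0..1}"
    and T_in: "AE x in lborel. x \<in> {p..q} \<longrightarrow> T_meas x \<in> {p..q}"
    and T_out: "AE x in lborel. x \<in> {0..1} - {p..q} \<longrightarrow> T_meas x \<notin> {p..q}"
    and uniq: "\<exists>!\<mu>. acim T p q \<mu>" and \<phi>: "acim_density T p q \<phi>"
  shows "\<exists>\<alpha>. AE x in lborel. indicator {p..q} x * \<psi> x = \<alpha> * \<phi> x"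
proof -
  have inv': "(LINT x:T_meas -` A|lborel. - \<psi> x) = (LINT x:A|lborel. - \<psi> x)" if "A \<in> sets borel" for A
    using inv[OF that] by (simp add: set_lebesgue_integral_def)
  have "AE x in lborel. indicator {p..q} x * max 0 (\<psi> x) = (LINT x:{p..q}|lborel. max 0 (\<psi> x)) * \<phi> x"
    using \<psi> positive_part_invariance[OF \<psi>(1) inv]
    by (intro invariant_density_multiple[OF _ _ _ _ pq T_in T_out uniq \<phi>] integrable_max) auto
  moreover have "AE x in lborel. indicator {p..q} x * max 0 (- \<psi> x) = (LINT x:{p..q}|lborel. max 0 (- \<psi> x)) * \<phi> x"
    using \<psi> positive_part_invariance[of "\<lambda>x. - \<psi> x", OF _ inv']
    by (intro invariant_density_multiple[OF _ _ _ _ pq T_in T_out uniq \<phi>] integrable_max) auto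
  ultimately have "AE x in lborel. indicator {p..q} x * \<psi> x =
    ((LINT x:{p..q}|lborel. max 0 (\<psi> x)) - (LINT x:{p..q}|lborel. max 0 (- \<psi> x))) * \<phi> x"
  proof eventually_elim
    case (elim x)
    have "indicator {p..q} x * \<psi> x = indicator {p..q} x * max 0 (\<psi> x) - indicator {p..q} x * max 0 (- \<psi> x)"
      by (auto simp: indicator_def max_def)
    then show ?case using elim by (simp add: left_diff_distrib)
  qed
  then show ?thesis by blast
qed

end

lemma acim_density_facts:
  assumes "acim_density T p q \<phi>" "{p..q} \<subseteq> {0..1}"
  shows "integrable lborel \<phi>" "\<And>x. 0 \<le> \<phi> x" "\<And>x. x \<notin> {p..q} \<Longrightarrow> \<phi> x = 0" "(LINT x|lborel. \<phi> x) = 1"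
proof -
  show i: "integrable lborel \<phi>" using assms BV_integrable by (auto simp: acim_density_def)
  show n: "\<And>x. 0 \<le> \<phi> x" "\<And>x. x \<notin> {p..q} \<Longrightarrow> \<phi> x = 0" using assms by (auto simp: acim_density_def)
  have "emeasure (density lborel (\<lambda>x. ennreal (\<phi> x))) {p..q} = 1"
    using assms by (auto simp: acim_density_def acim_def)
  then have "(LINT x:{p..q}|lborel. \<phi> x) = 1"
    using emeasure_density_lborel[OF i n(1), of "{p..q}"] by simp
  moreover have "(LINT x:{p..q}|lborel. \<phi> x) = (LINT x|lborel. \<phi> x)"
    unfolding set_lebesgue_integral_def by (intro Bochner_Integration.integral_cong) (use n(2) in \<open>auto simp: indicator_def\<close>)
  ultimately show "(LINT x|lborel. \<phi> x) = 1" by simp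
qed

text \<open>The two densities overlap at most at b, so \<psi> = \<alpha> \<phi>_l + \<beta> \<phi>_r
  holds almost everywhere, and also with absolute values. Integral 0 gives \<beta> = -\<alpha>, and
  norm 1 gives |\<alpha>| + |\<beta>| = 1.\<close>

lemma (in expanding_branches) limit_identification:
  assumes b: "0 < b" "b < 1"
    and inv_l: "\<And>i x. i < d \<Longrightarrow> x \<in> {c i<..<c (Suc i)} \<Longrightarrow> x \<in> {0<..<b} \<Longrightarrow> F i x \<in> {0..b}"
    and inv_r: "\<And>i x. i < d \<Longrightarrow> x \<in> {c i<..<c (Suc i)} \<Longrightarrow> x \<in> {b<..<1} \<Longrightarrow> F i x \<in> {b..1}"
    and l: "\<exists>!\<mu>. acim T 0 b \<mu>" "acim_density T 0 b \<phi>\<^sub>l"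
    and r: "\<exists>!\<mu>. acim T b 1 \<mu>" "acim_density T b 1 \<phi>\<^sub>r"
    and \<psi>: "integrable lborel \<psi>" "\<And>x. x \<notin> {0..1} \<Longrightarrow> \<psi> x = 0"
    and basic: "\<And>a. (LINT x:T_meas -` {..a}|lborel. \<psi> x) = (LINT x:{..a}|lborel. \<psi> x :: real)"
    and zero: "(LINT x|lborel. \<psi> x) = 0" and norm: "(LINT x|lborel. \<bar>\<psi> x\<bar>) = 1"
  shows "(AE x in lborel. \<psi> x = \<phi>\<^sub>l x / 2 - \<phi>\<^sub>r x / 2) \<or> (AE x in lborel. \<psi> x = - (\<phi>\<^sub>l x / 2 - \<phi>\<^sub>r x / 2))"
proof -
  have fin: "AE x in lborel. x \<notin> {0, b, 1}" by (intro AE_not_in countable_imp_null_set_lborel) auto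
  have Tl: "AE x in lborel. x \<in> {0..b} \<longrightarrow> T_meas x \<in> {0..b}"
    using fin AE_interior
  proof eventually_elim
    case (elim x)
    show ?case
    proof
      assume x: "x \<in> {0..b}"
      then obtain i where i: "i < d" "x \<in> {c i<..<c (Suc i)}" using elim(2) b by auto
      then show "T_meas x \<in> {0..b}" using inv_l[OF i] T_meas_eq[OF i] x elim(1) by auto
    qed
  qed
  have Tr: "AE x in lborel. x \<in> {b..1} \<longrightarrow> T_meas x \<in> {b..1}"
    using fin AE_interior
  proof eventually_elim
    case (elim x)
    show ?case
    proof
      assume x: "x \<in> {b..1}"
      then obtain i where i: "i < d" "x \<in> {c i<..<c (Suc i)}" using elim(2) b by auto
      then show "T_meas x \<in> {b..1}" using inv_r[OF i] T_meas_eq[OF i] x elim(1) by auto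
    qed
  qed
  \<comment> \<open>Points right of b stay in [b,1] and almost never hit b, so they do not enter
    [0,b].\<close>
  have Tl': "AE x in lborel. x \<in> {0..1} - {0..b} \<longrightarrow> T_meas x \<notin> {0..b}"
    using Tr AE_T_meas_neq[of b] by eventually_elim auto
  have Tr': "AE x in lborel. x \<in> {0..1} - {b..1} \<longrightarrow> T_meas x \<notin> {b..1}"
    using Tl AE_T_meas_neq[of b] by eventually_elim auto
  have inv: "(LINT x:T_meas -` A|lborel. \<psi> x) = (LINT x:A|lborel. \<psi> x)" if "A \<in> sets borel" for A
    by (rule signed_invariance[OF \<psi>(1) basic that])
  have sub: "{0..b} \<subseteq> {0..1}" "{b..1} \<subseteq> {0..1}" using b by auto
  obtain \<alpha> where \<alpha>: "AE x in lborel. indicator {0..b} x * \<psi> x = \<alpha> * \<phi>\<^sub>l x"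
    using invariant_signed_multiple[OF \<psi> inv sub(1) Tl Tl' l] by blast
  obtain \<beta> where \<beta>: "AE x in lborel. indicator {b..1} x * \<psi> x = \<beta> * \<phi>\<^sub>r x"
    using invariant_signed_multiple[OF \<psi> inv sub(2) Tr Tr' r] by blast
  note L = acim_density_facts[OF l(2) sub(1)] and R = acim_density_facts[OF r(2) sub(2)]
  have eq: "AE x in lborel. \<psi> x = \<alpha> * \<phi>\<^sub>l x + \<beta> * \<phi>\<^sub>r x \<and> \<bar>\<psi> x\<bar> = \<bar>\<alpha>\<bar> * \<phi>\<^sub>l x + \<bar>\<beta>\<bar> * \<phi>\<^sub>r x"
    using \<alpha> \<beta> fin
  proof eventually_elim
    case (elim x)
    consider "x \<in> {0..<b}" | "x \<in> {b<..1}" | "x \<notin> {0..1}" using elim(3) by force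
    then show ?case
    proof cases
      case 1 then show ?thesis using elim R(3)[of x] L(2)[of x] b by (auto simp: abs_mult)
    next
      case 2 then show ?thesis using elim L(3)[of x] R(2)[of x] b by (auto simp: abs_mult)
    next
      case 3
      then have "x \<notin> {0..b}" "x \<notin> {b..1}" using b by auto
      then show ?thesis using \<psi>(2)[OF 3] L(3)[of x] R(3)[of x] by simp
    qed
  qed
  have [measurable]: "\<psi> \<in> borel_measurable borel" "\<phi>\<^sub>l \<in> borel_measurable borel" "\<phi>\<^sub>r \<in> borel_measurable borel"
    using \<psi>(1) L(1) R(1) by auto
  have "(LINT x|lborel. \<psi> x) = (LINT x|lborel. \<alpha> * \<phi>\<^sub>l x + \<beta> * \<phi>\<^sub>r x)"
    by (intro integral_cong_AE) (use eq in auto)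
  also have "\<dots> = \<alpha> + \<beta>" using L(1,4) R(1,4) by simp
  finally have sum: "\<beta> = - \<alpha>" using zero by simp
  have "(LINT x|lborel. \<bar>\<psi> x\<bar>) = (LINT x|lborel. \<bar>\<alpha>\<bar> * \<phi>\<^sub>l x + \<bar>\<beta>\<bar> * \<phi>\<^sub>r x)"
    by (intro integral_cong_AE) (use eq in auto)
  also have "\<dots> = \<bar>\<alpha>\<bar> + \<bar>\<beta>\<bar>" using L(1,4) R(1,4) by simp
  finally have "\<bar>\<alpha>\<bar> = 1 / 2" using sum norm by simp
  then consider "\<alpha> = 1 / 2" | "\<alpha> = - (1 / 2)" by linarith
  then show ?thesis
  proof cases
    case 1
    from eq have "AE x in lborel. \<psi> x = \<phi>\<^sub>l x / 2 - \<phi>\<^sub>r x / 2" by eventually_elim (simp add: sum 1)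
    then show ?thesis ..
  next
    case 2
    from eq have "AE x in lborel. \<psi> x = - (\<phi>\<^sub>l x / 2 - \<phi>\<^sub>r x / 2)" by eventually_elim (simp add: sum 2)
    then show ?thesis ..
  qed
qed

section \<open>Eigenfunctions\<close>

text \<open>L1 convergence of one factor is combined with bounded almost everywhere convergence of
  the other. The alternative \<open>h x = 0\<close> lets points outside [0,1] be ignored.\<close>

lemma L1_pairing_limit:
  fixes f g :: "nat \<Rightarrow> real \<Rightarrow> real"
  assumes f: "\<And>n. integrable lborel (f n)" and h: "integrable lborel h"
    and lim: "(\<lambda>n. LINT x|lborel. \<bar>f n x - h x\<bar>) \<longlonglongrightarrow> 0"
    and g: "\<And>n. g n \<in> borel_measurable borel" "\<And>n x. \<bar>g n x\<bar> \<le> 1" and G: "G \<in> borel_measurable borel"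
    and conv: "AE x in lborel. h x = 0 \<or> (\<lambda>n. g n x) \<longlonglongrightarrow> G x"
  shows "(\<lambda>n. LINT x|lborel. f n x * g n x) \<longlonglongrightarrow> (LINT x|lborel. h x * G x)"
proof -
  have [measurable]: "h \<in> borel_measurable borel" using h by auto
  note [measurable] = g(1) G
  have hg: "(\<lambda>n. LINT x|lborel. h x * g n x) \<longlonglongrightarrow> (LINT x|lborel. h x * G x)"
  proof (rule integral_dominated_convergence[where w = "\<lambda>x. \<bar>h x\<bar>"])
    show "AE x in lborel. (\<lambda>n. h x * g n x) \<longlonglongrightarrow> h x * G x"
      using conv by eventually_elim (auto intro: tendsto_mult_left)
    show "AE x in lborel. norm (h x * g n x) \<le> \<bar>h x\<bar>" for n
      using g(2) by (intro AE_I2) (auto simp: abs_mult intro: mult_right_le_one_le)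
  qed (use h in auto)
  have "(\<lambda>n. LINT x|lborel. (f n x - h x) * g n x) \<longlonglongrightarrow> 0"
  proof (rule Lim_null_comparison[OF _ lim], intro always_eventually allI)
    fix n
    have "\<bar>LINT x|lborel. (f n x - h x) * g n x\<bar> \<le> 1 * (LINT x|lborel. \<bar>f n x - h x\<bar>)"
      by (rule abs_integral_times_le) (use f h g in auto)
    then show "norm (LINT x|lborel. (f n x - h x) * g n x) \<le> (LINT x|lborel. \<bar>f n x - h x\<bar>)" by simp
  qed
  from tendsto_add[OF this hg]
  have "(\<lambda>n. (LINT x|lborel. (f n x - h x) * g n x) + (LINT x|lborel. h x * g n x)) \<longlonglongrightarrow> (LINT x|lborel. h x * G x)"
    by simp
  moreover have "(LINT x|lborel. (f n x - h x) * g n x) + (LINT x|lborel. h x * g n x) = (LINT x|lborel. f n x * g n x)" for n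
    using integrable_times_bounded[OF f g(1) g(2), of n n] integrable_times_bounded[OF h g(1) g(2), of n]
    by (simp add: left_diff_distrib)
  ultimately show ?thesis by simp
qed

lemma L1_norm_limit:
  fixes f :: "nat \<Rightarrow> real \<Rightarrow> real"
  assumes f: "\<And>n. integrable lborel (f n)" and h: "integrable lborel h"
    and lim: "(\<lambda>n. LINT x|lborel. \<bar>f n x - h x\<bar>) \<longlonglongrightarrow> 0" and norm: "\<And>n. (LINT x|lborel. \<bar>f n x\<bar>) = C"
  shows "(LINT x|lborel. \<bar>h x\<bar>) = C"
proof -
  have "(\<lambda>n. (LINT x|lborel. \<bar>f n x\<bar>) - (LINT x|lborel. \<bar>h x\<bar>)) \<longlonglongrightarrow> 0"
  proof (rule Lim_null_comparison[OF _ lim], intro always_eventually allI)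
    fix n
    have "(LINT x|lborel. \<bar>f n x\<bar>) - (LINT x|lborel. \<bar>h x\<bar>) = (LINT x|lborel. \<bar>f n x\<bar> - \<bar>h x\<bar>)"
      using f h by simp
    also have "\<bar>\<dots>\<bar> \<le> (LINT x|lborel. \<bar>\<bar>f n x\<bar> - \<bar>h x\<bar>\<bar>)" by (rule integral_abs_bound)
    also have "\<dots> \<le> (LINT x|lborel. \<bar>f n x - h x\<bar>)"
      using f h by (intro integral_mono) auto
    finally show "norm ((LINT x|lborel. \<bar>f n x\<bar>) - (LINT x|lborel. \<bar>h x\<bar>)) \<le> (LINT x|lborel. \<bar>f n x - h x\<bar>)" by simp
  qed
  then show ?thesis unfolding norm using LIMSEQ_unique[OF tendsto_const] by fastforce
qed

context branch_family begin

abbreviation Tm :: "real \<Rightarrow> real \<Rightarrow> real" where "Tm \<epsilon> \<equiv> expanding_branches.T_meas (c \<epsilon>) d (\<lambda>i. F i \<epsilon>)"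

lemma interior_one_sided_limits:
  assumes i: "i < d" and x: "x \<in> {c 0 i<..<c 0 (Suc i)}"
  shows "Lim (at_left x) (T 0) = F i 0 x" "Lim (at_right x) (T 0) = F i 0 x"
proof -
  have "x \<in> interior (X i)" using x \<delta>_pos by auto
  then have "isCont (F i 0) x"
    using F_cont[OF i order_refl \<epsilon>\<^sub>0_pos] by (rule continuous_on_interior[rotated])
  then have t: "(F i 0 \<longlongrightarrow> F i 0 x) (at x)" by (simp add: isCont_def)
  have ev: "\<forall>\<^sub>F y in at x. F i 0 y = T 0 y"
    using eventually_at_in_open'[OF open_greaterThanLessThan x]
    by (rule eventually_mono) (use F_eq_T[OF i order_refl \<epsilon>\<^sub>0_pos] in auto)
  have "(T 0 \<longlongrightarrow> F i 0 x) (at x)" using t ev by (rule Lim_transform_eventually)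
  then show "Lim (at_left x) (T 0) = F i 0 x" "Lim (at_right x) (T 0) = F i 0 x"
    by (auto intro!: tendsto_Lim intro: tendsto_within_subset)
qed

text \<open>A point inside an unperturbed cell eventually lies inside the perturbed cell of the same
  index, where the convergence of the branches applies.\<close>

lemma Tm_limit:
  assumes ex: "\<forall>\<^sub>F \<epsilon> in at_right 0. branches \<epsilon> lam M"
    and i: "i < d" and x: "x \<in> {c 0 i<..<c 0 (Suc i)}"
  shows "((\<lambda>\<epsilon>. Tm \<epsilon> x) \<longlongrightarrow> F i 0 x) (at_right 0)"
proof -
  have "x \<in> X i" using x \<delta>_pos by auto
  then have "((\<lambda>\<epsilon>. F i \<epsilon> x) \<longlongrightarrow> F i 0 x) (at_right 0)" using F_unif[OF i] by (rule tendsto_uniform_limitI[rotated])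
  moreover have "\<forall>\<^sub>F \<epsilon> in at_right 0. c \<epsilon> i < x" "\<forall>\<^sub>F \<epsilon> in at_right 0. x < c \<epsilon> (Suc i)"
    using order_tendstoD[OF c_lim[of i]] order_tendstoD[OF c_lim[of "Suc i"]] i x by auto
  then have "\<forall>\<^sub>F \<epsilon> in at_right 0. F i \<epsilon> x = Tm \<epsilon> x"
    using ex by eventually_elim (use i in \<open>simp add: expanding_branches.T_meas_eq\<close>)
  ultimately show ?thesis by (rule Lim_transform_eventually)
qed

text \<open>Quantified over all normalised eigenfunctions and with both signs allowed, so that it
  applies before one of them is singled out. A failure would give a sequence staying at distance at
  least \<open>e\<close> from both candidates, whereas a subsequence converges to one of
  them.\<close>

lemma eigenfunctions_converge:
  assumes m1: "1 < min_expansion (T 0) (c 0 ` {..d})"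
    and alt: "2 < min_expansion (T 0) (c 0 ` {..d}) \<or>
      (\<forall>j n. 0 < j \<longrightarrow> j < d \<longrightarrow> 0 < n \<longrightarrow> c 0 j \<notin> (bivalued_image (T 0) ^^ n) {c 0 j})"
    and \<rho>: "(\<rho> \<longlongrightarrow> 1) (at_right 0)" "\<forall>\<^sub>F \<epsilon> in at_right 0. \<rho> \<epsilon> < 1"
    and b: "0 < b" "b < 1"
    and inv_l: "(\<Union>x\<in>{0..b}. one_sided_values 0 b (T 0) x) \<subseteq> {0..b}"
    and inv_r: "(\<Union>x\<in>{b..1}. one_sided_values b 1 (T 0) x) \<subseteq> {b..1}"
    and l: "\<exists>!\<mu>. acim (T 0) 0 b \<mu>" "acim_density (T 0) 0 b \<phi>\<^sub>l"
    and r: "\<exists>!\<mu>. acim (T 0) b 1 \<mu>" "acim_density (T 0) b 1 \<phi>\<^sub>r"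
    and e: "0 < e"
  shows "\<forall>\<^sub>F \<epsilon> in at_right 0. \<forall>f\<in>BV. perron_frobenius (T \<epsilon>) (c \<epsilon>) d f = (\<lambda>x. \<rho> \<epsilon> * f x) \<longrightarrow>
    (LINT x|lborel. \<bar>f x\<bar>) = 1 \<longrightarrow>
    (LINT x|lborel. \<bar>f x - (\<phi>\<^sub>l x / 2 - \<phi>\<^sub>r x / 2)\<bar>) < e \<or> (LINT x|lborel. \<bar>f x + (\<phi>\<^sub>l x / 2 - \<phi>\<^sub>r x / 2)\<bar>) < e"
    (is "\<forall>\<^sub>F \<epsilon> in _. ?P \<epsilon>")
proof (rule ccontr)
  assume not: "\<not> (\<forall>\<^sub>F \<epsilon> in at_right 0. ?P \<epsilon>)"
  obtain lam where lam: "1 < lam" "lam < min_expansion (T 0) (c 0 ` {..d})" using dense m1 by blast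
  define ex where "ex \<epsilon> M = branches \<epsilon> lam M" for \<epsilon> M
  obtain M where ex0: "ex 0 M" and exp: "\<forall>\<^sub>F \<epsilon> in at_right 0. ex \<epsilon> M"
    using eventually_expanding[OF lam] unfolding ex_def by blast
  have "\<forall>\<^sub>F \<epsilon> in at_right 0. \<rho> \<epsilon> \<le> 1" using \<rho>(2) by eventually_elim simp
  then obtain V where V: "\<forall>\<^sub>F \<epsilon> in at_right 0. \<forall>f\<in>BV. perron_frobenius (T \<epsilon>) (c \<epsilon>) d f = (\<lambda>x. \<rho> \<epsilon> * f x) \<longrightarrow>
    (LINT x|lborel. \<bar>f x\<bar>) \<le> 1 \<longrightarrow> weak_variation_le f V"
    using uniform_weak_variation[OF m1 alt \<rho>(1)] by blast
  define good where "good \<epsilon> \<longleftrightarrow> ex \<epsilon> M \<and> \<rho> \<epsilon> < 1 \<and> (\<forall>f\<in>BV. perron_frobenius (T \<epsilon>) (c \<epsilon>) d f = (\<lambda>x. \<rho> \<epsilon> * f x) \<longrightarrow>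
    (LINT x|lborel. \<bar>f x\<bar>) \<le> 1 \<longrightarrow> weak_variation_le f V)" for \<epsilon>
  have good: "\<forall>\<^sub>F \<epsilon> in at_right 0. good \<epsilon>"
    using exp \<rho>(2) V by eventually_elim (simp add: good_def)
  have "\<exists>\<epsilon>. 0 < \<epsilon> \<and> \<epsilon> < 1 / real (Suc n) \<and> good \<epsilon> \<and> \<not> ?P \<epsilon>" for n
  proof (rule ccontr)
    assume none: "\<nexists>\<epsilon>. 0 < \<epsilon> \<and> \<epsilon> < 1 / real (Suc n) \<and> good \<epsilon> \<and> \<not> ?P \<epsilon>"
    have "\<forall>\<^sub>F \<epsilon> in at_right 0. \<epsilon> \<in> {0<..<1 / real (Suc n)}"
      by (rule eventually_at_right_real) simp
    then have "\<forall>\<^sub>F \<epsilon> in at_right 0. ?P \<epsilon>"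
      using good by eventually_elim (use none in auto)
    then show False using not by blast
  qed
  then have "\<forall>n. \<exists>\<epsilon>. 0 < \<epsilon> \<and> \<epsilon> < 1 / real (Suc n) \<and> good \<epsilon> \<and> \<not> ?P \<epsilon>" ..
  from choice[OF this] obtain \<epsilon> where "\<forall>n. 0 < \<epsilon> n \<and> \<epsilon> n < 1 / real (Suc n) \<and> good (\<epsilon> n) \<and> \<not> ?P (\<epsilon> n)" ..
  then have \<epsilon>: "\<And>n. 0 < \<epsilon> n" "\<And>n. \<epsilon> n < 1 / real (Suc n)" "\<And>n. good (\<epsilon> n)" "\<And>n. \<not> ?P (\<epsilon> n)"
    by simp_all
  have "\<forall>n. \<exists>f. f \<in> BV \<and> perron_frobenius (T (\<epsilon> n)) (c (\<epsilon> n)) d f = (\<lambda>x. \<rho> (\<epsilon> n) * f x) \<and> (LINT x|lborel. \<bar>f x\<bar>) = 1 \<and>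
    e \<le> (LINT x|lborel. \<bar>f x - (\<phi>\<^sub>l x / 2 - \<phi>\<^sub>r x / 2)\<bar>) \<and> e \<le> (LINT x|lborel. \<bar>f x + (\<phi>\<^sub>l x / 2 - \<phi>\<^sub>r x / 2)\<bar>)"
  proof
    fix n
    from \<epsilon>(4)[of n] show "\<exists>f. f \<in> BV \<and> perron_frobenius (T (\<epsilon> n)) (c (\<epsilon> n)) d f = (\<lambda>x. \<rho> (\<epsilon> n) * f x) \<and> (LINT x|lborel. \<bar>f x\<bar>) = 1 \<and>
      e \<le> (LINT x|lborel. \<bar>f x - (\<phi>\<^sub>l x / 2 - \<phi>\<^sub>r x / 2)\<bar>) \<and> e \<le> (LINT x|lborel. \<bar>f x + (\<phi>\<^sub>l x / 2 - \<phi>\<^sub>r x / 2)\<bar>)"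
      by (simp only: not_less Bex_def Ball_def not_all not_imp de_Morgan_disj)
  qed
  from choice[OF this] obtain f where "\<forall>n. f n \<in> BV \<and> perron_frobenius (T (\<epsilon> n)) (c (\<epsilon> n)) d (f n) = (\<lambda>x. \<rho> (\<epsilon> n) * f n x) \<and>
    (LINT x|lborel. \<bar>f n x\<bar>) = 1 \<and> e \<le> (LINT x|lborel. \<bar>f n x - (\<phi>\<^sub>l x / 2 - \<phi>\<^sub>r x / 2)\<bar>) \<and>
    e \<le> (LINT x|lborel. \<bar>f n x + (\<phi>\<^sub>l x / 2 - \<phi>\<^sub>r x / 2)\<bar>)" ..
  then have f: "\<And>n. f n \<in> BV"
    "\<And>n. perron_frobenius (T (\<epsilon> n)) (c (\<epsilon> n)) d (f n) = (\<lambda>x. \<rho> (\<epsilon> n) * f n x)"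
    "\<And>n. (LINT x|lborel. \<bar>f n x\<bar>) = 1"
    "\<And>n. e \<le> (LINT x|lborel. \<bar>f n x - (\<phi>\<^sub>l x / 2 - \<phi>\<^sub>r x / 2)\<bar>)"
    "\<And>n. e \<le> (LINT x|lborel. \<bar>f n x + (\<phi>\<^sub>l x / 2 - \<phi>\<^sub>r x / 2)\<bar>)" by blast+
  have exn: "ex (\<epsilon> n) M" and \<rho>n: "\<rho> (\<epsilon> n) < 1" for n using \<epsilon>(3)[of n] by (auto simp: good_def)
  have fint: "integrable lborel (f n)" for n using BV_integrable[OF f(1)] .
  have f0: "x \<notin> {0..1} \<Longrightarrow> f n x = 0" for n x using BV_eq_0[OF f(1)] .
  have fV: "weak_variation_le (f n) V" for n using \<epsilon>(3)[of n] f(1,2,3)[of n] by (simp add: good_def)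
  obtain s h0 where s: "strict_mono (s :: nat \<Rightarrow> nat)" and h0: "integrable lborel h0"
    and lim0: "(\<lambda>n. LINT x|lborel. \<bar>f (s n) x - h0 x\<bar>) \<longlonglongrightarrow> 0"
    using weak_variation_compactness[of f V 1, OF fint f0 fV] f(3) by auto
  \<comment> \<open>The L1 limit is determined up to null sets only; cutting it off makes it vanish
    outside [0,1] at every point.\<close>
  define h where "h x = indicator {0..1} x * h0 x" for x
  have h: "integrable lborel h" unfolding h_def[abs_def] using integrable_mult_indicator[OF _ h0, of "{0..1}"] by simp
  have h_0: "x \<notin> {0..1} \<Longrightarrow> h x = 0" for x by (simp add: h_def)
  have lim: "(\<lambda>n. LINT x|lborel. \<bar>f (s n) x - h x\<bar>) \<longlonglongrightarrow> 0"
  proof (rule Lim_null_comparison[OF _ lim0], intro always_eventually allI)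
    fix n
    have "(LINT x|lborel. \<bar>f (s n) x - h x\<bar>) \<le> (LINT x|lborel. \<bar>f (s n) x - h0 x\<bar>)"
      by (intro integral_mono integrable_abs Bochner_Integration.integrable_diff fint h h0)
         (use f0 in \<open>auto simp: h_def indicator_def\<close>)
    then show "norm (LINT x|lborel. \<bar>f (s n) x - h x\<bar>) \<le> (LINT x|lborel. \<bar>f (s n) x - h0 x\<bar>)" by simp
  qed
  interpret E0: expanding_branches "T 0" "c 0" d "\<lambda>i. F i 0" "\<lambda>i. F' i 0" "\<lambda>i. F'' i 0" lam M
    using ex0 by (simp add: ex_def)
  have dual: "\<rho> (\<epsilon> n) * (LINT x|lborel. f n x * g x) = (LINT x|lborel. f n x * g (Tm (\<epsilon> n) x))"
    if g: "g \<in> borel_measurable borel" "\<And>x. \<bar>g x\<bar> \<le> B" for n g B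
  proof -
    interpret E: expanding_branches "T (\<epsilon> n)" "c (\<epsilon> n)" d "\<lambda>i. F i (\<epsilon> n)" "\<lambda>i. F' i (\<epsilon> n)" "\<lambda>i. F'' i (\<epsilon> n)" lam M
      using exn by (simp add: ex_def)
    have "perron_frobenius (T (\<epsilon> n)) (c (\<epsilon> n)) d (f n) \<in> BV"
      unfolding f(2) using BV_bounded_linear[OF bounded_linear_mult_right f(1) BV_regulated[OF f(1)]] .
    from E.perron_frobenius_duality[OF f(1) this g] show ?thesis unfolding f(2) by (simp add: mult.assoc)
  qed
  have \<epsilon>_lim: "filterlim (\<lambda>n. \<epsilon> (s n)) (at_right 0) sequentially"
  proof -
    have "\<epsilon> \<longlonglongrightarrow> 0"
      by (rule tendsto_sandwich[OF _ _ tendsto_const LIMSEQ_inverse_real_of_nat])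
         (use \<epsilon>(1,2) in \<open>auto intro!: always_eventually less_imp_le simp: inverse_eq_divide\<close>)
    then have "filterlim \<epsilon> (at_right 0) sequentially"
      using \<epsilon>(1) by (intro tendsto_imp_filterlim_at_right) auto
    then show ?thesis using filterlim_compose[OF _ filterlim_subseq[OF s]] by blast
  qed
  have \<rho>_lim: "(\<lambda>n. \<rho> (\<epsilon> (s n))) \<longlonglongrightarrow> 1" using filterlim_compose[OF \<rho>(1) \<epsilon>_lim] .
  have zero: "(LINT x|lborel. h x) = 0"
  proof -
    \<comment> \<open>Pairing with the constant 1 shows that the integral equals \<rho> times
      itself, and \<rho> < 1.\<close>
    have "(LINT x|lborel. f n x) = 0" for n
    proof -
      have "\<rho> (\<epsilon> n) * (LINT x|lborel. f n x) = (LINT x|lborel. f n x)" using dual[of "\<lambda>_. 1" 1 n] by simp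
      then have "(\<rho> (\<epsilon> n) - 1) * (LINT x|lborel. f n x) = 0" by (simp add: algebra_simps)
      then show ?thesis using \<rho>n[of n] by simp
    qed
    moreover have "(\<lambda>n. LINT x|lborel. f (s n) x * 1) \<longlonglongrightarrow> (LINT x|lborel. h x * 1)"
      by (rule L1_pairing_limit[OF fint h lim]) auto
    ultimately show ?thesis using LIMSEQ_unique[OF tendsto_const] by fastforce
  qed
  have norm: "(LINT x|lborel. \<bar>h x\<bar>) = 1" by (rule L1_norm_limit[OF fint h lim f(3)])
  have basic: "(LINT x:Tm 0 -` {..a}|lborel. h x) = (LINT x:{..a}|lborel. h x)" for a
  proof -
    let ?g = "indicator {..a} :: real \<Rightarrow> real"
    have Tn: "Tm (\<epsilon> n) \<in> borel_measurable borel" for n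
      using expanding_branches.T_meas_measurable exn unfolding ex_def by blast
    have "(\<lambda>n. LINT x|lborel. f (s n) x * ?g (Tm (\<epsilon> (s n)) x)) \<longlonglongrightarrow> (LINT x|lborel. h x * ?g (Tm 0 x))"
    proof (rule L1_pairing_limit[OF fint h lim])
      show "(\<lambda>x. ?g (Tm (\<epsilon> (s n)) x)) \<in> borel_measurable borel" for n using Tn[of "s n"] by measurable
      show "\<bar>?g (Tm (\<epsilon> (s n)) x)\<bar> \<le> 1" for n x by (simp add: indicator_def)
      \<comment> \<open>The indicator jumps only at \<open>a\<close>, and \<open>Tm 0 x\<close>
        differs from \<open>a\<close> for almost every x in [0,1].\<close>
      show "AE x in lborel. h x = 0 \<or> (\<lambda>n. ?g (Tm (\<epsilon> (s n)) x)) \<longlonglongrightarrow> ?g (Tm 0 x)"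
        using E0.AE_interior E0.AE_T_meas_neq[of a]
      proof eventually_elim
        case (elim x)
        show ?case
        proof (cases "x \<in> {0..1}")
          case True
          then obtain i where i: "i < d" "x \<in> {c 0 i<..<c 0 (Suc i)}" using elim(1) by blast
          have "(\<lambda>n. Tm (\<epsilon> (s n)) x) \<longlonglongrightarrow> Tm 0 x"
            using filterlim_compose[OF Tm_limit[OF exp[unfolded ex_def] i] \<epsilon>_lim] E0.T_meas_eq[OF i] by simp
          note lt = order_tendstoD[OF this]
          have "\<forall>\<^sub>F n in sequentially. ?g (Tm (\<epsilon> (s n)) x) = ?g (Tm 0 x)"
          proof (cases "Tm 0 x < a")
            case True
            from lt(2)[OF this] show ?thesis by eventually_elim (use True in \<open>simp add: indicator_def\<close>)
          next
            case False
            then have "a < Tm 0 x" using elim(2) \<open>x \<in> {0..1}\<close> by auto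
            from lt(1)[OF this] show ?thesis by eventually_elim (use \<open>a < Tm 0 x\<close> in \<open>simp add: indicator_def\<close>)
          qed
          then show ?thesis by (simp add: tendsto_eventually)
        qed (use h_0 in simp)
      qed
    qed (use E0.T_meas_measurable in measurable)
    moreover have "(\<lambda>n. LINT x|lborel. f (s n) x * ?g x) \<longlonglongrightarrow> (LINT x|lborel. h x * ?g x)"
      by (rule L1_pairing_limit[OF fint h lim]) (auto simp: indicator_def)
    from tendsto_mult[OF \<rho>_lim this]
    have "(\<lambda>n. LINT x|lborel. f (s n) x * ?g (Tm (\<epsilon> (s n)) x)) \<longlonglongrightarrow> (LINT x|lborel. h x * ?g x)"
      using dual[of ?g 1 "s n" for n] by (simp add: indicator_def)
    ultimately have "(LINT x|lborel. h x * ?g (Tm 0 x)) = (LINT x|lborel. h x * ?g x)"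
      by (rule LIMSEQ_unique)
    moreover have "?g (Tm 0 x) = indicator (Tm 0 -` {..a}) x" for x by (simp add: indicator_def)
    ultimately show ?thesis by (simp add: set_lebesgue_integral_def mult.commute)
  qed
  have disj: "(AE x in lborel. h x = \<phi>\<^sub>l x / 2 - \<phi>\<^sub>r x / 2) \<or> (AE x in lborel. h x = - (\<phi>\<^sub>l x / 2 - \<phi>\<^sub>r x / 2))"
  proof (rule E0.limit_identification[OF b _ _ l r h h_0 basic zero norm])
    fix i x assume i: "i < d" "x \<in> {c 0 i<..<c 0 (Suc i)}"
    note lims = interior_one_sided_limits[OF i]
    show "F i 0 x \<in> {0..b}" if "x \<in> {0<..<b}"
    proof -
      have "F i 0 x \<in> one_sided_values 0 b (T 0) x" using that lims by (auto simp: one_sided_values_def)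
      moreover have "x \<in> {0..b}" using that by simp
      ultimately show ?thesis by (rule inv_l[THEN subsetD, OF UN_I, rotated])
    qed
    show "F i 0 x \<in> {b..1}" if "x \<in> {b<..<1}"
    proof -
      have "F i 0 x \<in> one_sided_values b 1 (T 0) x" using that lims by (auto simp: one_sided_values_def)
      moreover have "x \<in> {b..1}" using that by simp
      ultimately show ?thesis by (rule inv_r[THEN subsetD, OF UN_I, rotated])
    qed
  qed
  have [measurable]: "\<phi>\<^sub>l \<in> borel_measurable borel" "\<phi>\<^sub>r \<in> borel_measurable borel" "h \<in> borel_measurable borel"
    "f n \<in> borel_measurable borel" for n
    using l(2) r(2) h fint by (auto simp: acim_density_def intro: BV_borel_measurable)
  obtain n where n: "(LINT x|lborel. \<bar>f (s n) x - h x\<bar>) < e"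
    using order_tendstoD(2)[OF lim e] by (auto simp: eventually_sequentially)
  from disj show False
  proof
    assume *: "AE x in lborel. h x = \<phi>\<^sub>l x / 2 - \<phi>\<^sub>r x / 2"
    have "(LINT x|lborel. \<bar>f (s n) x - h x\<bar>) = (LINT x|lborel. \<bar>f (s n) x - (\<phi>\<^sub>l x / 2 - \<phi>\<^sub>r x / 2)\<bar>)"
      by (rule integral_cong_AE) (use * in auto)
    then show False using n f(4)[of "s n"] by linarith
  next
    assume *: "AE x in lborel. h x = - (\<phi>\<^sub>l x / 2 - \<phi>\<^sub>r x / 2)"
    have "(LINT x|lborel. \<bar>f (s n) x - h x\<bar>) = (LINT x|lborel. \<bar>f (s n) x + (\<phi>\<^sub>l x / 2 - \<phi>\<^sub>r x / 2)\<bar>)"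
      by (rule integral_cong_AE) (use * in auto)
    then show False using n f(5)[of "s n"] by linarith
  qed
qed

end

text \<open>A nonzero one-sided limit would keep f nonzero on an interval, which is not a null set.
  With all one-sided limits 0, the chosen representative vanishes everywhere.\<close>

lemma BV_AE_zero:
  fixes f :: "real \<Rightarrow> real"
  assumes f: "f \<in> BV" and ae: "AE x in lborel. f x = 0"
  shows "f = (\<lambda>x. 0)"
proof -
  have no_interval: "\<not> (\<forall>y\<in>{u<..<v}. f y \<noteq> 0)" if "u < v" for u v
  proof
    assume *: "\<forall>y\<in>{u<..<v}. f y \<noteq> 0"
    have "AE x in lborel. x \<notin> {u<..<v}" using ae by eventually_elim (use * in auto)
    then have "{u<..<v} \<in> null_sets lborel" by (subst (asm) AE_iff_null_sets[symmetric]) auto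
    then show False using \<open>u < v\<close> by (auto simp: null_sets_def)
  qed
  have "Lim (at_left x) f = 0" if "0 < x" "x \<le> 1" for x
  proof -
    obtain l where l: "(f \<longlongrightarrow> l) (at_left x)" using BV_regulated[OF f] unfolding regulated_def by blast
    have "l = 0"
    proof (rule ccontr)
      assume "l \<noteq> 0"
      then have "\<forall>\<^sub>F y in at_left x. f y \<noteq> 0" by (rule tendsto_imp_eventually_ne[OF l])
      then obtain u where "u < x" "\<forall>y>u. y < x \<longrightarrow> f y \<noteq> 0" by (auto simp: eventually_at_left_field)
      then show False using no_interval[of u x] by auto
    qed
    then show ?thesis using l by (auto intro: tendsto_Lim)
  qed
  moreover have "Lim (at_right x) f = 0" if "0 \<le> x" "x < 1" for x
  proof -
    obtain l where l: "(f \<longlongrightarrow> l) (at_right x)" using BV_regulated[OF f] unfolding regulated_def by blast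
    have "l = 0"
    proof (rule ccontr)
      assume "l \<noteq> 0"
      then have "\<forall>\<^sub>F y in at_right x. f y \<noteq> 0" by (rule tendsto_imp_eventually_ne[OF l])
      then obtain u where "x < u" "\<forall>y>x. y < u \<longrightarrow> f y \<noteq> 0" by (auto simp: eventually_at_right_field)
      then show False using no_interval[of x u] by auto
    qed
    then show ?thesis using l by (auto intro: tendsto_Lim)
  qed
  ultimately have "bv_version f = (\<lambda>x. 0)" by (auto simp: fun_eq_iff bv_version_def)
  then show ?thesis using f by (simp add: BV_def)
qed

text \<open>The operator commutes with real and imaginary parts, \<rho> is real, and one of the two
  parts is not identically 0. By \<open>BV_AE_zero\<close> that part has positive L1 norm and can be
  normalised.\<close>

lemma (in expanding_branches) real_eigenfunction:
  assumes "simple_eigenvalue (perron_frobenius T c d) (complex_of_real \<rho>)"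
  shows "\<exists>f :: real \<Rightarrow> real. f \<in> BV \<and> perron_frobenius T c d f = (\<lambda>x. \<rho> * f x) \<and> (LINT x|lborel. \<bar>f x\<bar>) = 1"
proof -
  obtain f where f: "f \<in> BV" "f \<noteq> (\<lambda>x. 0)" "perron_frobenius T c d f = (\<lambda>x. complex_of_real \<rho> * f x)"
    using assms unfolding simple_eigenvalue_def by blast
  have reg: "regulated f" using BV_complex_regulated[OF f(1)] .
  have "(\<lambda>x. Re (f x)) \<in> BV" "(\<lambda>x. Im (f x)) \<in> BV"
    using BV_bounded_linear[OF bounded_linear_Re f(1) reg] BV_bounded_linear[OF bounded_linear_Im f(1) reg] .
  moreover have "perron_frobenius T c d (\<lambda>x. Re (f x)) = (\<lambda>x. \<rho> * Re (f x))"
    "perron_frobenius T c d (\<lambda>x. Im (f x)) = (\<lambda>x. \<rho> * Im (f x))"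
    using perron_frobenius_bounded_linear[OF bounded_linear_Re reg]
      perron_frobenius_bounded_linear[OF bounded_linear_Im reg] by (simp_all add: f(3))
  moreover have "(\<lambda>x. Re (f x)) \<noteq> (\<lambda>x. 0) \<or> (\<lambda>x. Im (f x)) \<noteq> (\<lambda>x. 0)"
    using f(2) by (auto simp: fun_eq_iff complex_eq_iff)
  ultimately obtain u :: "real \<Rightarrow> real" where u: "u \<in> BV" "perron_frobenius T c d u = (\<lambda>x. \<rho> * u x)" "u \<noteq> (\<lambda>x. 0)"
    by blast
  define m where "m = (LINT x|lborel. \<bar>u x\<bar>)"
  have "m \<noteq> 0"
  proof
    assume "m = 0"
    then have "AE x in lborel. u x = 0"
      using integral_nonneg_eq_0_iff_AE[of lborel "\<lambda>x. \<bar>u x\<bar>"] BV_integrable[OF u(1)] by (simp add: m_def)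
    then show False using BV_AE_zero[OF u(1)] u(3) by blast
  qed
  moreover have "0 \<le> m" by (simp add: m_def)
  ultimately have m: "0 < m" by simp
  have ureg: "regulated u" using BV_regulated[OF u(1)] .
  have bl: "bounded_linear (\<lambda>y::real. inverse m * y)" by (rule bounded_linear_mult_right)
  have "(\<lambda>x. inverse m * u x) \<in> BV" using BV_bounded_linear[OF bl u(1) ureg] .
  moreover have "perron_frobenius T c d (\<lambda>x. inverse m * u x) = (\<lambda>x. \<rho> * (inverse m * u x))"
    using perron_frobenius_bounded_linear[OF bl ureg] by (simp add: u(2) mult.left_commute)
  moreover have "(LINT x|lborel. \<bar>inverse m * u x\<bar>) = 1" using m by (simp add: abs_mult m_def[symmetric])
  ultimately show ?thesis by blast
qed

text \<open>Both functions are complex multiples of one function \<open>k\<close>;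
  cross-multiplication at a point where f does not vanish eliminates \<open>k\<close> and yields a
  real factor.\<close>

lemma (in expanding_branches) real_eigenfunctions_proportional:
  fixes f g :: "real \<Rightarrow> real"
  assumes simple: "simple_eigenvalue (perron_frobenius T c d) (complex_of_real \<rho>)"
    and f: "f \<in> BV" "perron_frobenius T c d f = (\<lambda>x. \<rho> * f x)" "f \<noteq> (\<lambda>x. 0)"
    and g: "g \<in> BV" "perron_frobenius T c d g = (\<lambda>x. \<rho> * g x)"
  shows "\<exists>t. g = (\<lambda>x. t * f x)"
proof -
  obtain k where k: "generalized_eigenspace (perron_frobenius T c d) (complex_of_real \<rho>) = range (\<lambda>(a::complex) x. a * k x)"
    using simple unfolding simple_eigenvalue_def by blast
  have "\<exists>a. (\<lambda>x. complex_of_real (u x)) = (\<lambda>x. a * k x)"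
    if u: "u \<in> BV" "perron_frobenius T c d u = (\<lambda>x. \<rho> * u x)" for u :: "real \<Rightarrow> real"
  proof -
    have reg: "regulated u" using BV_regulated[OF u(1)] .
    have "(\<lambda>x. complex_of_real (u x)) \<in> BV" using BV_bounded_linear[OF bounded_linear_of_real u(1) reg] .
    moreover have "perron_frobenius T c d (\<lambda>x. complex_of_real (u x)) = (\<lambda>x. complex_of_real \<rho> * complex_of_real (u x))"
      using perron_frobenius_bounded_linear[OF bounded_linear_of_real reg] by (simp add: u(2))
    ultimately have "(\<lambda>x. complex_of_real (u x)) \<in> generalized_eigenspace (perron_frobenius T c d) (complex_of_real \<rho>)"
      unfolding generalized_eigenspace_def by (auto intro!: exI[of _ 1])
    then show ?thesis unfolding k by blast
  qed
  from this[OF f(1,2)] this[OF g] obtain a a' where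
    a: "\<And>x. complex_of_real (f x) = a * k x" and a': "\<And>x. complex_of_real (g x) = a' * k x"
    by (meson fun_cong)
  obtain x0 where x0: "f x0 \<noteq> 0" using f(3) by auto
  then have nz: "a \<noteq> 0" "k x0 \<noteq> 0" using a[of x0] by auto
  have "g x = g x0 / f x0 * f x" for x
  proof -
    have "complex_of_real (g x0) * complex_of_real (f x) = complex_of_real (g x) * complex_of_real (f x0)"
      unfolding a a' by (simp add: mult_ac)
    then have "g x0 * f x = g x * f x0" by (metis of_real_eq_iff of_real_mult)
    then show ?thesis using x0 by (simp add: field_simps)
  qed
  then show ?thesis by blast
qed

theorem theorem2:
  fixes T :: "real \<Rightarrow> real \<Rightarrow> real" and c :: "real \<Rightarrow> nat \<Rightarrow> real" and d :: nat
    and b :: real and \<phi>\<^sub>l \<phi>\<^sub>r :: "real \<Rightarrow> real" and \<rho> :: "real \<Rightarrow> real"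
  assumes T0: "piecewise_C2 (T 0) (c 0) d" "1 < min_expansion (T 0) (c 0 ` {..d})"
    and b: "0 < b" "b < 1"
    and inv_l: "(\<Union>x\<in>{0..b}. one_sided_values 0 b (T 0) x) \<subseteq> {0..b}"
    and inv_r: "(\<Union>x\<in>{b..1}. one_sided_values b 1 (T 0) x) \<subseteq> {b..1}"
    and I1_l: "\<exists>!\<mu>. acim (T 0) 0 b \<mu>" "acim_density (T 0) 0 b \<phi>\<^sub>l"
    and I1_r: "\<exists>!\<mu>. acim (T 0) b 1 \<mu>" "acim_density (T 0) b 1 \<phi>\<^sub>r"
    and I2: "\<And>k. 0 < k \<Longrightarrow>
      (bivalued_image (T 0) ^^ k) (c 0 ` {..d}) \<inter> infinitesimal_holes (T 0) b = {}"
    and I3: "\<forall>x \<in> infinitesimal_holes (T 0) b \<inter> {0..b}. 0 < \<phi>\<^sub>l x"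
      "\<forall>x \<in> infinitesimal_holes (T 0) b \<inter> {b..1}. 0 < \<phi>\<^sub>r x"
    and I4: "2 < min_expansion (T 0) (c 0 ` {..d}) \<or>
      (\<forall>x \<in> c 0 ` {..d}. \<forall>n>0. x \<in> (bivalued_image (T 0) ^^ n) {x} \<longrightarrow>
         (x = 0 \<or> x = 1) \<and> one_sided_values 0 1 (T 0) x = {x})"
    and pert: "C2_small_perturbations T c d"
    and P1: "\<And>\<epsilon>. 0 < \<epsilon> \<Longrightarrow> \<exists>!\<mu>. acim (T \<epsilon>) 0 1 \<mu>"
    and P2: "b \<notin> c 0 ` {..d} \<Longrightarrow> \<forall>\<epsilon>>0. T \<epsilon> b = b"
      "b \<in> c 0 ` {..d} \<Longrightarrow> Lim (at_left b) (T 0) < b \<and> b < Lim (at_right b) (T 0) \<and>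
         (\<forall>\<epsilon>>0. b \<in> c \<epsilon> ` {..d})"
    and rho: "second_eigenvalue_near_1 (\<lambda>\<epsilon>. perron_frobenius (T \<epsilon>) (c \<epsilon>) d) \<rho>"
  shows "\<exists>\<psi> :: real \<Rightarrow> real \<Rightarrow> real.
    (\<forall>\<^sub>F \<epsilon> in at_right 0.
       normalized_eigenfunction (perron_frobenius (T \<epsilon>) (c \<epsilon>) d) (\<rho> \<epsilon>) b (\<psi> \<epsilon>) \<and>
       (\<forall>g. normalized_eigenfunction (perron_frobenius (T \<epsilon>) (c \<epsilon>) d) (\<rho> \<epsilon>) b g \<longrightarrow> g = \<psi> \<epsilon>)) \<and>
    ((\<lambda>\<epsilon>. L1_norm (\<lambda>x. \<psi> \<epsilon> x - (\<phi>\<^sub>l x / 2 - \<phi>\<^sub>r x / 2))) \<longlongrightarrow> 0) (at_right 0)"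
proof -
  obtain \<delta> \<epsilon>\<^sub>0 F F' F'' where \<delta>: "0 < \<delta>" "0 < \<epsilon>\<^sub>0" and pert': "\<forall>i<d.
          (\<forall>\<epsilon>\<in>{0..<\<epsilon>\<^sub>0}.
             {c \<epsilon> i..c \<epsilon> (Suc i)} \<subseteq> {c 0 i - \<delta>..c 0 (Suc i) + \<delta>} \<and>
             C2_with_derivs {c 0 i - \<delta>..c 0 (Suc i) + \<delta>} (F i \<epsilon>) (F' i \<epsilon>) (F'' i \<epsilon>) \<and>
             (\<forall>x\<in>{c \<epsilon> i..c \<epsilon> (Suc i)}. F i \<epsilon> x = restr (T \<epsilon>) (c \<epsilon> i) (c \<epsilon> (Suc i)) x)) \<and>
          uniform_limit {c 0 i - \<delta>..c 0 (Suc i) + \<delta>} (F i) (F i 0) (at_right 0) \<and>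
          uniform_limit {c 0 i - \<delta>..c 0 (Suc i) + \<delta>} (F' i) (F' i 0) (at_right 0) \<and>
          uniform_limit {c 0 i - \<delta>..c 0 (Suc i) + \<delta>} (F'' i) (F'' i 0) (at_right 0)"
    using pert unfolding C2_small_perturbations_def by (elim conjE exE) (rule that)
  have pieces: "piecewise_C2 (T \<epsilon>) (c \<epsilon>) d" if "0 \<le> \<epsilon>" for \<epsilon>
    using conjunct1[OF pert[unfolded C2_small_perturbations_def]] T0(1) that by (cases "\<epsilon> = 0") auto
  have c_lim: "((\<lambda>\<epsilon>. c \<epsilon> i) \<longlongrightarrow> c 0 i) (at_right 0)" if "i \<le> d" for i
  proof -
    have "C2_on {0..} (\<lambda>\<epsilon>. c \<epsilon> i)"
      using conjunct1[OF conjunct2[OF pert[unfolded C2_small_perturbations_def]]] that by simp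
    then obtain g' g'' where "C2_with_derivs {0..} (\<lambda>\<epsilon>. c \<epsilon> i) g' g''" by (auto simp: C2_on_def)
    then have "((\<lambda>\<epsilon>. c \<epsilon> i) has_real_derivative g' 0) (at 0 within {0..})"
      by (simp add: C2_with_derivs_def)
    from DERIV_continuous[OF this] have "((\<lambda>\<epsilon>. c \<epsilon> i) \<longlongrightarrow> c 0 i) (at 0 within {0..})"
      by (simp only: continuous_within)
    then show ?thesis by (rule tendsto_within_subset) auto
  qed
  interpret branch_family T c d \<delta> \<epsilon>\<^sub>0 F F' F''
  proof
    fix i \<epsilon> assume *: "i < d" "0 \<le> \<epsilon>" "\<epsilon> < \<epsilon>\<^sub>0"
    then have "\<epsilon> \<in> {0..<\<epsilon>\<^sub>0}" by simp
    note p = bspec[OF conjunct1[OF pert'[rule_format, OF *(1)]] this]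
    show "{c \<epsilon> i..c \<epsilon> (Suc i)} \<subseteq> {c 0 i - \<delta>..c 0 (Suc i) + \<delta>}"
      "C2_with_derivs {c 0 i - \<delta>..c 0 (Suc i) + \<delta>} (F i \<epsilon>) (F' i \<epsilon>) (F'' i \<epsilon>)"
      using p by blast+
    show "F i \<epsilon> x = restr (T \<epsilon>) (c \<epsilon> i) (c \<epsilon> (Suc i)) x" if "x \<in> {c \<epsilon> i..c \<epsilon> (Suc i)}" for x
      using p that by blast
  next
    fix i assume "i < d"
    note p = conjunct2[OF pert'[rule_format, OF this]]
    show "uniform_limit {c 0 i - \<delta>..c 0 (Suc i) + \<delta>} (F i) (F i 0) (at_right 0)"
      "uniform_limit {c 0 i - \<delta>..c 0 (Suc i) + \<delta>} (F' i) (F' i 0) (at_right 0)"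
      "uniform_limit {c 0 i - \<delta>..c 0 (Suc i) + \<delta>} (F'' i) (F'' i 0) (at_right 0)"
      using p by blast+
  qed (use pieces c_lim \<delta> in blast)+
  let ?A = "\<lambda>\<epsilon>. perron_frobenius (T \<epsilon>) (c \<epsilon>) d :: (real \<Rightarrow> real) \<Rightarrow> real \<Rightarrow> real"
  let ?N = "\<lambda>\<epsilon>. normalized_eigenfunction (?A \<epsilon>) (\<rho> \<epsilon>) b"
  define \<phi> where "\<phi> x = \<phi>\<^sub>l x / 2 - \<phi>\<^sub>r x / 2" for x
  have sub: "{0..b} \<subseteq> {0..1}" "{b..1} \<subseteq> {0..1}" using b by auto
  note L = acim_density_facts[OF I1_l(2) sub(1)] and R = acim_density_facts[OF I1_r(2) sub(2)]
  have \<phi>_int: "integrable lborel \<phi>" unfolding \<phi>_def[abs_def] using L(1) R(1) by simp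
  have \<phi>_0: "\<phi> x = 0" if "x \<notin> {0..1}" for x
  proof -
    have "x \<notin> {0..b}" "x \<notin> {b..1}" using that b by auto
    then show ?thesis using L(3)[of x] R(3)[of x] by (simp add: \<phi>_def)
  qed
  \<comment> \<open>The right density meets [0,b] at most in b, so half of the left mass remains.
    Its sign tells the two candidate limits apart.\<close>
  have \<phi>_half: "(LINT x|lborel. \<phi> x * indicator {0..b} x) = 1 / 2"
  proof -
    have [measurable]: "\<phi> \<in> borel_measurable borel" "\<phi>\<^sub>l \<in> borel_measurable borel" using \<phi>_int L(1) by auto
    have "AE x in lborel. x \<notin> {b}" by (intro AE_not_in countable_imp_null_set_lborel) auto
    then have "AE x in lborel. \<phi> x * indicator {0..b} x = \<phi>\<^sub>l x / 2"
      by eventually_elim (use L(3) R(3) in \<open>auto simp: \<phi>_def indicator_def\<close>)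
    then have "(LINT x|lborel. \<phi> x * indicator {0..b} x) = (LINT x|lborel. \<phi>\<^sub>l x / 2)"
      by (intro integral_cong_AE) auto
    then show ?thesis using L(4) by simp
  qed
  \<comment> \<open>Critical points of index strictly between 0 and d lie strictly between 0 and 1,
    so the exception in the periodicity assumption cannot concern them.\<close>
  have alt: "2 < min_expansion (T 0) (c 0 ` {..d}) \<or>
      (\<forall>j n. 0 < j \<longrightarrow> j < d \<longrightarrow> 0 < n \<longrightarrow> c 0 j \<notin> (bivalued_image (T 0) ^^ n) {c 0 j})"
  proof -
    have "0 < c 0 j" "c 0 j < 1" if "0 < j" "j < d" for j
      using partition_mono[of d "c 0" "Suc 0" j, OF c_less] partition_mono[of d "c 0" "Suc j" d, OF c_less]
        c_less[of 0 0] c_less[of 0 j] c_ends[of 0] that by auto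
    then have inner: "c 0 j \<noteq> 0 \<and> c 0 j \<noteq> 1" if "0 < j" "j < d" for j
      using that by (metis less_irrefl)
    from I4 show ?thesis
    proof
      assume np: "\<forall>x \<in> c 0 ` {..d}. \<forall>n>0. x \<in> (bivalued_image (T 0) ^^ n) {x} \<longrightarrow>
         (x = 0 \<or> x = 1) \<and> one_sided_values 0 1 (T 0) x = {x}"
      have "c 0 j \<notin> (bivalued_image (T 0) ^^ n) {c 0 j}" if j: "0 < j" "j < d" "0 < n" for j n
      proof
        assume "c 0 j \<in> (bivalued_image (T 0) ^^ n) {c 0 j}"
        moreover have "c 0 j \<in> c 0 ` {..d}" using j by simp
        ultimately show False using np j(3) inner[OF j(1,2)] by metis
      qed
      then show ?thesis by simp
    qed simp
  qed
  have \<rho>_lim: "(\<rho> \<longlongrightarrow> 1) (at_right 0)" using rho by (simp add: second_eigenvalue_near_1_def)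
  have \<rho>_ev: "\<forall>\<^sub>F \<epsilon> in at_right 0. \<rho> \<epsilon> < 1"
    and simple_ev: "\<forall>\<^sub>F \<epsilon> in at_right 0. simple_eigenvalue (perron_frobenius (T \<epsilon>) (c \<epsilon>) d) (complex_of_real (\<rho> \<epsilon>))"
  proof -
    obtain \<delta>' where "\<forall>\<^sub>F \<epsilon> in at_right 0. \<rho> \<epsilon> < 1 \<and>
        BV_spectrum (perron_frobenius (T \<epsilon>) (c \<epsilon>) d) \<inter> ball 1 \<delta>' = {1, complex_of_real (\<rho> \<epsilon>)} \<and>
        simple_eigenvalue (perron_frobenius (T \<epsilon>) (c \<epsilon>) d) 1 \<and>
        simple_eigenvalue (perron_frobenius (T \<epsilon>) (c \<epsilon>) d) (complex_of_real (\<rho> \<epsilon>))"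
      using rho unfolding second_eigenvalue_near_1_def by blast
    then show "\<forall>\<^sub>F \<epsilon> in at_right 0. \<rho> \<epsilon> < 1"
      "\<forall>\<^sub>F \<epsilon> in at_right 0. simple_eigenvalue (perron_frobenius (T \<epsilon>) (c \<epsilon>) d) (complex_of_real (\<rho> \<epsilon>))"
      by (simp_all add: eventually_conj_iff)
  qed
  obtain lam where "1 < lam" "lam < min_expansion (T 0) (c 0 ` {..d})" using dense T0(2) by blast
  then obtain M where ex_ev: "\<forall>\<^sub>F \<epsilon> in at_right 0.
      branches \<epsilon> lam M"
    using eventually_expanding by blast
  have close: "\<forall>\<^sub>F \<epsilon> in at_right 0. \<forall>f\<in>BV. ?A \<epsilon> f = (\<lambda>x. \<rho> \<epsilon> * f x) \<longrightarrow>
    (LINT x|lborel. \<bar>f x\<bar>) = 1 \<longrightarrow> (LINT x|lborel. \<bar>f x - \<phi> x\<bar>) < e \<or> (LINT x|lborel. \<bar>f x + \<phi> x\<bar>) < e"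
    if "0 < e" for e
    using eigenfunctions_converge[OF T0(2) alt \<rho>_lim \<rho>_ev b inv_l inv_r I1_l I1_r that] unfolding \<phi>_def .
  \<comment> \<open>With s = 1 or s = -1: closeness to \<phi> or to -\<phi> forces the mass on [0,b]
    to be near 1/2 or -1/2.\<close>
  have mass: "\<bar>(LINT x|lborel. f x * indicator {0..b} x) - s / 2\<bar> \<le> (LINT x|lborel. \<bar>f x - s * \<phi> x\<bar>)"
    if f: "integrable lborel f" for f s
  proof -
    have i: "integrable lborel (\<lambda>x. f x * indicator {0..b} x)" "integrable lborel (\<lambda>x. \<phi> x * indicator {0..b} x)"
      by (intro integrable_times_bounded[of _ _ 1] f \<phi>_int; auto simp: indicator_def)+
    have "(LINT x|lborel. (f x - s * \<phi> x) * indicator {0..b} x) = (LINT x|lborel. f x * indicator {0..b} x - s * (\<phi> x * indicator {0..b} x))"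
      by (simp add: left_diff_distrib mult.assoc)
    also have "\<dots> = (LINT x|lborel. f x * indicator {0..b} x) - s / 2"
      using i by (simp add: \<phi>_half)
    finally have "(LINT x|lborel. f x * indicator {0..b} x) - s / 2 = (LINT x|lborel. (f x - s * \<phi> x) * indicator {0..b} x)" by simp
    moreover have "\<bar>LINT x|lborel. (f x - s * \<phi> x) * indicator {0..b} x\<bar> \<le> 1 * (LINT x|lborel. \<bar>f x - s * \<phi> x\<bar>)"
      by (rule abs_integral_times_le) (use f \<phi>_int in \<open>auto simp: indicator_def\<close>)
    ultimately show ?thesis by simp
  qed
  have N_iff: "?N \<epsilon> f \<longleftrightarrow> f \<in> BV \<and> ?A \<epsilon> f = (\<lambda>x. \<rho> \<epsilon> * f x) \<and> (LINT x|lborel. \<bar>f x\<bar>) = 1 \<and>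
    0 < (LINT x|lborel. f x * indicator {0..b} x)" for \<epsilon> f
    using L1_norm_eq_lborel[of f] BV_eq_0[of f]
    unfolding normalized_eigenfunction_def set_lebesgue_integral_def by (auto simp: mult.commute)
  \<comment> \<open>As 1/4 < 1/2, an eigenfunction this close to \<phi> or -\<phi> has nonzero mass
    on [0,b], so multiplication by the sign of that mass normalises it.\<close>
  have unique: "\<forall>\<^sub>F \<epsilon> in at_right 0. \<exists>!f. ?N \<epsilon> f"
    using simple_ev ex_ev close[of "1 / 4", simplified]
  proof eventually_elim
    case (elim \<epsilon>)
    interpret E: expanding_branches "T \<epsilon>" "c \<epsilon>" d "\<lambda>i. F i \<epsilon>" "\<lambda>i. F' i \<epsilon>" "\<lambda>i. F'' i \<epsilon>" lam M
      using elim(2) .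
    obtain u where u: "u \<in> BV" "?A \<epsilon> u = (\<lambda>x. \<rho> \<epsilon> * u x)" "(LINT x|lborel. \<bar>u x\<bar>) = 1"
      using E.real_eigenfunction[OF elim(1)] by blast
    let ?m = "LINT x|lborel. u x * indicator {0..b} x"
    have "(LINT x|lborel. \<bar>u x - \<phi> x\<bar>) < 1 / 4 \<or> (LINT x|lborel. \<bar>u x + \<phi> x\<bar>) < 1 / 4"
      using elim(3) u by (simp add: mult.commute)
    then have "?m \<noteq> 0"
      using mass[OF BV_integrable[OF u(1)], of 1] mass[OF BV_integrable[OF u(1)], of "-1"] by auto
    define v where "v x = sgn ?m * u x" for x
    have sgn: "\<bar>sgn ?m\<bar> = 1" using \<open>?m \<noteq> 0\<close> by (simp add: abs_sgn_eq)
    have ureg: "regulated u" using BV_regulated[OF u(1)] .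
    have bl: "bounded_linear (\<lambda>y::real. sgn ?m * y)" by (rule bounded_linear_mult_right)
    have "v \<in> BV" unfolding v_def[abs_def] using BV_bounded_linear[OF bl u(1) ureg] .
    moreover have "?A \<epsilon> v = (\<lambda>x. \<rho> \<epsilon> * v x)"
      unfolding v_def[abs_def] E.perron_frobenius_bounded_linear[OF bl ureg] u(2) by (simp add: mult.left_commute)
    moreover have "(LINT x|lborel. \<bar>v x\<bar>) = 1" using u(3) sgn by (simp add: v_def abs_mult)
    moreover have "(LINT x|lborel. v x * indicator {0..b} x) = \<bar>?m\<bar>"
      by (simp add: v_def mult.assoc abs_sgn mult.commute[of ?m])
    ultimately have v: "?N \<epsilon> v" using \<open>?m \<noteq> 0\<close> unfolding N_iff by simp
    show ?case
    proof (rule ex1I[of "?N \<epsilon>" v])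
      show "?N \<epsilon> v" by fact
    next
      fix g assume "?N \<epsilon> g"
      then have g: "g \<in> BV" "?A \<epsilon> g = (\<lambda>x. \<rho> \<epsilon> * g x)" "(LINT x|lborel. \<bar>g x\<bar>) = 1"
        "0 < (LINT x|lborel. g x * indicator {0..b} x)" unfolding N_iff by auto
      have v': "v \<in> BV" "?A \<epsilon> v = (\<lambda>x. \<rho> \<epsilon> * v x)" "(LINT x|lborel. \<bar>v x\<bar>) = 1"
        "0 < (LINT x|lborel. v x * indicator {0..b} x)" using v unfolding N_iff by auto
      have "v \<noteq> (\<lambda>x. 0)" using v'(3) by auto
      then obtain t where t: "g = (\<lambda>x. t * v x)"
        using E.real_eigenfunctions_proportional[OF elim(1) v'(1,2) _ g(1,2)] by blast
      have "\<bar>t\<bar> = 1" using g(3) v'(3) unfolding t by (simp add: abs_mult)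
      moreover have "0 < t" using g(4) v'(4) unfolding t by (simp add: mult.assoc zero_less_mult_iff)
      ultimately show "g = v" unfolding t by simp
    qed
  qed
  \<comment> \<open>The value is unspecified where existence or uniqueness fails; only small
    \<epsilon> enter the claim.\<close>
  define \<psi> where "\<psi> \<epsilon> = (THE f. ?N \<epsilon> f)" for \<epsilon>
  have \<psi>: "\<forall>\<^sub>F \<epsilon> in at_right 0. ?N \<epsilon> (\<psi> \<epsilon>) \<and> (\<forall>g. ?N \<epsilon> g \<longrightarrow> g = \<psi> \<epsilon>)"
    using unique by eventually_elim (metis \<psi>_def theI' )
  have "((\<lambda>\<epsilon>. L1_norm (\<lambda>x. \<psi> \<epsilon> x - \<phi> x)) \<longlongrightarrow> 0) (at_right 0)"
  proof (rule tendstoI)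
    fix e :: real assume "0 < e"
    then have "0 < min e (1 / 4)" by simp
    from close[OF this] \<psi> show "\<forall>\<^sub>F \<epsilon> in at_right 0. dist (L1_norm (\<lambda>x. \<psi> \<epsilon> x - \<phi> x)) 0 < e"
    proof eventually_elim
      case (elim \<epsilon>)
      have p: "\<psi> \<epsilon> \<in> BV" "?A \<epsilon> (\<psi> \<epsilon>) = (\<lambda>x. \<rho> \<epsilon> * \<psi> \<epsilon> x)" "(LINT x|lborel. \<bar>\<psi> \<epsilon> x\<bar>) = 1"
        "0 < (LINT x|lborel. \<psi> \<epsilon> x * indicator {0..b} x)" using elim(2) unfolding N_iff by auto
      \<comment> \<open>Closeness to -\<phi> would make the mass on [0,b] negative, below -1/4,
        against the sign normalisation.\<close>
      have "\<not> (LINT x|lborel. \<bar>\<psi> \<epsilon> x + \<phi> x\<bar>) < min e (1 / 4)"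
        using mass[OF BV_integrable[OF p(1)], of "-1"] p(4) by auto
      then have "(LINT x|lborel. \<bar>\<psi> \<epsilon> x - \<phi> x\<bar>) < e" using elim(1) p(1-3) by force
      moreover have "L1_norm (\<lambda>x. \<psi> \<epsilon> x - \<phi> x) = (LINT x|lborel. \<bar>\<psi> \<epsilon> x - \<phi> x\<bar>)"
        using L1_norm_eq_lborel[of "\<lambda>x. \<psi> \<epsilon> x - \<phi> x"] BV_eq_0[OF p(1)] \<phi>_0 by simp
      ultimately show ?case by (simp add: dist_real_def)
    qed
  qed
  then show ?thesis using \<psi> unfolding \<phi>_def by blast
qed

end
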